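(* Let $n_1 \geq n_2 \geq n_3 \geq 2$ be integers with $n_1 \geq 5$. The number $\ell(n_1,n_2,n_3)$ of subdirect products of $S_{n_1}\times S_{n_2}\times S_{n_3}$ is \[\ell(n_1,n_2,n_3) = \begin{cases} (n_1!)^{2} + 6\,n_1! + 6 & \text{if } n_1 = n_2 = n_3 \neq 6,\\ 2082246 & \text{if } n_1 = n_2 = n_3 = 6,\\ 66 & \text{if } n_2 = n_3 = 4,\\ 18 & \text{if } n_2 \in\{3,4\},\ n_3 = 3,\\ 2886 & \text{if } \{n_1,n_2,n_3\} = \{6,6,m_2\} \text{ as multisets, } m_2 \neq 6,\\ 2\,m_1! + 6 & \text{if } \{n_1,n_2,n_3\} = \{m_1,m_1,m_2\} \text{ as multisets, } m_1 \neq m_2,\ 6 \neq m_1 \geq 5,\\ 6 & \text{otherwise.} \end{cases}\]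
   Context: $S_n$ is the symmetric group on $n$ elements. A subgroup $\Delta\leq G_1\times G_2\times G_3$ is a subdirect product of $G_1\times G_2\times G_3$ if its projection to each of the three coordinates is surjective. The number counts subgroups (as subsets), not isomorphism or conjugacy classes. *)

theory Defs
  imports "HOL-Algebra.Sym_Groups" "HOL-Library.Multiset"
begin

text \<open>\<open>\<times>\<times>\<close> associates to the right, so elements of the product are triples \<open>(x, y, z)\<close>.\<close>

definition subdirect_product3 ::
  "('a \<times> 'b \<times> 'c) set \<Rightarrow> 'a monoid \<Rightarrow> 'b monoid \<Rightarrow> 'c monoid \<Rightarrow> bool" where
  "subdirect_product3 \<Delta> G1 G2 G3 \<longleftrightarrow>
     subgroup \<Delta> (G1 \<times>\<times> G2 \<times>\<times> G3) \<and>
     (\<lambda>(x, y, z). x) ` \<Delta> = carrier G1 \<and>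
     (\<lambda>(x, y, z). y) ` \<Delta> = carrier G2 \<and>
     (\<lambda>(x, y, z). z) ` \<Delta> = carrier G3"

definition num_subdirect :: "nat \<Rightarrow> nat \<Rightarrow> nat \<Rightarrow> nat" where
  "num_subdirect n1 n2 n3 =
     card {\<Delta>. subdirect_product3 \<Delta> (sym_group n1) (sym_group n2) (sym_group n3)}"

end

theory Submission
  imports Defs
begin

text \<open>By Goursat's lemma, the subdirect products \<open>D\<close> of \<open>G \<times> H\<close> with \<open>{x. (x, 1) \<in> D}\<close> equal to the kernel
  of a fixed epimorphism \<open>G \<rightarrow> Q\<close> correspond to the epimorphisms \<open>H \<rightarrow> Q\<close>. A subdirect product of three
  symmetric groups is a subdirect product of \<open>S_{n1}\<close> and its image \<open>P\<close> in \<open>S_{n2} \<times> S_{n3}\<close>, which is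
  itself subdirect. As \<open>n1 \<ge> 5\<close>, the normal subgroups of \<open>S_{n1}\<close> are \<open>1\<close>, \<open>A_{n1}\<close> and \<open>S_{n1}\<close>,
  so each \<open>P\<close> contributes \<open>1 + |Epi(P, C_2)| + |Epi(P, S_{n1})|\<close>. A nontrivial character of \<open>P\<close> is unique unless
  \<open>P\<close> is the full product, which has three. As two commuting normal subgroups of \<open>S_{n1}\<close> cannot both be
  nontrivial, an epimorphism from \<open>P\<close> onto \<open>S_{n1}\<close> factors through one of the two projections. What
  remains is the number of automorphisms of \<open>S_n\<close>, and the quotient \<open>S_3\<close> of \<open>S_4\<close>.

  Automorphisms preserve the property of a class of involutions that any two of its members have a
  product of order at most 3. For \<open>n \<noteq> 6\<close> essentially only the transpositions have it, so every
  automorphism permutes the transpositions and is inner. For \<open>n = 6\<close> the products of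
  three disjoint transpositions have it too, and the action on the six synthematic totals provides an
  outer automorphism.\<close>

section \<open>Subdirect products and Goursat's lemma\<close>

text \<open>Origin of the constants. Let \<open>p\<close> be the number of subdirect
  \<open>P\<close> in \<open>S_n2 x S_n3\<close>. Adding \<open>1 + |Epi(P, C_2)|\<close> over all
  \<open>P\<close> gives \<open>2p + 2\<close>: the full product contributes 4, every other
  \<open>P\<close> contributes 2. For \<open>n2 < n1\<close> this is the whole count, so
  \<open>p = 2\<close> yields 6, \<open>p = 2 + 6\<close> yields 18, and \<open>S_4 x S_4\<close>
  with \<open>p = 2 + 24 + 6\<close> yields 66. The value \<open>2A + 6\<close>, where
  \<open>A = |Aut(S_m)|\<close>, arises in two ways: from \<open>p = 2 + A\<close> if the two equal
  degrees are the lower ones, and from \<open>p = 2\<close> with \<open>A\<close> epimorphisms onto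
  \<open>S_n1\<close> for each \<open>P\<close> if they are the upper ones. For three equal degrees
  \<open>p = A + 2\<close>; the \<open>A\<close> graphs of automorphisms have only \<open>A\<close>
  epimorphisms each, since both projections are isomorphisms, the other two \<open>P\<close> have
  \<open>2A\<close>, and the total is \<open>A^2 + 6A + 6\<close>. Degree 6 has
  \<open>A = 1440\<close>. Only the largest degree is assumed to be at least 5. The others may be 2,
  3 or 4, so normal subgroups have to be classified in every degree, including the coincidence
  \<open>A_2 = 1\<close> and the Klein four-group in \<open>S_4\<close>.\<close>

text \<open>\<open>extensional\<close> fixes the values outside the carrier, so that distinct
  elements differ somewhere on \<open>G\<close> and \<open>card\<close> really counts
  epimorphisms.\<close>

definition epis :: "('a, 'm) monoid_scheme \<Rightarrow> ('b, 'n) monoid_scheme \<Rightarrow> ('a \<Rightarrow> 'b) set" where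
  "epis G H = {f \<in> hom G H \<inter> extensional (carrier G). f ` carrier G = carrier H}"

definition subdirect :: "('a \<times> 'b) set \<Rightarrow> ('a, 'm) monoid_scheme \<Rightarrow> ('b, 'n) monoid_scheme \<Rightarrow> bool" where
  "subdirect D G H \<longleftrightarrow> subgroup D (G \<times>\<times> H) \<and> fst ` D = carrier G \<and> snd ` D = carrier H"

definition fst_kernel :: "('a \<times> 'b) set \<Rightarrow> ('b, 'n) monoid_scheme \<Rightarrow> 'a set" where
  "fst_kernel D H = {x. (x, \<one>\<^bsub>H\<^esub>) \<in> D}"

lemma restrict_in_epis_iff:
  "restrict f (carrier G) \<in> epis G H \<longleftrightarrow> f \<in> hom G H \<and> f ` carrier G = carrier H"
  if "group G"
proof -
  interpret group G by fact
  show ?thesis by (auto simp: epis_def hom_def Pi_iff)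
qed

lemma episD:
  assumes "f \<in> epis G H"
  shows "f \<in> hom G H" "f \<in> extensional (carrier G)" "f ` carrier G = carrier H"
  using assms by (auto simp: epis_def)

lemma epis_group_hom: "\<lbrakk>f \<in> epis G H; group G; group H\<rbrakk> \<Longrightarrow> group_hom G H f"
  by (simp add: epis_def group_hom_def group_hom_axioms_def)

lemma finite_epis:
  assumes "finite (carrier G)" "finite (carrier H)"
  shows "finite (epis G H)"
proof (rule finite_subset)
  show "epis G H \<subseteq> (\<Pi>\<^sub>E x\<in>carrier G. carrier H)"
    by (auto simp: epis_def hom_def PiE_def)
  show "finite (\<Pi>\<^sub>E x\<in>carrier G. carrier H)"
    using assms by (intro finite_PiE) auto
qed

lemma epis_eqI:
  "\<lbrakk>f \<in> epis G H; g \<in> epis G K; \<And>x. x \<in> carrier G \<Longrightarrow> f x = g x\<rbrakk> \<Longrightarrow> f = g"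
  by (auto simp: epis_def intro: extensionalityI)

lemma epis_card_le:
  assumes "f \<in> epis G H" "finite (carrier G)"
  shows "card (carrier H) \<le> card (carrier G)"
  using assms card_image_le by (metis episD(3))

lemma subdirectD:
  assumes "subdirect D G H"
  shows "subgroup D (G \<times>\<times> H)" "fst ` D = carrier G" "snd ` D = carrier H"
  using assms by (auto simp: subdirect_def)

lemma subdirect_mult:
  assumes "subdirect D G H" "(x, y) \<in> D" "(x', y') \<in> D"
  shows "(x \<otimes>\<^bsub>G\<^esub> x', y \<otimes>\<^bsub>H\<^esub> y') \<in> D"
  using subgroup.m_closed[OF subdirectD(1)[OF assms(1)] assms(2,3)] by simp

lemma subdirect_subset: "subdirect D G H \<Longrightarrow> D \<subseteq> carrier G \<times> carrier H"
  using subgroup.subset[of D "G \<times>\<times> H"] by (simp add: subdirect_def)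

lemma subdirect_carrier:
  assumes "subdirect D G H" "(x, y) \<in> D"
  shows "x \<in> carrier G" "y \<in> carrier H"
  using subgroup.subset[OF subdirectD(1)[OF assms(1)]] assms(2) by auto

lemma subdirect_one: "subdirect D G H \<Longrightarrow> (\<one>\<^bsub>G\<^esub>, \<one>\<^bsub>H\<^esub>) \<in> D"
  using subgroup.one_closed[OF subdirectD(1)] by simp

lemma subdirect_inv:
  assumes "group G" "group H" "subdirect D G H" "(x, y) \<in> D"
  shows "(inv\<^bsub>G\<^esub> x, inv\<^bsub>H\<^esub> y) \<in> D"
  using subgroup.m_inv_closed[OF subdirectD(1)[OF assms(3)] assms(4)]
    subdirect_carrier[OF assms(3,4)] assms(1,2) by (simp add: inv_DirProd)

lemma subdirect_fst_ex:
  assumes "subdirect D G H" "x \<in> carrier G" shows "\<exists>y. (x, y) \<in> D"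
  using assms by (force simp: subdirect_def image_iff)

lemma subdirect_snd_ex:
  assumes "subdirect D G H" "y \<in> carrier H" shows "\<exists>x. (x, y) \<in> D"
  using assms by (force simp: subdirect_def image_iff)

text \<open>Conjugation by \<open>x\<close> lifts to conjugation by some \<open>(x, y)\<close> in
  \<open>D\<close>, because \<open>D\<close> projects onto \<open>G\<close>; in the second
  coordinate it fixes the identity.\<close>

lemma fst_kernel_normal:
  assumes G: "group G" and H: "group H" and D: "subdirect D G H"
  shows "fst_kernel D H \<lhd> G"
proof -
  interpret G: group G by fact
  interpret H: group H by fact
  note c = subdirect_carrier[OF D]
  show ?thesis
  proof (rule G.normal_invI)
    show "subgroup (fst_kernel D H) G"
    proof (rule G.subgroupI)
      show "fst_kernel D H \<subseteq> carrier G" using c by (auto simp: fst_kernel_def)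
      show "fst_kernel D H \<noteq> {}" using subdirect_one[OF D] by (auto simp: fst_kernel_def)
      show "inv\<^bsub>G\<^esub> a \<in> fst_kernel D H" if "a \<in> fst_kernel D H" for a
        using subdirect_inv[OF G H D] that by (fastforce simp: fst_kernel_def)
      show "a \<otimes>\<^bsub>G\<^esub> b \<in> fst_kernel D H" if "a \<in> fst_kernel D H" "b \<in> fst_kernel D H" for a b
        using subdirect_mult[OF D] that by (fastforce simp: fst_kernel_def)
    qed
    fix x h assume x: "x \<in> carrier G" and h: "h \<in> fst_kernel D H"
    obtain y where y: "(x, y) \<in> D" using subdirect_fst_ex[OF D x] by auto
    have "(x \<otimes>\<^bsub>G\<^esub> h \<otimes>\<^bsub>G\<^esub> inv\<^bsub>G\<^esub> x, y \<otimes>\<^bsub>H\<^esub> \<one>\<^bsub>H\<^esub> \<otimes>\<^bsub>H\<^esub> inv\<^bsub>H\<^esub> y) \<in> D"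
      using h y by (intro subdirect_mult[OF D] subdirect_inv[OF G H D]) (auto simp: fst_kernel_def)
    then show "x \<otimes>\<^bsub>G\<^esub> h \<otimes>\<^bsub>G\<^esub> inv\<^bsub>G\<^esub> x \<in> fst_kernel D H"
      using c[OF y] by (simp add: fst_kernel_def)
  qed
qed

definition fibre_product ::
  "('a, 'm) monoid_scheme \<Rightarrow> ('b, 'n) monoid_scheme \<Rightarrow> ('a \<Rightarrow> 'c) \<Rightarrow> ('b \<Rightarrow> 'c) \<Rightarrow> ('a \<times> 'b) set" where
  "fibre_product G H p f = {(x, y). x \<in> carrier G \<and> y \<in> carrier H \<and> p x = f y}"

lemma subdirect_fibre_product:
  assumes G: "group G" and H: "group H" and Q: "group Q"
    and p: "p \<in> hom G Q" "p ` carrier G = carrier Q" and f: "f \<in> epis H Q"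
  shows "subdirect (fibre_product G H p f) G H" "fst_kernel (fibre_product G H p f) H = kernel G Q p"
proof -
  interpret p: group_hom G Q p using G Q p by (simp add: group_hom_def group_hom_axioms_def)
  interpret f: group_hom H Q f using f H Q by (simp add: epis_group_hom)
  interpret GH: group "G \<times>\<times> H" using G H by (rule DirProd_group)
  have "subgroup (fibre_product G H p f) (G \<times>\<times> H)"
  proof (rule GH.subgroupI)
    have "(\<one>\<^bsub>G\<^esub>, \<one>\<^bsub>H\<^esub>) \<in> fibre_product G H p f" by (simp add: fibre_product_def)
    then show "fibre_product G H p f \<noteq> {}" by auto
  qed (auto simp: fibre_product_def G H)
  moreover have "fst ` fibre_product G H p f = carrier G"
  proof -
    have "\<exists>y\<in>carrier H. p x = f y" if "x \<in> carrier G" for x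
      using that p(2) episD(3)[OF f] by (metis image_iff)
    then have "x \<in> fst ` fibre_product G H p f" if "x \<in> carrier G" for x
      using that by (force simp: fibre_product_def)
    then show ?thesis by (auto simp: fibre_product_def)
  qed
  moreover have "snd ` fibre_product G H p f = carrier H"
  proof -
    have "\<exists>x\<in>carrier G. p x = f y" if "y \<in> carrier H" for y
      using that p(2) episD(3)[OF f] by (metis image_iff)
    then have "y \<in> snd ` fibre_product G H p f" if "y \<in> carrier H" for y
      using that by (force simp: fibre_product_def)
    then show ?thesis by (auto simp: fibre_product_def)
  qed
  ultimately show "subdirect (fibre_product G H p f) G H" by (simp add: subdirect_def)
  show "fst_kernel (fibre_product G H p f) H = kernel G Q p"
    by (auto simp: fst_kernel_def fibre_product_def kernel_def)
qed

text \<open>Keeping \<open>p\<close> fixed removes the usual ambiguity by automorphisms of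
  \<open>Q\<close>, so each \<open>D\<close> belongs to exactly one epimorphism. The inverse
  correspondence sends \<open>y\<close> to \<open>p x\<close> for any \<open>(x, y)\<close> in
  \<open>D\<close>.\<close>

lemma goursat:
  assumes G: "group G" and H: "group H" and Q: "group Q"
    and p: "p \<in> hom G Q" "p ` carrier G = carrier Q"
  shows "bij_betw (fibre_product G H p) (epis H Q)
    {D. subdirect D G H \<and> fst_kernel D H = kernel G Q p}"
  unfolding bij_betw_def
proof (intro conjI inj_onI equalityI subsetI)
  fix f g assume f: "f \<in> epis H Q" and g: "g \<in> epis H Q"
    and eq: "fibre_product G H p f = fibre_product G H p g"
  show "f = g"
  proof (rule epis_eqI[OF f g])
    fix y assume y: "y \<in> carrier H"
    then obtain x where "x \<in> carrier G" "p x = f y" using p(2) episD(3)[OF f] by (metis image_iff)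
    then have "(x, y) \<in> fibre_product G H p f" using y by (simp add: fibre_product_def)
    then have "(x, y) \<in> fibre_product G H p g" unfolding eq .
    with \<open>p x = f y\<close> show "f y = g y" by (simp add: fibre_product_def)
  qed
next
  fix D assume "D \<in> fibre_product G H p ` epis H Q"
  then obtain f where "f \<in> epis H Q" "D = fibre_product G H p f" by blast
  then show "D \<in> {D. subdirect D G H \<and> fst_kernel D H = kernel G Q p}"
    using subdirect_fibre_product[OF G H Q p] by simp
next
  fix D assume "D \<in> {D. subdirect D G H \<and> fst_kernel D H = kernel G Q p}"
  then have D: "subdirect D G H" and ker: "fst_kernel D H = kernel G Q p" by auto
  interpret p: group_hom G Q p using G Q p by (simp add: group_hom_def group_hom_axioms_def)
  interpret H: group H by fact
  note c = subdirect_carrier[OF D]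
  \<comment> \<open>The fibre of \<open>D\<close> over \<open>y\<close> is a single coset of
    \<open>kernel G Q p\<close>. This makes \<open>f\<close> below independent of the choice of
    \<open>x\<close> and lets \<open>D\<close> be recovered from \<open>f\<close>.\<close>
  have uniq: "p x = p x' \<longleftrightarrow> (x', y) \<in> D" if "(x, y) \<in> D" "x' \<in> carrier G" for x x' y
  proof
    assume "p x = p x'"
    then have "x' \<otimes>\<^bsub>G\<^esub> inv\<^bsub>G\<^esub> x \<in> kernel G Q p"
      using c[OF that(1)] that(2) by (simp add: kernel_def p.hom_mult)
    then have "(x' \<otimes>\<^bsub>G\<^esub> inv\<^bsub>G\<^esub> x, \<one>\<^bsub>H\<^esub>) \<in> D" using ker by (auto simp: fst_kernel_def)
    from subdirect_mult[OF D this that(1)] show "(x', y) \<in> D"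
      using c[OF that(1)] that(2) p.G.m_assoc[of "x'" "inv\<^bsub>G\<^esub> x" x] by simp
  next
    assume "(x', y) \<in> D"
    from subdirect_mult[OF D this subdirect_inv[OF G H D that(1)]]
    have "x' \<otimes>\<^bsub>G\<^esub> inv\<^bsub>G\<^esub> x \<in> kernel G Q p" using c[OF that(1)] ker by (auto simp: fst_kernel_def)
    then have "p x' \<otimes>\<^bsub>Q\<^esub> inv\<^bsub>Q\<^esub> p x = \<one>\<^bsub>Q\<^esub>" using c[OF that(1)] that(2) by (simp add: kernel_def p.hom_mult)
    moreover have "p x \<in> carrier Q" "p x' \<in> carrier Q" using c[OF that(1)] that(2) by auto
    ultimately show "p x = p x'" using p.H.inv_equality[of "p x'" "inv\<^bsub>Q\<^esub> p x"] by simp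
  qed
  define f where "f = restrict (\<lambda>y. p (SOME x. (x, y) \<in> D)) (carrier H)"
  have f: "f y = p x" if "(x, y) \<in> D" for x y
  proof -
    have "(SOME x. (x, y) \<in> D, y) \<in> D" using that by (rule someI)
    then have "p (SOME x. (x, y) \<in> D) = p x" using uniq c[OF that] that by blast
    then show ?thesis using c[OF that] by (simp add: f_def)
  qed
  have "f \<in> epis H Q"
    unfolding epis_def
  proof (intro CollectI conjI IntI homI)
    fix y assume "y \<in> carrier H"
    then obtain x where x: "(x, y) \<in> D" using subdirect_snd_ex[OF D] by auto
    then show "f y \<in> carrier Q" using f[OF x] c[OF x] by simp
  next
    fix y y' assume "y \<in> carrier H" "y' \<in> carrier H"
    then obtain x x' where xy: "(x, y) \<in> D" "(x', y') \<in> D" using subdirect_snd_ex[OF D] by meson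
    then show "f (y \<otimes>\<^bsub>H\<^esub> y') = f y \<otimes>\<^bsub>Q\<^esub> f y'" 
      using f[OF xy(1)] f[OF xy(2)] c[OF xy(1)] c[OF xy(2)] f[OF subdirect_mult[OF D xy]] by simp
  next
    show "f \<in> extensional (carrier H)" by (simp add: f_def)
    show "f ` carrier H = carrier Q"
    proof (intro equalityI subsetI)
      fix z assume "z \<in> f ` carrier H"
      then obtain x y where xy: "(x, y) \<in> D" "z = f y" using subdirect_snd_ex[OF D] by blast
      then show "z \<in> carrier Q" using f[OF xy(1)] c[OF xy(1)] by simp
    next
      fix z assume "z \<in> carrier Q"
      then obtain x where x: "x \<in> carrier G" "z = p x" using p by auto
      then obtain y where y: "(x, y) \<in> D" using subdirect_fst_ex[OF D] by blast
      then show "z \<in> f ` carrier H" using x f[OF y] c[OF y] by (metis imageI)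
    qed
  qed
  moreover have "D = fibre_product G H p f"
  proof (intro equalityI subrelI)
    fix x y assume xy: "(x, y) \<in> D"
    then show "(x, y) \<in> fibre_product G H p f" using f[OF xy] c[OF xy] by (simp add: fibre_product_def)
  next
    fix x y assume "(x, y) \<in> fibre_product G H p f"
    then have xy: "x \<in> carrier G" "y \<in> carrier H" "p x = f y" by (auto simp: fibre_product_def)
    then obtain x' where x': "(x', y) \<in> D" using subdirect_snd_ex[OF D] by auto
    then show "(x, y) \<in> D" using uniq[OF x' xy(1)] f[OF x'] xy(3) by simp
  qed
  ultimately show "D \<in> fibre_product G H p ` epis H Q" by blast
qed

lemma finite_subdirect:
  assumes "finite (carrier G)" "finite (carrier H)"
  shows "finite {D. subdirect D G H}"
proof (rule finite_subset)
  show "{D. subdirect D G H} \<subseteq> Pow (carrier G \<times> carrier H)"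
    using subdirect_subset by blast
qed (use assms in simp)

section \<open>Three factors as an iterated product of two\<close>

text \<open>The image of \<open>D\<close> in \<open>G2 \<times>\<times> G3\<close> becomes the
  second factor of a two-fold product. Only the carrier is changed, so multiplication and unit
  remain those of the ambient group.\<close>

lemma subdirect_product3_iff:
  assumes "group G1" "group G2" "group G3"
  shows "subdirect_product3 D G1 G2 G3 \<longleftrightarrow>
    subdirect (snd ` D) G2 G3 \<and> subdirect D G1 ((G2 \<times>\<times> G3)\<lparr>carrier := snd ` D\<rparr>)"
    (is "?l \<longleftrightarrow> ?r")
proof -
  interpret G: group "G2 \<times>\<times> G3" using assms by (intro DirProd_group)
  interpret K: group "G1 \<times>\<times> G2 \<times>\<times> G3" using assms by (intro DirProd_group)
  have 1: "(\<lambda>(x, y, z). x) ` D = fst ` D" "(\<lambda>(x, y, z). y) ` D = fst ` snd ` D"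
     "(\<lambda>(x, y, z). z) ` D = snd ` snd ` D"
    by (simp_all add: image_image case_prod_beta)
  have hom: "snd \<in> hom (G1 \<times>\<times> G2 \<times>\<times> G3) (G2 \<times>\<times> G3)" by (auto simp: hom_def)
  have sub: "subgroup (snd ` D) (G2 \<times>\<times> G3)" if "subgroup D (G1 \<times>\<times> G2 \<times>\<times> G3)"
  proof -
    interpret s: group_hom "G1 \<times>\<times> G2 \<times>\<times> G3" "G2 \<times>\<times> G3" snd by unfold_locales (fact hom)
    show ?thesis using s.subgroup_img_is_subgroup[OF that] .
  qed
  let ?P = "(G2 \<times>\<times> G3)\<lparr>carrier := snd ` D\<rparr>"
  have "subgroup D (G1 \<times>\<times> G2 \<times>\<times> G3) \<longleftrightarrow> subgroup D (G1 \<times>\<times> ?P)" if s: "subgroup (snd ` D) (G2 \<times>\<times> G3)"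
  proof -
    \<comment> \<open>As a record this product is the triple product with a smaller carrier, so both
      subgroup statements can be compared inside one group.\<close>
    have eq: "G1 \<times>\<times> ?P = (G1 \<times>\<times> G2 \<times>\<times> G3)\<lparr>carrier := carrier G1 \<times> snd ` D\<rparr>"
      by (auto simp: DirProd_def)
    have big: "subgroup (carrier G1 \<times> snd ` D) (G1 \<times>\<times> G2 \<times>\<times> G3)"
      using DirProd_subgroups[OF assms(1) group.subgroup_self[OF assms(1)] G.is_group s] .
    show ?thesis
    proof
      assume D: "subgroup D (G1 \<times>\<times> G2 \<times>\<times> G3)"
      have "D \<subseteq> carrier G1 \<times> snd ` D" using subgroup.subset[OF D] by force
      then show "subgroup D (G1 \<times>\<times> ?P)" unfolding eq by (rule K.subgroup_incl[OF D big])
    next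
      assume "subgroup D (G1 \<times>\<times> ?P)"
      then show "subgroup D (G1 \<times>\<times> G2 \<times>\<times> G3)" unfolding eq by (rule K.incl_subgroup[OF big])
    qed
  qed
  then show ?thesis using sub by (auto simp: subdirect_product3_def subdirect_def 1)
qed

lemma card_subdirect_product3:
  assumes "group G1" "group G2" "group G3"
    and "finite (carrier G1)" "finite (carrier G2)" "finite (carrier G3)"
  shows "card {D. subdirect_product3 D G1 G2 G3} =
    (\<Sum>P\<in>{P. subdirect P G2 G3}. card {D. subdirect D G1 ((G2 \<times>\<times> G3)\<lparr>carrier := P\<rparr>)})"
proof -
  let ?A = "\<lambda>P. {D. subdirect D G1 ((G2 \<times>\<times> G3)\<lparr>carrier := P\<rparr>)}"
  have *: "snd ` D = P" if "D \<in> ?A P" for D P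
    using that by (simp add: subdirect_def)
  have "{D. subdirect_product3 D G1 G2 G3} = (\<Union>P\<in>{P. subdirect P G2 G3}. ?A P)"
    using * by (auto simp: subdirect_product3_iff[OF assms(1-3)])
  also have "card \<dots> = (\<Sum>P\<in>{P. subdirect P G2 G3}. card (?A P))"
  proof (rule card_UN_disjoint)
    show "finite {P. subdirect P G2 G3}" using assms by (intro finite_subdirect)
    show "\<forall>P\<in>{P. subdirect P G2 G3}. finite (?A P)"
    proof
      fix P assume "P \<in> {P. subdirect P G2 G3}"
      then have "P \<subseteq> carrier G2 \<times> carrier G3" using subdirect_subset by blast
      then have "finite P" using assms by (meson finite_SigmaI finite_subset)
      then show "finite (?A P)" using assms by (intro finite_subdirect) simp_all
    qed
  qed (use * in blast)
  finally show ?thesis .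
qed

section \<open>Normal subgroups of the symmetric groups\<close>

lemmas sym_group_simps = sym_group_carrier sym_group_mult sym_group_one

lemma finite_sym_group [simp]: "finite (carrier (sym_group n))"
  using finite_permutations[of "{1..n}"] by (simp add: sym_group_def)

text \<open>The complements of \<open>A\<close> and of its image have the same finite size, so any
  bijection between them completes \<open>f\<close>. This supplies conjugating permutations
  prescribed on a few points.\<close>

lemma permutes_extend:
  assumes "finite X" "A \<subseteq> X" "inj_on f A" "f ` A \<subseteq> X"
  obtains g where "g permutes X" "\<And>x. x \<in> A \<Longrightarrow> g x = f x"
proof -
  have "card (f ` A) = card A" using assms by (simp add: card_image)
  then have "card (X - A) = card (X - f ` A)"
    using assms by (simp add: card_Diff_subset finite_subset)
  then obtain h where h: "bij_betw h (X - A) (X - f ` A)"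
    using assms(1) finite_same_card_bij[of "X - A" "X - f ` A"] by auto
  define g where "g x = (if x \<in> A then f x else if x \<in> X then h x else x)" for x
  have "bij_betw g A (f ` A)"
    using assms(3) by (auto simp: bij_betw_def g_def inj_on_def)
  moreover have "bij_betw g (X - A) (X - f ` A)"
    using h by (rule bij_betw_cong[THEN iffD1, rotated]) (auto simp: g_def)
  ultimately have "bij_betw g (A \<union> (X - A)) (f ` A \<union> (X - f ` A))"
    by (rule bij_betw_combine) auto
  moreover have "A \<union> (X - A) = X" "f ` A \<union> (X - f ` A) = X" using assms by auto
  ultimately have "g permutes X"
    using assms(2) by (intro bij_imp_permutes) (auto simp: g_def)
  then show ?thesis using that by (auto simp: g_def)
qed

lemma permutes_conj_apply: "g permutes X \<Longrightarrow> (g \<circ> p \<circ> inv' g) (g x) = g (p x)"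
  by (simp add: permutes_inverses)

lemma permutes_conj_eqI:
  assumes "g permutes X" "\<And>x. q (g x) = g (p x)" shows "g \<circ> p \<circ> inv' g = q"
proof
  fix y show "(g \<circ> p \<circ> inv' g) y = q y"
    using assms(2)[of "inv' g y"] by (simp add: permutes_inverses[OF assms(1)])
qed

lemma permutes_transpose_apply:
  "g permutes X \<Longrightarrow> transpose (g a) (g b) (g x) = g (transpose a b x)"
  by (auto simp: transpose_def dest: permutes_inj injD)

lemma permutes_conj_transpose:
  "g permutes X \<Longrightarrow> g \<circ> transpose a b \<circ> inv' g = transpose (g a) (g b)"
  by (rule permutes_conj_eqI) (simp_all add: permutes_transpose_apply)

lemma permutes_conj: "\<lbrakk>g permutes X; p permutes X\<rbrakk> \<Longrightarrow> g \<circ> p \<circ> inv' g permutes X"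
  by (intro permutes_compose permutes_inv)

lemma normal_sym_groupD:
  assumes "N \<lhd> sym_group n"
  shows "x \<in> N \<Longrightarrow> x permutes {1..n}" "id \<in> N" "x \<in> N \<Longrightarrow> y \<in> N \<Longrightarrow> x \<circ> y \<in> N"
    "x \<in> N \<Longrightarrow> inv' x \<in> N" "x \<in> N \<Longrightarrow> g permutes {1..n} \<Longrightarrow> g \<circ> x \<circ> inv' g \<in> N"
proof -
  interpret N: normal N "sym_group n" by fact
  show c: "x permutes {1..n}" if "x \<in> N" for x using subgroup.mem_carrier[OF N.is_subgroup that] by (simp add: sym_group_simps)
  show "id \<in> N" using subgroup.one_closed[OF N.is_subgroup] unfolding sym_group_one .
  show "x \<circ> y \<in> N" if "x \<in> N" "y \<in> N" using subgroup.m_closed[OF N.is_subgroup that] by (simp add: sym_group_simps)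
  show "inv' x \<in> N" if "x \<in> N" using subgroup.m_inv_closed[OF N.is_subgroup that] c[OF that] by (simp add: sym_group_simps)
  show "g \<circ> x \<circ> inv' g \<in> N" if "x \<in> N" "g permutes {1..n}"
    using N.inv_op_closed2[of g x] that by (simp add: sym_group_simps)
qed

text \<open>The commutator of \<open>x\<close> with the transposition \<open>(a  x a)\<close> is a 3-cycle.\<close>

lemma normal_contains_alt_group:
  assumes N: "N \<lhd> sym_group n" and x: "x \<in> N" and a: "x (x a) \<noteq> a"
  shows "carrier (alt_group n) \<subseteq> N"
proof -
  note ND = normal_sym_groupD[OF N]
  have px: "x permutes {1..n}" by (rule ND(1)[OF x])
  define b c where "b = x a" and "c = x b"
  have "x a \<noteq> a" using a by auto
  then have "a \<in> {1..n}" using px by (meson permutes_not_in)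
  then have abc: "a \<in> {1..n}" "b \<in> {1..n}" "c \<in> {1..n}"
    using permutes_in_image[OF px] by (simp_all add: b_def c_def)
  have ne: "a \<noteq> b" "b \<noteq> c" "a \<noteq> c"
    using a \<open>x a \<noteq> a\<close> inj_eq[OF permutes_inj[OF px], of a "x a"] by (simp_all add: b_def c_def)
  have pt: "transpose a b permutes {1..n}" using abc by (intro permutes_swap_id)
  have "transpose a b \<circ> (x \<circ> transpose a b \<circ> inv' x) = (transpose a b \<circ> x \<circ> inv' (transpose a b)) \<circ> inv' x"
    by (simp add: comp_assoc)
  also have "\<dots> \<in> N" using ND(3,4,5) x pt by blast
  finally have 3: "transpose a b \<circ> transpose b c \<in> N"
    by (simp add: permutes_conj_transpose[OF px] b_def c_def)
  \<comment> \<open>One 3-cycle gives all: a permutation sending \<open>a\<close>, \<open>b\<close>,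
    \<open>c\<close> to the entries of another 3-cycle conjugates the one into the other.\<close>
  have cyc: "y \<in> N" if "y \<in> three_cycles n" for y
  proof -
    obtain cs where cs: "y = cycle_of_list cs" "cycle cs" "length cs = 3" "set cs \<subseteq> {1..n}"
      using \<open>y \<in> three_cycles n\<close> by auto
    obtain a' b' c' where cs_def: "cs = [a', b', c']"
      using stupid_lemma[OF cs(3)] by auto
    have d: "a' \<noteq> b'" "b' \<noteq> c'" "a' \<noteq> c'" "{a', b', c'} \<subseteq> {1..n}" using cs by (auto simp: cs_def)
    obtain g where g: "g permutes {1..n}" "\<And>x. x \<in> {a, b, c} \<Longrightarrow> g x = (id(a := a', b := b', c := c')) x"
    proof (rule permutes_extend[of "{1..n}" "{a, b, c}" "id(a := a', b := b', c := c')"])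
      show "inj_on (id(a := a', b := b', c := c')) {a, b, c}" using ne d by (auto simp: inj_on_def)
    qed (use abc ne d in auto)
    have gg: "g a = a'" "g b = b'" "g c = c'" using g(2)[of a] g(2)[of b] g(2)[of c] ne by auto
    have "g \<circ> (transpose a b \<circ> transpose b c) \<circ> inv' g = transpose a' b' \<circ> transpose b' c'"
      by (rule permutes_conj_eqI[OF g(1)])
        (simp flip: gg add: permutes_transpose_apply[OF g(1)])
    also have "\<dots> = y" by (simp add: cs(1) cs_def)
    finally show ?thesis using ND(5)[OF 3 g(1)] by simp
  qed
  have "y \<in> N" if "y \<in> generate (alt_group n) (three_cycles n)" for y
    using that
  proof (induction rule: generate.induct)
    case one show ?case using ND(2) unfolding alt_group_one .
  next
    case (incl h) then show ?case by (rule cyc)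
  next
    case (inv h)
    then have "h \<in> carrier (alt_group n)" using three_cycles_incl by blast
    then show ?case using ND(4)[OF cyc[OF inv]] by (simp add: alt_group_inv_equality)
  next
    case (eng h1 h2) then show ?case unfolding alt_group_mult by (intro ND(3))
  qed
  then show ?thesis by (auto simp: alt_group_carrier_as_three_cycles)
qed

text \<open>The identity and the three double transpositions, described by their action
  (fixed-point-free involutions of four points) instead of being listed.\<close>

definition klein_four :: "(nat \<Rightarrow> nat) set" where
  "klein_four = {p. p permutes {1..4} \<and> (p = id \<or> (\<forall>x\<in>{1..4}. p x \<noteq> x \<and> p (p x) = x))}"

text \<open>By \<open>normal_contains_alt_group\<close> every element of \<open>N\<close> squares to
  the identity. This applies also to the product of \<open>x\<close> with any of its conjugates;
  suitable conjugates exclude a fixed point of \<open>x\<close> and any point beyond two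
  2-cycles.\<close>

lemma normal_sym_group_involution:
  assumes N: "N \<lhd> sym_group n" and nA: "\<not> carrier (alt_group n) \<subseteq> N"
    and x: "x \<in> N" "x \<noteq> id"
  shows "n = 4" "x \<in> klein_four"
proof -
  note ND = normal_sym_groupD[OF N]
  have inv: "y (y a) = a" if "y \<in> N" for y a
    using normal_contains_alt_group[OF N that] nA by blast
  have px: "x permutes {1..n}" by (rule ND(1)[OF x(1)])
  have injx: "x u = x v \<longleftrightarrow> u = v" for u v using permutes_inj[OF px] by (auto dest: injD)
  obtain a where a: "x a \<noteq> a" using x(2) by (auto simp: fun_eq_iff)
  define b where "b = x a"
  have aX: "a \<in> {1..n}" using a px by (meson permutes_not_in)
  have bX: "b \<in> {1..n}" using aX permutes_in_image[OF px] by (simp add: b_def)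
  have xb: "x b = a" using inv[OF x(1)] by (simp add: b_def)
  have ab: "a \<noteq> b" using a by (simp add: b_def)
  have fpf: "x e \<noteq> e" if e: "e \<in> {1..n}" for e
  proof
    assume xe: "x e = e"
    then have "e \<noteq> a" "e \<noteq> b" using a xb by auto
    define g where "g = transpose b e"
    have pg: "g permutes {1..n}" unfolding g_def using bX e by (intro permutes_swap_id)
    define x' where "x' = g \<circ> x \<circ> inv' g"
    have x'N: "x' \<in> N" unfolding x'_def by (rule ND(5)[OF x(1) pg])
    have c: "x' (g u) = g (x u)" for u unfolding x'_def by (rule permutes_conj_apply[OF pg])
    have "x' a = e" using c[of a] \<open>e \<noteq> a\<close> ab by (simp add: g_def b_def[symmetric])
    moreover have "x' e = a" using c[of b] \<open>e \<noteq> a\<close> ab by (simp add: g_def xb)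
    ultimately have "(x \<circ> x') ((x \<circ> x') a) = b" by (simp add: xe b_def)
    with inv[OF ND(3)[OF x(1) x'N], of a] ab show False by simp
  qed
  \<comment> \<open>With \<open>d = x c\<close>, the 3-cycle \<open>b -> c -> e -> b\<close> turns
    the pairs \<open>{a, b}\<close>, \<open>{c, d}\<close> into \<open>{a, c}\<close>,
    \<open>{e, d}\<close>. So \<open>x \<circ> x'\<close> sends \<open>a\<close> to \<open>d\<close>
    and \<open>d\<close> to \<open>x e\<close>, which is not \<open>a\<close>.\<close>
  have no: False if c: "c \<in> {1..n}" "c \<notin> {a, b}" and e: "e \<in> {1..n}" "e \<notin> {a, b, c, x c}" for c e
  proof -
    define d where "d = x c"
    have dX: "d \<in> {1..n}" using c permutes_in_image[OF px] by (simp add: d_def)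
    have xd: "x d = c" using inv[OF x(1)] by (simp add: d_def)
    have cd: "c \<noteq> d" using fpf[OF c(1)] by (simp add: d_def)
    have dd: "d \<noteq> a" "d \<noteq> b" using c(2) xd xb by (auto simp: b_def)
    define g where "g = transpose b c \<circ> transpose c e"
    have pg: "g permutes {1..n}" unfolding g_def using bX e c
      by (intro permutes_compose permutes_swap_id)
    define x' where "x' = g \<circ> x \<circ> inv' g"
    have x'N: "x' \<in> N" unfolding x'_def by (rule ND(5)[OF x(1) pg])
    have cj: "x' (g u) = g (x u)" for u unfolding x'_def by (rule permutes_conj_apply[OF pg])
    have ne: "c \<noteq> a" "c \<noteq> b" "e \<noteq> a" "e \<noteq> b" "e \<noteq> c" "e \<noteq> d" using c e by (auto simp: d_def)
    have gs: "g a = a" "g b = c" "g c = e" "g d = d"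
      using ne ne[symmetric] ab dd dd[symmetric] cd by (auto simp: g_def transpose_def)
    have "x' a = c" using cj[of a] gs by (simp add: b_def[symmetric])
    moreover have "x' d = e" using cj[of d] gs xd by simp
    ultimately have "(x \<circ> x') ((x \<circ> x') a) = x e" by (simp add: d_def[symmetric])
    moreover have "x e \<noteq> a" using xb injx[of e b] ne by auto
    ultimately show False using inv[OF ND(3)[OF x(1) x'N], of a] by simp
  qed
  \<comment> \<open>\<open>A_2\<close> is trivial and thus contained in every \<open>N\<close>.
    Excluding degree 2 ensures a point \<open>c\<close> outside \<open>{a, b}\<close>.\<close>
  have "n \<noteq> 2"
  proof
    assume "n = 2"
    then have "card (carrier (alt_group n)) = 1" using alt_group_card_carrier[of n] by simp
    moreover have "id \<in> carrier (alt_group n)" by (simp add: alt_group_carrier)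
    ultimately have "carrier (alt_group n) = {id}" by (metis card_1_singletonE singletonD)
    with nA ND(2) show False by simp
  qed
  have "card {a, b} \<le> card {1..n}" using aX bX by (intro card_mono) auto
  then have "n \<ge> 3" using \<open>n \<noteq> 2\<close> ab by simp
  then have "\<not> {1..n} \<subseteq> {a, b}" using card_mono[of "{a, b}" "{1..n}"] ab by auto
  then obtain c where c: "c \<in> {1..n}" "c \<notin> {a, b}" by blast
  have X: "{1..n} = {a, b, c, x c}"
    using no[OF c] c(1) aX bX permutes_in_image[OF px, of c] by blast
  have "x c \<noteq> a" "x c \<noteq> b" "x c \<noteq> c" using xb injx[of c b] injx[of c a] c fpf[OF c(1)] by (auto simp: b_def)
  then have "card {a, b, c, x c} = 4" using c ab by auto
  then show n4: "n = 4" by (metis X card_atLeastAtMost diff_Suc_1)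
  show "x \<in> klein_four" using px fpf inv[OF x(1)] by (auto simp: klein_four_def n4)
qed

text \<open>Both have the shape \<open>(1 b)(c d)\<close>, and \<open>g\<close> relabels the points
  accordingly. Hence a normal subgroup containing one of the double transpositions contains all of
  them.\<close>

lemma klein_four_conj:
  assumes p: "p \<in> klein_four" "p \<noteq> id" and q: "q \<in> klein_four" "q \<noteq> id"
  obtains g where "g permutes {1..4}" "q = g \<circ> p \<circ> inv' g"
proof -
  have card: "\<exists>c. c \<in> {1..4::nat} \<and> c \<notin> {a, b}" for a b
  proof -
    have "card {a, b} < card {1..4::nat}" by (cases "a = b") auto
    then have "\<not> {1..4} \<subseteq> {a, b}" by (metis card_mono finite.emptyI finite.insertI not_le)
    then show ?thesis by blast
  qed
  have form: "\<exists>b c d. distinct [1, b, c, d] \<and> {1..4::nat} = {1, b, c, d} \<and> r 1 = b \<and> r b = 1 \<and> r c = d \<and> r d = c"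
    if r: "r \<in> klein_four" "r \<noteq> id" for r
  proof -
    have pr: "r permutes {1..4}" and inv: "\<And>x. x \<in> {1..4} \<Longrightarrow> r x \<noteq> x \<and> r (r x) = x"
      using r by (auto simp: klein_four_def)
    have inj: "r u = r v \<longleftrightarrow> u = v" for u v using permutes_inj[OF pr] by (auto dest: injD)
    obtain c where c: "c \<in> {1..4}" "c \<notin> {1, r 1}" using card by blast
    have 1: "1 \<in> {1..4::nat}" by simp
    have d: "distinct [1, r 1, c, r c]"
      using c inv[OF 1] inv[OF c(1)] inj[of 1 c] inj[of "r 1" c] by auto
    have "{1, r 1, c, r c} \<subseteq> {1..4}" using c 1 permutes_in_image[OF pr] by blast
    moreover have "card {1, r 1, c, r c} = card {1..4::nat}" using distinct_card[OF d] by simp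
    ultimately have "{1, r 1, c, r c} = {1..4}" by (intro card_subset_eq) auto
    then show ?thesis using d inv[OF 1] inv[OF c(1)] by metis
  qed
  obtain b c d where 1: "distinct [1, b, c, d]" "{1..4::nat} = {1, b, c, d}" "p 1 = b" "p b = 1" "p c = d" "p d = c"
    using form[OF p] by blast
  obtain b' c' d' where 2: "distinct [1, b', c', d']" "{1..4::nat} = {1, b', c', d'}" "q 1 = b'" "q b' = 1" "q c' = d'" "q d' = c'"
    using form[OF q] by blast
  obtain g where g: "g permutes {1..4}" "\<And>x. x \<in> {1, b, c, d} \<Longrightarrow> g x = (id(b := b', c := c', d := d')) x"
  proof (rule permutes_extend[of "{1..4}" "{1, b, c, d}" "id(b := b', c := c', d := d')"])
    show "inj_on (id(b := b', c := c', d := d')) {1, b, c, d}" using 1(1) 2(1) by (auto simp: inj_on_def)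
    show "id(b := b', c := c', d := d') ` {1, b, c, d} \<subseteq> {1..4}" using 1(1) unfolding 2(2) by auto
  qed (use 1 in auto)
  have gg: "g 1 = 1" "g b = b'" "g c = c'" "g d = d'"
    using g(2)[of 1] g(2)[of b] g(2)[of c] g(2)[of d] 1(1) by auto
  have "q (g x) = g (p x)" for x
  proof (cases "x \<in> {1..4}")
    case True
    then have "x \<in> {1, b, c, d}" unfolding 1(2) .
    then show ?thesis using gg 1(3-) 2(3-) by (elim insertE emptyE) simp_all
  next
    case False
    then have "g x = x" "p x = x" "q x = x" using g(1) p q by (auto simp: klein_four_def dest: permutes_not_in)
    then show ?thesis by simp
  qed
  then have "q = g \<circ> p \<circ> inv' g" using permutes_conj_eqI[OF g(1)] by metis
  then show ?thesis using that g(1) by blast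
qed

text \<open>Together with \<open>A_n\<close>, a single odd element yields all odd ones. If
  \<open>A_n\<close> is not contained in \<open>N\<close>, one nontrivial element of
  \<open>klein_four\<close> yields the rest by conjugation. The alternatives overlap in low degree,
  e.g. \<open>A_2 = {id}\<close>, and have to be separated when kernels are counted.\<close>

lemma normal_sym_group_cases:
  assumes N: "N \<lhd> sym_group n"
  shows "N = {id} \<or> N = carrier (alt_group n) \<or> N = carrier (sym_group n) \<or> n = 4 \<and> N = klein_four"
proof (cases "carrier (alt_group n) \<subseteq> N")
  case True
  note ND = normal_sym_groupD[OF N]
  have sub: "N \<subseteq> carrier (sym_group n)" using ND(1) by (auto simp: sym_group_carrier)
  show ?thesis
  proof (cases "N \<subseteq> carrier (alt_group n)")
    case True with \<open>carrier (alt_group n) \<subseteq> N\<close> show ?thesis by blast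
  next
    case False
    then obtain x where x: "x \<in> N" "x \<notin> carrier (alt_group n)" by blast
    then have px: "x permutes {1..n}" "\<not> evenperm x" using ND(1) by (auto simp: alt_group_carrier)
    have perm: "permutation r" if "r permutes {1..n}" for r
      using that by (auto simp: permutation_permutes)
    have "y \<in> N" if y: "y permutes {1..n}" for y
    proof (cases "evenperm y")
      case True then show ?thesis using y \<open>carrier (alt_group n) \<subseteq> N\<close> by (auto simp: alt_group_carrier)
    next
      case False
      have "evenperm (y \<circ> inv' x)"
        using px y False perm[OF px(1)] perm[OF y] perm[OF permutes_inv[OF px(1)]]
        by (simp add: evenperm_comp evenperm_inv)
      then have "y \<circ> inv' x \<in> N"
        using y px(1) \<open>carrier (alt_group n) \<subseteq> N\<close> permutes_compose[OF permutes_inv[OF px(1)] y]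
        by (auto simp: alt_group_carrier)
      then have "(y \<circ> inv' x) \<circ> x \<in> N" using ND(3) x(1) by blast
      then show ?thesis using permutes_inv_o(2)[OF px(1)] by (simp add: comp_assoc)
    qed
    then show ?thesis using sub by (auto simp: sym_group_carrier)
  qed
next
  case False
  note ND = normal_sym_groupD[OF N]
  show ?thesis
  proof (cases "N \<subseteq> {id}")
    case True then show ?thesis using ND(2) by auto
  next
    case nt: False
    then obtain x where x: "x \<in> N" "x \<noteq> id" by auto
    have "n = 4" by (rule normal_sym_group_involution(1)[OF N False x])
    have "N \<subseteq> klein_four"
    proof
      fix y assume "y \<in> N"
      then show "y \<in> klein_four"
        using normal_sym_group_involution(2)[OF N False, of y] by (cases "y = id") (auto simp: klein_four_def)
    qed
    moreover have "klein_four \<subseteq> N"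
    proof
      fix y assume y: "y \<in> klein_four"
      show "y \<in> N"
      proof (cases "y = id")
        case True then show ?thesis using ND(2) by simp
      next
        case False
        obtain g where "g permutes {1..4}" "y = g \<circ> x \<circ> inv' g"
          using klein_four_conj[of x y] x y False \<open>N \<subseteq> klein_four\<close> by blast
        then show ?thesis using ND(5) x(1) \<open>n = 4\<close> by blast
      qed
    qed
    ultimately show ?thesis using \<open>n = 4\<close> by blast
  qed
qed

section \<open>The Klein four-group\<close>

lemma four_cover:
  assumes "{a, b, c, d, e} \<subseteq> {1..4::nat}" "distinct [a, b, c, d]"
  shows "e \<in> {a, b, c, d}"
proof -
  have "card {a, b, c, d} = card {1..4::nat}" using distinct_card[OF assms(2)] by simp
  then have "{a, b, c, d} = {1..4}" using assms(1) by (intro card_subset_eq) auto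
  then show ?thesis using assms(1) by blast
qed

lemma klein_fourD:
  assumes "p \<in> klein_four"
  shows "p permutes {1..4}" "p (p x) = x"
    "x \<in> {1..4} \<Longrightarrow> p x = x \<Longrightarrow> p = id" "p x \<in> {1..4} \<longleftrightarrow> x \<in> {1..4}" "p x = p y \<longleftrightarrow> x = y"
proof -
  show p: "p permutes {1..4}" using assms by (simp add: klein_four_def)
  show "p (p x) = x"
    using assms permutes_not_in[OF p] by (cases "x \<in> {1..4}") (auto simp: klein_four_def)
  show "x \<in> {1..4} \<Longrightarrow> p x = x \<Longrightarrow> p = id" using assms by (auto simp: klein_four_def)
  show "p x \<in> {1..4} \<longleftrightarrow> x \<in> {1..4}" by (rule permutes_in_image[OF p])
  show "p x = p y \<longleftrightarrow> x = y" by (rule inj_eq[OF permutes_inj[OF p]])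
qed

text \<open>A nontrivial element is determined by the partner of one point: the remaining two points
  cannot be fixed and must be swapped. With \<open>klein_four_transitive\<close> this says that the
  action is regular.\<close>

lemma klein_four_eqI:
  assumes p: "p \<in> klein_four" and q: "q \<in> klein_four" and x: "x \<in> {1..4}" "p x = q x"
  shows "p = q"
proof (cases "p = id \<or> q = id")
  case True
  then show ?thesis using klein_fourD(3)[OF p x(1)] klein_fourD(3)[OF q x(1)] x(2) by auto
next
  case False
  note P = klein_fourD[OF p] and Q = klein_fourD[OF q]
  show ?thesis
  proof
    fix c show "p c = q c"
    proof (cases "c \<in> {1..4}")
      case False
      then show ?thesis using permutes_not_in[OF P(1)] permutes_not_in[OF Q(1)] by simp
    next
      case c: True
      consider "c = x" | "c = p x" | "c \<noteq> x" "c \<noteq> p x" by blast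
      then show ?thesis
      proof cases
        case 2
        then show ?thesis using P(2)[of x] Q(2)[of x] x(2) by simp
      next
        case 3
        have pc: "p c \<noteq> c" and qc: "q c \<noteq> c" and px: "p x \<noteq> x"
          using False P(3) Q(3) c x by blast+
        have "p c \<noteq> x" "q c \<noteq> x" "p c \<noteq> p x" "q c \<noteq> p x"
          using P(2)[of c] Q(2)[of c] 3 x P(5)[of c x] Q(5)[of c x] by auto
        moreover have "q c \<in> {x, p x, c, p c}"
          by (rule four_cover) (use c x P(4) Q(4) 3 pc px calculation in auto)
        ultimately show ?thesis using qc by auto
      qed (use x in simp)
    qed
  qed
qed

text \<open>For distinct nontrivial \<open>p\<close>, \<open>q\<close> the points \<open>x\<close>,
  \<open>p x\<close>, \<open>q x\<close> are distinct, so \<open>p (q x)\<close> and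
  \<open>q (p x)\<close> are both the fourth point. Thus \<open>p\<close> and \<open>q\<close>
  commute and their product is again an involution.\<close>

lemma klein_four_comp:
  assumes p: "p \<in> klein_four" and q: "q \<in> klein_four"
  shows "p \<circ> q \<in> klein_four"
proof (cases "p = id \<or> q = id \<or> p = q")
  case True
  have "p \<circ> p = id" using klein_fourD(2)[OF p] by (simp add: fun_eq_iff)
  moreover have "id \<in> klein_four" unfolding klein_four_def by (intro CollectI conjI permutes_id disjI1 refl)
  ultimately show ?thesis using True p q by (elim disjE) simp_all
next
  case False
  note P = klein_fourD[OF p] and Q = klein_fourD[OF q]
  have ne: "p x \<noteq> x" "q x \<noteq> x" "p x \<noteq> q x" if "x \<in> {1..4}" for x
    using that False P(3) Q(3) klein_four_eqI[OF p q] by blast+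
  have "p (q x) \<noteq> x \<and> p (q (p (q x))) = x" if x: "x \<in> {1..4}" for x
  proof -
    have 1: "p (q x) \<noteq> x" "p (q x) \<noteq> p x" "p (q x) \<noteq> q x"
      using ne[OF x] ne(1)[of "q x"] P(2)[of "q x"] P(5) Q(4) x by metis+
    have 2: "q (p x) \<noteq> x" "q (p x) \<noteq> q x" "q (p x) \<noteq> p x"
      using ne[OF x] ne(2)[of "p x"] Q(2)[of "p x"] Q(5) P(4) x by metis+
    have "q (p x) \<in> {x, p x, q x, p (q x)}"
      by (rule four_cover) (use x P(4) Q(4) ne[OF x] 1 in auto)
    then have "q (p x) = p (q x)" using 2 by blast
    then have "p (q (p (q x))) = p (q (q (p x)))" by simp
    then show ?thesis using 1(1) P(2) Q(2) by simp
  qed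
  then show ?thesis unfolding klein_four_def using permutes_compose[OF Q(1) P(1)] by auto
qed

lemma klein_four_normal: "klein_four \<lhd> sym_group 4"
proof -
  interpret S: group "sym_group 4" by (rule sym_group_is_group)
  have inv: "inv' p = p" if "p \<in> klein_four" for p
    using klein_fourD(2)[OF that] by (intro inv_equality) auto
  show ?thesis
  proof (rule S.normal_invI)
    show "subgroup klein_four (sym_group 4)"
    proof (rule S.subgroupI)
      show "klein_four \<subseteq> carrier (sym_group 4)" using klein_fourD(1) by (auto simp: sym_group_carrier)
      show "klein_four \<noteq> {}" by (auto simp: klein_four_def intro!: exI[of _ id])
      show "inv\<^bsub>sym_group 4\<^esub> a \<in> klein_four" if "a \<in> klein_four" for a
        using that inv klein_fourD(1) by (simp add: sym_group_carrier)
      show "a \<otimes>\<^bsub>sym_group 4\<^esub> b \<in> klein_four" if "a \<in> klein_four" "b \<in> klein_four" for a b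
        unfolding sym_group_mult using that by (rule klein_four_comp)
    qed
    fix g p assume g: "g \<in> carrier (sym_group 4)" and p: "p \<in> klein_four"
    then have pg: "g permutes {1..4}" by (simp add: sym_group_carrier)
    have "g \<circ> p \<circ> inv' g \<in> klein_four"
    proof (cases "p = id")
      case True
      then have "g \<circ> p \<circ> inv' g = id" using permutes_inv_o(1)[OF pg] by (simp add: comp_assoc)
      then show ?thesis using p True by simp
    next
      case False
      have "(g \<circ> p \<circ> inv' g) x \<noteq> x \<and> (g \<circ> p \<circ> inv' g) ((g \<circ> p \<circ> inv' g) x) = x" if x: "x \<in> {1..4}" for x
      proof -
        have "inv' g x \<in> {1..4}" using permutes_in_image[OF permutes_inv[OF pg]] x by blast
        then have "p (inv' g x) \<noteq> inv' g x" using klein_fourD(3)[OF p] False by blast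
        then show ?thesis using klein_fourD(2)[OF p]
          by (metis comp_apply permutes_inverses[OF pg])
      qed
      then show ?thesis
        unfolding klein_four_def using permutes_conj[OF pg klein_fourD(1)[OF p]] by blast
    qed
    then show "g \<otimes>\<^bsub>sym_group 4\<^esub> p \<otimes>\<^bsub>sym_group 4\<^esub> inv\<^bsub>sym_group 4\<^esub> g \<in> klein_four"
      using g unfolding sym_group_mult by simp
  qed
qed

lemma transpose_notin_klein_four:
  assumes "n = 4" "a \<in> {1..n}" "b \<in> {1..n}" "a \<noteq> b"
  shows "transpose a b \<notin> klein_four"
proof
  assume k: "transpose a b \<in> klein_four"
  have "card {a, b} < card {1..4::nat}" using assms by auto
  then have "\<not> {1..4} \<subseteq> {a, b}" 
    by (meson card_mono finite.emptyI finite.insertI not_le)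
  then obtain c where "c \<in> {1..4}" "c \<noteq> a" "c \<noteq> b" by blast
  then have "transpose a b = id" using klein_fourD(3)[OF k, of c] by simp
  then show False using assms(4) by (simp add: transpose_eq_id_iff)
qed

lemma klein_four_transitive:
  assumes x: "x \<in> {1..4}" and y: "y \<in> {1..4}"
  obtains v where "v \<in> klein_four" "v x = y"
proof (cases "x = y")
  case True
  have "id \<in> klein_four" unfolding klein_four_def by (intro CollectI conjI permutes_id disjI1 refl)
  then show ?thesis using that[of id] True by simp
next
  case False
  have "card ({1..4} - {x, y}) = 2" using x y False by simp
  then obtain c d where cd: "{1..4} - {x, y} = {c, d}" "c \<noteq> d" by (auto simp: card_2_iff)
  then have ne: "c \<noteq> x" "c \<noteq> y" "d \<noteq> x" "d \<noteq> y" "c \<in> {1..4}" "d \<in> {1..4}" by blast+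
  define v where "v = transpose x y \<circ> transpose c d"
  have "v permutes {1..4}"
    unfolding v_def using x y ne by (intro permutes_compose permutes_swap_id)
  moreover have "v z \<noteq> z \<and> v (v z) = z" if "z \<in> {1..4}" for z
  proof -
    have "z \<in> {x, y, c, d}" using that cd by blast
    then show ?thesis using False cd(2) ne(1-4) ne(1-4)[symmetric] by (auto simp: v_def transpose_def)
  qed
  ultimately have "v \<in> klein_four" unfolding klein_four_def by blast
  moreover have "v x = y" using ne(1-4) by (simp add: v_def)
  ultimately show ?thesis using that by blast
qed

section \<open>Generation by star transpositions\<close>

text \<open>\<open>(a b) = (1 a)(1 b)(1 a)\<close>. The star has only \<open>n - 1\<close> members,
  which keeps the table checks in degree 6 small.\<close>

lemma subgroup_star_generators:
  assumes K: "subgroup K (sym_group n)" and star: "\<And>k. k \<in> {2..n} \<Longrightarrow> transpose 1 k \<in> K"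
  shows "K = carrier (sym_group n)"
proof
  show "K \<subseteq> carrier (sym_group n)" by (rule subgroup.subset[OF K])
  have comp: "p \<circ> q \<in> K" if "p \<in> K" "q \<in> K" for p q
    using subgroup.m_closed[OF K that] by (simp only: sym_group_mult)
  have id: "id \<in> K" using subgroup.one_closed[OF K] by (simp only: sym_group_one)
  have star': "transpose 1 k \<in> K" if "k \<in> {1..n}" "k \<noteq> 1" for k using star[of k] that by simp
  have trans: "transpose a b \<in> K" if ab: "a \<in> {1..n}" "b \<in> {1..n}" "a \<noteq> b" for a b
  proof -
    consider "a = 1" | "b = 1" | "a \<noteq> 1" "b \<noteq> 1" by blast
    then show ?thesis
    proof cases
      case 1 then show ?thesis using star'[of b] ab by simp
    next
      case 2 then show ?thesis using star'[of a] ab by (simp add: transpose_commute)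
    next
      case 3
      have "transpose a b = (transpose 1 a \<circ> transpose 1 b) \<circ> transpose 1 a"
        using ab(3) 3 by (auto simp: fun_eq_iff transpose_def)
      also have "\<dots> \<in> K" using comp star'[OF ab(1) 3(1)] star'[OF ab(2) 3(2)] by blast
      finally show ?thesis .
    qed
  qed
  show "carrier (sym_group n) \<subseteq> K"
  proof
    fix p assume "p \<in> carrier (sym_group n)"
    then have "p permutes {1..n}" "finite {1..n}" by (simp_all add: sym_group_carrier)
    then show "p \<in> K"
    proof (induction rule: permutes_induct)
      case id show ?case by (rule \<open>id \<in> K\<close>)
    next
      case (swap a b p) then show ?case using comp trans by blast
    qed
  qed
qed

text \<open>The set where two homomorphisms agree is a subgroup.\<close>

lemma sym_group_hom_eqI:
  assumes f: "f \<in> hom (sym_group n) Q" and g: "g \<in> hom (sym_group n) Q" and Q: "group Q"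
    and eq: "\<And>i. i \<in> {2..n} \<Longrightarrow> f (transpose 1 i) = g (transpose 1 i)"
    and p: "p permutes {1..n}"
  shows "f p = g p"
proof -
  interpret f: group_hom "sym_group n" Q f
    using f Q sym_group_is_group by (simp add: group_hom_def group_hom_axioms_def)
  interpret g: group_hom "sym_group n" Q g
    using g Q sym_group_is_group by (simp add: group_hom_def group_hom_axioms_def)
  define K where "K = {p \<in> carrier (sym_group n). f p = g p}"
  have "subgroup K (sym_group n)"
  proof (rule f.G.subgroupI)
    have "\<one>\<^bsub>sym_group n\<^esub> \<in> K" by (simp add: K_def)
    then show "K \<noteq> {}" by blast
  next
    fix a assume "a \<in> K"
    then have "a \<in> carrier (sym_group n)" "f a = g a" by (simp_all add: K_def)
    then show "inv\<^bsub>sym_group n\<^esub> a \<in> K"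
      using f.hom_inv[of a] g.hom_inv[of a] f.G.inv_closed[of a] unfolding K_def by simp
  next
    fix a b assume "a \<in> K" "b \<in> K"
    then have "a \<in> carrier (sym_group n)" "b \<in> carrier (sym_group n)" "f a = g a" "f b = g b"
      by (simp_all add: K_def)
    then show "a \<otimes>\<^bsub>sym_group n\<^esub> b \<in> K"
      using f.hom_mult[of a b] g.hom_mult[of a b] f.G.m_closed[of a b] unfolding K_def by simp
  qed (auto simp: K_def)
  moreover have "transpose 1 k \<in> K" if "k \<in> {2..n}" for k
  proof -
    have "transpose 1 k permutes {1..n}" using that by (intro permutes_swap_id) auto
    then show ?thesis using eq[OF that] by (simp add: K_def sym_group_carrier)
  qed
  ultimately have "K = carrier (sym_group n)" by (rule subgroup_star_generators)
  then have "p \<in> K" using p by (simp add: sym_group_carrier)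
  then show ?thesis by (simp add: K_def)
qed

text \<open>Surjective endomorphisms of a finite group are its automorphisms; in this form they fit
  the count supplied by \<open>goursat\<close>.\<close>

abbreviation auts :: "nat \<Rightarrow> ((nat \<Rightarrow> nat) \<Rightarrow> nat \<Rightarrow> nat) set" where
  "auts n \<equiv> epis (sym_group n) (sym_group n)"

lemma epis_inj_on:
  assumes "f \<in> epis G H" "finite (carrier G)" "card (carrier H) = card (carrier G)"
  shows "inj_on f (carrier G)"
  using assms by (intro eq_card_imp_inj_on) (auto simp: episD)

lemma autsD:
  assumes f: "f \<in> auts n"
  shows "p permutes {1..n} \<Longrightarrow> f p permutes {1..n}"
    "p permutes {1..n} \<Longrightarrow> q permutes {1..n} \<Longrightarrow> f (p \<circ> q) = f p \<circ> f q"
    "f id = id"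
    "p permutes {1..n} \<Longrightarrow> f (inv' p) = inv' (f p)"
    "p permutes {1..n} \<Longrightarrow> q permutes {1..n} \<Longrightarrow> f p = f q \<longleftrightarrow> p = q"
    "q permutes {1..n} \<Longrightarrow> \<exists>p. p permutes {1..n} \<and> f p = q"
proof -
  interpret group_hom "sym_group n" "sym_group n" f
    using f sym_group_is_group by (intro epis_group_hom)
  show 1: "f p permutes {1..n}" if "p permutes {1..n}" for p
    using hom_closed[of p] that by (simp add: sym_group_carrier)
  show "f (p \<circ> q) = f p \<circ> f q" if "p permutes {1..n}" "q permutes {1..n}"
    using hom_mult[of p q] that by (simp add: sym_group_carrier sym_group_mult)
  show "f id = id" using hom_one by (simp only: sym_group_one)
  show "f (inv' p) = inv' (f p)" if "p permutes {1..n}"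
    using hom_inv[of p] that 1[OF that] by (simp add: sym_group_carrier)
  have "inj_on f (carrier (sym_group n))" by (rule epis_inj_on[OF f]) auto
  then show "f p = f q \<longleftrightarrow> p = q" if "p permutes {1..n}" "q permutes {1..n}"
    using that by (auto simp: inj_on_def sym_group_carrier)
  show "\<exists>p. p permutes {1..n} \<and> f p = q" if "q permutes {1..n}"
    using that episD(3)[OF f] by (metis image_iff sym_group_carrier)
qed

section \<open>Involutions that multiply like transpositions\<close>

text \<open>Equal, disjoint or degenerate transpositions give a product that squares to the
  identity; two that share exactly one point give a 3-cycle.\<close>

lemma transpose_comp_order:
  fixes a b c d :: 'a
  defines "y \<equiv> transpose a b \<circ> transpose c d"
  shows "y \<circ> y = id \<or> y \<circ> y \<circ> y = id"
proof (cases "a = b \<or> c = d \<or> a = c \<and> b = d \<or> a = d \<and> b = c \<or> {a, b} \<inter> {c, d} = {}")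
  case True
  then have "y \<circ> y = id" by (elim disjE) (auto simp: y_def fun_eq_iff transpose_def)
  then show ?thesis ..
next
  case False
  then consider "a \<noteq> b" "a \<noteq> d" "b \<noteq> d" "c = a" | "a \<noteq> b" "a \<noteq> c" "b \<noteq> c" "d = a"
    | "a \<noteq> b" "a \<noteq> d" "b \<noteq> d" "c = b" | "a \<noteq> b" "a \<noteq> c" "b \<noteq> c" "d = b" by auto
  then have "y \<circ> y \<circ> y = id" by cases (auto simp: y_def fun_eq_iff transpose_def)
  then show ?thesis ..
qed

text \<open>Conjugating by a 5-cycle or an 8-cycle turns an involution that is neither a transposition nor
  one of the listed exceptions into one whose product with it has order greater than 3.\<close>

lemma three_transposition_involution:
  fixes n :: nat
  assumes p: "p permutes {1..n}" "p \<noteq> id" "\<And>x. p (p x) = x"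
    and ord: "\<And>g. g permutes {1..n} \<Longrightarrow>
      (let y = p \<circ> (g \<circ> p \<circ> inv' g) in y \<circ> y = id \<or> y \<circ> y \<circ> y = id)"
  shows "(\<exists>a\<in>{1..n}. \<exists>b\<in>{1..n}. a \<noteq> b \<and> p = transpose a b) \<or>
    (n = 4 \<or> n = 6) \<and> (\<forall>x\<in>{1..n}. p x \<noteq> x)"
proof -
  have injp: "p u = p v \<longleftrightarrow> u = v" for u v by (rule inj_eq[OF permutes_inj[OF p(1)]])
  have mem: "x \<in> {1..n}" "p x \<in> {1..n}" if "p x \<noteq> x" for x
    using that permutes_not_in[OF p(1)] permutes_in_image[OF p(1)] by metis+
  obtain a where a: "p a \<noteq> a" using p(2) by (auto simp: fun_eq_iff)
  define b where "b = p a"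
  have pb: "p b = a" "p a = b" "a \<noteq> b" using p(3) a by (auto simp: b_def)
  have abX: "a \<in> {1..n}" "b \<in> {1..n}" using mem[OF a] by (simp_all add: b_def)
  show ?thesis
  proof (cases "p = transpose a b")
    case True
    then show ?thesis using abX pb by blast
  next
    case False
    then obtain c where pc': "p c \<noteq> transpose a b c" by (auto simp: fun_eq_iff)
    then have c: "p c \<noteq> c" "c \<noteq> a" "c \<noteq> b" using pb by (auto simp: transpose_def split: if_splits)
    define d where "d = p c"
    have pd: "p d = c" "p c = d" "c \<noteq> d" using p(3) c by (auto simp: d_def)
    have cdX: "c \<in> {1..n}" "d \<in> {1..n}" using mem[OF c(1)] by (simp_all add: d_def)
    have d: "d \<noteq> a" "d \<noteq> b" using pd pb c by auto
    have fpf: "p e \<noteq> e" if e: "e \<in> {1..n}" for e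
    proof
      assume pe: "p e = e"
      then have ne: "e \<noteq> a" "e \<noteq> b" "e \<noteq> c" "e \<noteq> d" using pb pd by auto
      \<comment> \<open>The 5-cycle \<open>a -> b -> c -> d -> e -> a\<close>. The product with the
        conjugate moves \<open>a\<close> to \<open>b\<close>, \<open>d\<close>, \<open>e\<close> in
        turn, so neither its square nor its cube fixes \<open>a\<close>.\<close>
      let ?f = "id(a := b, b := c, c := d, d := e, e := a)"
      note dist = ne ne[symmetric] d d[symmetric] c(2,3) c(2,3)[symmetric] pb(3) pb(3)[symmetric] pd(3) pd(3)[symmetric]
      obtain g where g: "g permutes {1..n}" "\<And>x. x \<in> {a, b, c, d, e} \<Longrightarrow> g x = ?f x"
      proof (rule permutes_extend[of "{1..n}" "{a, b, c, d, e}" ?f])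
        show "inj_on ?f {a, b, c, d, e}" using dist by (simp add: inj_on_def)
      qed (use dist abX cdX e in simp_all)
      define q where "q = g \<circ> p \<circ> inv' g"
      have q: "q (g x) = g (p x)" for x unfolding q_def by (rule permutes_conj_apply[OF g(1)])
      have gs: "g a = b" "g b = c" "g c = d" "g d = e" "g e = a"
        using g(2)[of a] g(2)[of b] g(2)[of c] g(2)[of d] g(2)[of e] dist by simp_all
      have qs: "q b = c" "q d = e" "q a = a"
        using q[of a] q[of c] q[of e] gs pb pd pe by simp_all
      have "(p \<circ> q) a = b" "(p \<circ> q) b = d" "(p \<circ> q) d = e" using qs pb pd pe by simp_all
      then have "((p \<circ> q) \<circ> (p \<circ> q)) a = d" "((p \<circ> q) \<circ> (p \<circ> q) \<circ> (p \<circ> q)) a = e"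
        by (simp_all only: comp_apply)
      moreover have "(p \<circ> q) \<circ> (p \<circ> q) = id \<or> (p \<circ> q) \<circ> (p \<circ> q) \<circ> (p \<circ> q) = id"
        using ord[OF g(1)] unfolding q_def Let_def .
      ultimately show False using ne d by (metis id_apply)
    qed
    \<comment> \<open>Four 2-cycles are too many: conjugating by the 8-cycle through their points
      gives a product that moves \<open>a\<close> to \<open>u\<close>, \<open>e\<close>,
      \<open>c\<close> in turn. Two or three 2-cycles without fixed points remain, i.e. degree 4 or
      6.\<close>
    have no: False if e: "e \<in> {1..n}" "e \<notin> {a, b, c, d}" and u: "u \<in> {1..n}" "u \<notin> {a, b, c, d, e, p e}" for e u
    proof -
      define f v where "f = p e" and "v = p u"
      have pf: "p f = e" "p e = f" "e \<noteq> f" using p(3) fpf[OF e(1)] by (auto simp: f_def)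
      have pv: "p v = u" "p u = v" "u \<noteq> v" using p(3) fpf[OF u(1)] by (auto simp: v_def)
      have fX: "f \<in> {1..n}" "v \<in> {1..n}" using mem[OF fpf[OF e(1)]] mem[OF fpf[OF u(1)]] by (simp_all add: f_def v_def)
      have ne: "e \<noteq> a" "e \<noteq> b" "e \<noteq> c" "e \<noteq> d" "u \<noteq> a" "u \<noteq> b" "u \<noteq> c" "u \<noteq> d" "u \<noteq> e" "u \<noteq> f"
        using e u by (auto simp: f_def)
      have ne2: "f \<noteq> a" "f \<noteq> b" "f \<noteq> c" "f \<noteq> d" "v \<noteq> a" "v \<noteq> b" "v \<noteq> c" "v \<noteq> d" "v \<noteq> e" "v \<noteq> f"
        using ne pb pd pf pv by metis+
      let ?f = "id(a := b, b := c, c := d, d := e, e := f, f := u, u := v, v := a)"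
      note dist0 = ne ne2 pf(3) pv(3) d c(2,3) pb(3) pd(3)
      note dist = dist0 dist0[symmetric]
      obtain g where g: "g permutes {1..n}" "\<And>x. x \<in> {a, b, c, d, e, f, u, v} \<Longrightarrow> g x = ?f x"
      proof (rule permutes_extend[of "{1..n}" "{a, b, c, d, e, f, u, v}" ?f])
        show "inj_on ?f {a, b, c, d, e, f, u, v}" using dist by (simp add: inj_on_def)
      qed (use dist abX cdX e(1) u(1) fX in simp_all)
      define q where "q = g \<circ> p \<circ> inv' g"
      have q: "q (g x) = g (p x)" for x unfolding q_def by (rule permutes_conj_apply[OF g(1)])
      have gs: "g a = b" "g b = c" "g c = d" "g d = e" "g e = f" "g f = u" "g u = v" "g v = a"
        using g(2)[of a] g(2)[of b] g(2)[of c] g(2)[of d] g(2)[of e] g(2)[of f] g(2)[of u] g(2)[of v] dist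
        by simp_all
      have qs: "q a = v" "q u = f" "q e = d"
        using q[of v] q[of f] q[of d] gs pb pd pf pv by simp_all
      have "(p \<circ> q) a = u" "(p \<circ> q) u = e" "(p \<circ> q) e = c" using qs pb pd pf pv by simp_all
      then have "((p \<circ> q) \<circ> (p \<circ> q)) a = e" "((p \<circ> q) \<circ> (p \<circ> q) \<circ> (p \<circ> q)) a = c"
        by (simp_all only: comp_apply)
      moreover have "(p \<circ> q) \<circ> (p \<circ> q) = id \<or> (p \<circ> q) \<circ> (p \<circ> q) \<circ> (p \<circ> q) = id"
        using ord[OF g(1)] unfolding q_def Let_def .
      ultimately show False using ne c by (metis id_apply)
    qed
    have "n = 4 \<or> n = 6"
    proof (cases "{1..n} \<subseteq> {a, b, c, d}")
      case True
      then have "{1..n} = {a, b, c, d}" using abX cdX by blast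
      moreover have "card {a, b, c, d} = 4" using pb(3) pd(3) c d by auto
      ultimately show ?thesis by (metis card_atLeastAtMost diff_Suc_1)
    next
      case False
      then obtain e where e: "e \<in> {1..n}" "e \<notin> {a, b, c, d}" by blast
      have "p e \<in> {1..n}" using mem[OF fpf[OF e(1)]] by blast
      then have "{1..n} = {a, b, c, d, e, p e}" using no[OF e] abX cdX e by blast
      moreover have "p e \<notin> {a, b, c, d, e}" using e(2) fpf[OF e(1)] pb pd p(3) by (metis insert_iff singletonD)
      then have "card {a, b, c, d, e, p e} = 6" using pb(3) pd(3) c d e(2) by auto
      ultimately show ?thesis by (metis card_atLeastAtMost diff_Suc_1)
    qed
    then show ?thesis using fpf by blast
  qed
qed

section \<open>Automorphisms of the symmetric groups\<close>

text \<open>Since \<open>f\<close> is onto, every conjugate of \<open>f t\<close> is the image of a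
  conjugate of \<open>t\<close>, so the order condition on products passes from transpositions to
  \<open>f t\<close>. The exception of degree 4 needs a separate argument.\<close>

lemma aut_transpose:
  fixes n :: nat
  assumes f: "f \<in> auts n" and ab: "a \<in> {1..n}" "b \<in> {1..n}" "a \<noteq> b"
  shows "(\<exists>c\<in>{1..n}. \<exists>d\<in>{1..n}. c \<noteq> d \<and> f (transpose a b) = transpose c d) \<or>
    n = 6 \<and> (\<forall>x\<in>{1..n}. f (transpose a b) x \<noteq> x)"
proof -
  note F = autsD[OF f]
  define t p where "t = transpose a b" and "p = f t"
  have pt: "t permutes {1..n}" unfolding t_def using ab by (intro permutes_swap_id)
  have pp: "p permutes {1..n}" unfolding p_def by (rule F(1)[OF pt])
  have tid: "t \<noteq> id" using ab by (simp add: t_def transpose_eq_id_iff)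
  have pid: "p \<noteq> id" using F(5)[OF pt permutes_id] tid unfolding F(3) p_def by blast
  have "p \<circ> p = f (t \<circ> t)" unfolding p_def using F(2)[OF pt pt] by simp
  also have "t \<circ> t = id" by (simp add: t_def)
  finally have "p \<circ> p = id" unfolding F(3) .
  then have inv: "p (p x) = x" for x by (metis comp_apply id_apply)
  have "(\<exists>c\<in>{1..n}. \<exists>d\<in>{1..n}. c \<noteq> d \<and> p = transpose c d) \<or> (n = 4 \<or> n = 6) \<and> (\<forall>x\<in>{1..n}. p x \<noteq> x)"
  proof (rule three_transposition_involution[OF pp pid inv])
    fix g assume g: "g permutes {1..n}"
    then obtain h where h: "h permutes {1..n}" "f h = g" using F(6) by blast
    define s where "s = h \<circ> t \<circ> inv' h"
    have ps: "s permutes {1..n}" unfolding s_def by (rule permutes_conj[OF h(1) pt])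
    define y where "y = t \<circ> s"
    have py: "y permutes {1..n}" unfolding y_def by (rule permutes_compose[OF ps pt])
    have "g \<circ> p \<circ> inv' g = f s"
      unfolding s_def p_def F(2)[OF permutes_compose[OF pt h(1)] permutes_inv[OF h(1)]] F(2)[OF h(1) pt]
        F(4)[OF h(1)] h(2) ..
    then have "p \<circ> (g \<circ> p \<circ> inv' g) = f y" unfolding p_def y_def F(2)[OF pt ps] by simp
    moreover have "y \<circ> y = id \<or> y \<circ> y \<circ> y = id"
      unfolding y_def s_def t_def permutes_conj_transpose[OF h(1)] by (rule transpose_comp_order)
    then have "f y \<circ> f y = id \<or> f y \<circ> f y \<circ> f y = id"
      using F(2)[OF py py] F(2)[OF permutes_compose[OF py py] py] F(3) by metis
    ultimately show "let y = p \<circ> (g \<circ> p \<circ> inv' g) in y \<circ> y = id \<or> y \<circ> y \<circ> y = id"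
      unfolding Let_def by metis
  qed
  \<comment> \<open>In degree 4 a fixed-point-free involution lies in the normal subgroup
    \<open>klein_four\<close>. Its preimage \<open>K\<close> is normal and contains
    \<open>t\<close>, which is odd and outside \<open>klein_four\<close>; so \<open>K\<close> is
    everything, against surjectivity of \<open>f\<close>.\<close>
  moreover have False if n4: "n = 4" and fpf: "\<forall>x\<in>{1..n}. p x \<noteq> x"
  proof -
    interpret hom: group_hom "sym_group n" "sym_group n" f
      using f sym_group_is_group by (intro epis_group_hom)
    define K where "K = {x \<in> carrier (sym_group n). f x \<in> klein_four}"
    have V: "klein_four \<lhd> sym_group n" using klein_four_normal n4 by simp
    note VD = normal_sym_groupD[OF V]
    have K: "K \<lhd> sym_group n"
    proof (rule hom.G.normal_invI)
      show "subgroup K (sym_group n)"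
      proof (rule hom.G.subgroupI)
        show "K \<subseteq> carrier (sym_group n)" by (auto simp: K_def)
        have "id \<in> K" unfolding K_def sym_group_carrier using VD(2) by (simp only: F(3) mem_Collect_eq permutes_id simp_thms)
        then show "K \<noteq> {}" by blast
        show "inv\<^bsub>sym_group n\<^esub> a \<in> K" if "a \<in> K" for a
          using that VD(4) F(4) by (simp add: K_def sym_group_carrier permutes_inv)
        show "a \<otimes>\<^bsub>sym_group n\<^esub> b \<in> K" if "a \<in> K" "b \<in> K" for a b
          using that VD(3) F(2) unfolding K_def sym_group_carrier sym_group_mult mem_Collect_eq
          by (metis permutes_compose)
      qed
      fix x h assume x: "x \<in> carrier (sym_group n)" and h: "h \<in> K"
      then have "f (x \<circ> h \<circ> inv' x) = f x \<circ> f h \<circ> inv' (f x)"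
        unfolding K_def sym_group_carrier mem_Collect_eq using F(2,4) by (metis permutes_compose permutes_inv)
      also have "\<dots> \<in> klein_four" using h x F(1) by (intro VD(5)) (auto simp: K_def sym_group_carrier)
      finally have "x \<circ> h \<circ> inv' x \<in> K"
        using x h permutes_conj[of x "{1..n}" h] unfolding K_def sym_group_carrier mem_Collect_eq by blast
      then show "x \<otimes>\<^bsub>sym_group n\<^esub> h \<otimes>\<^bsub>sym_group n\<^esub> inv\<^bsub>sym_group n\<^esub> x \<in> K"
        using x unfolding sym_group_mult by simp
    qed
    have "p \<in> klein_four" using pp inv fpf unfolding klein_four_def n4 by blast
    then have tK: "t \<in> K" using pt by (simp add: K_def p_def sym_group_carrier)
    have "t \<notin> klein_four" unfolding t_def by (rule transpose_notin_klein_four[OF n4 ab])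
    moreover have "t \<notin> carrier (alt_group n)"
      using ab by (simp add: alt_group_carrier t_def evenperm_swap)
    ultimately have "K = carrier (sym_group n)"
      using normal_sym_group_cases[OF K] tK tid by blast
    moreover obtain x where x: "x permutes {1..n}" "f x = t" using F(6)[OF pt] by blast
    ultimately have "x \<in> K" by (simp add: sym_group_carrier)
    then show False using \<open>t \<notin> klein_four\<close> x(2) by (simp add: K_def)
  qed
  ultimately show ?thesis unfolding p_def t_def by blast
qed

abbreviation inner_aut :: "nat \<Rightarrow> (nat \<Rightarrow> nat) \<Rightarrow> (nat \<Rightarrow> nat) \<Rightarrow> nat \<Rightarrow> nat" where
  "inner_aut n g \<equiv> restrict (\<lambda>p. g \<circ> p \<circ> inv' g) (carrier (sym_group n))"

lemma conj_hom:
  assumes g: "g permutes {1..n}"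
  shows "(\<lambda>p. g \<circ> p \<circ> inv' g) \<in> hom (sym_group n) (sym_group n)"
proof (rule homI)
  fix x assume "x \<in> carrier (sym_group n)"
  then show "g \<circ> x \<circ> inv' g \<in> carrier (sym_group n)"
    using permutes_conj[OF g] by (simp only: sym_group_carrier)
next
  fix x y
  show "g \<circ> (x \<otimes>\<^bsub>sym_group n\<^esub> y) \<circ> inv' g = (g \<circ> x \<circ> inv' g) \<otimes>\<^bsub>sym_group n\<^esub> (g \<circ> y \<circ> inv' g)"
    unfolding sym_group_mult by (simp add: fun_eq_iff permutes_inverses[OF g])
qed

lemma inner_aut_in_auts:
  assumes g: "g permutes {1..n}"
  shows "inner_aut n g \<in> auts n"
  unfolding restrict_in_epis_iff[OF sym_group_is_group]
proof
  show "(\<lambda>p. g \<circ> p \<circ> inv' g) \<in> hom (sym_group n) (sym_group n)" by (rule conj_hom[OF g])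
  show "(\<lambda>p. g \<circ> p \<circ> inv' g) ` carrier (sym_group n) = carrier (sym_group n)"
  proof (intro equalityI subsetI)
    fix q assume "q \<in> (\<lambda>p. g \<circ> p \<circ> inv' g) ` carrier (sym_group n)"
    then show "q \<in> carrier (sym_group n)" using permutes_conj[OF g] by (auto simp only: sym_group_carrier)
  next
    fix q assume q: "q \<in> carrier (sym_group n)"
    have "inv' g \<circ> q \<circ> g \<in> carrier (sym_group n)"
      using q g by (simp only: sym_group_carrier) (intro permutes_compose permutes_inv)
    moreover have "q = g \<circ> (inv' g \<circ> q \<circ> g) \<circ> inv' g"
      by (simp add: fun_eq_iff permutes_inverses[OF g])
    ultimately show "q \<in> (\<lambda>p. g \<circ> p \<circ> inv' g) ` carrier (sym_group n)" by blast
  qed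
qed

text \<open>Equal conjugates of \<open>(x y)\<close> and \<open>(x z)\<close> locate
  \<open>f x\<close> in both \<open>{g x, g y}\<close> and \<open>{g x, g z}\<close>, whose only
  common point is \<open>g x\<close>. A second and a third point are needed, hence the bound on
  \<open>n\<close>.\<close>

lemma inner_aut_inj:
  assumes n: "n \<ge> 3"
  shows "inj_on (inner_aut n) (carrier (sym_group n))"
proof (rule inj_onI)
  fix f g assume fg: "f \<in> carrier (sym_group n)" "g \<in> carrier (sym_group n)" and eq: "inner_aut n f = inner_aut n g"
  then have f: "f permutes {1..n}" and g: "g permutes {1..n}" by (simp_all add: sym_group_carrier)
  have tr: "transpose (f x) (f y) = transpose (g x) (g y)" if "x \<in> {1..n}" "y \<in> {1..n}" for x y
  proof -
    have "transpose x y \<in> carrier (sym_group n)" using that by (simp add: sym_group_carrier permutes_swap_id)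
    then show ?thesis
      using fun_cong[OF eq, of "transpose x y"]
      unfolding restrict_apply permutes_conj_transpose[OF f] permutes_conj_transpose[OF g] by simp
  qed
  show "f = g"
  proof
    fix x show "f x = g x"
    proof (cases "x \<in> {1..n}")
      case False then show ?thesis using f g by (simp add: permutes_not_in)
    next
      case True
      have "card ({1..n} - {x}) \<ge> 2" using True n by simp
      then obtain y z where yz: "y \<in> {1..n}" "z \<in> {1..n}" "y \<noteq> x" "z \<noteq> x" "y \<noteq> z"
        by (metis DiffE One_nat_def card_le_Suc0_iff_eq finite_Diff finite_atLeastAtMost insertI1
            not_less_eq_eq numeral_2_eq_2)
      have inj: "f u = f v \<longleftrightarrow> u = v" "g u = g v \<longleftrightarrow> u = v" for u v
        using f g by (simp_all add: permutes_inj inj_eq)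
      have "transpose (g x) (g y) (f x) = f y" "transpose (g x) (g z) (f x) = f z"
        using tr[OF True yz(1)] tr[OF True yz(2)] by (metis transpose_apply_first)+
      then show ?thesis using yz inj by (metis transpose_apply_other transpose_apply_second)
    qed
  qed
qed

text \<open>The \<open>(1 i)\<close> do not commute pairwise, so their images are transpositions
  that pairwise meet. Such a family is a star or a triangle; a star with centre \<open>a\<close>
  gives \<open>g\<close> by \<open>1 -> a\<close> and \<open>i ->\<close> the other end of the image
  of \<open>(1 i)\<close>.\<close>

lemma aut_inner:
  fixes n :: nat
  assumes n: "n \<ge> 3" and f: "f \<in> auts n"
    and tr: "\<And>i. i \<in> {2..n} \<Longrightarrow> \<exists>c\<in>{1..n}. \<exists>d\<in>{1..n}. c \<noteq> d \<and> f (transpose 1 i) = transpose c d"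
  obtains g where "g permutes {1..n}" "f = inner_aut n g"
proof -
  note F = autsD[OF f]
  define T where "T i = f (transpose 1 i)" for i
  have p1: "transpose 1 i permutes {1..n}" if "i \<in> {2..n}" for i using that by (intro permutes_swap_id) auto
  have Tinj: "T i = T j \<longleftrightarrow> i = j" if "i \<in> {2..n}" "j \<in> {2..n}" for i j
    unfolding T_def F(5)[OF p1[OF that(1)] p1[OF that(2)]] by (metis transpose_apply_first)
  have share: "{c, d} \<inter> {c', d'} \<noteq> {}"
    if ij: "i \<in> {2..n}" "j \<in> {2..n}" "i \<noteq> j" and T: "T i = transpose c d" "T j = transpose c' d'" for i j c d c' d'
  proof
    assume "{c, d} \<inter> {c', d'} = {}"
    then have "T i \<circ> T j = T j \<circ> T i" unfolding T by (auto simp: fun_eq_iff transpose_def)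
    then have "f (transpose 1 i \<circ> transpose 1 j) = f (transpose 1 j \<circ> transpose 1 i)"
      unfolding T_def using F(2) p1 ij by simp
    then have "transpose 1 i \<circ> transpose 1 j = transpose 1 j \<circ> transpose 1 i"
      using F(5) permutes_compose p1 ij by blast
    then have "(transpose 1 i \<circ> transpose 1 j) 1 = (transpose 1 j \<circ> transpose 1 i) 1" by simp
    then show False using ij by (auto simp: transpose_def split: if_splits)
  qed
  have 23: "2 \<in> {2..n}" "3 \<in> {2..n}" using n by auto
  obtain u v where uv: "u \<in> {1..n}" "v \<in> {1..n}" "u \<noteq> v" "T 2 = transpose u v"
    using tr[OF 23(1)] by (auto simp: T_def)
  obtain u' v' where uv': "u' \<in> {1..n}" "v' \<in> {1..n}" "u' \<noteq> v'" "T 3 = transpose u' v'"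
    using tr[OF 23(2)] by (auto simp: T_def)
  have "{u, v} \<inter> {u', v'} \<noteq> {}" by (rule share[OF 23 _ uv(4) uv'(4)]) simp
  then obtain a where a: "a \<in> {u, v}" "a \<in> {u', v'}" by blast
  obtain b where b: "b \<in> {1..n}" "b \<noteq> a" "T 2 = transpose a b"
    using a(1) uv by (metis insertE singletonD transpose_commute)
  obtain c where c: "c \<in> {1..n}" "c \<noteq> a" "T 3 = transpose a c"
    using a(2) uv' by (metis insertE singletonD transpose_commute)
  have aX: "a \<in> {1..n}" using a uv by blast
  have bc: "b \<noteq> c" using Tinj[OF 23] b c by auto
  have star: "\<exists>s\<in>{1..n}. s \<noteq> a \<and> T i = transpose a s" if i: "i \<in> {2..n}" for i
  proof -
    consider "i = 2" | "i = 3" | "i \<noteq> 2" "i \<noteq> 3" by blast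
    then show ?thesis
    proof cases
      case 3
      obtain r s where rs: "r \<in> {1..n}" "s \<in> {1..n}" "r \<noteq> s" "T i = transpose r s"
        using tr[OF i] by (auto simp: T_def)
      have m2: "{r, s} \<inter> {a, b} \<noteq> {}" by (rule share[OF i 23(1) 3(1) rs(4) b(3)])
      have m3: "{r, s} \<inter> {a, c} \<noteq> {}" by (rule share[OF i 23(2) 3(2) rs(4) c(3)])
      \<comment> \<open>The triangle is impossible: its third side \<open>(b c)\<close> is the image
        of \<open>(1 2)(1 3)(1 2) = (2 3)\<close>, which fixes 1, unlike
        \<open>(1 i)\<close>.\<close>
      have "a \<in> {r, s}"
      proof (rule ccontr)
        assume "a \<notin> {r, s}"
        then have "{r, s} = {b, c}" using m2 m3 bc by blast
        then have "T i = transpose b c" using rs(4) by (metis doubleton_eq_iff transpose_commute)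
        also have "\<dots> = (T 2 \<circ> T 3) \<circ> T 2"
          unfolding b(3) c(3) using b(2) c(2) bc by (auto simp: fun_eq_iff transpose_def)
        also have "\<dots> = f ((transpose 1 2 \<circ> transpose 1 3) \<circ> transpose 1 2)"
          unfolding T_def using F(2) p1[OF 23(1)] p1[OF 23(2)] permutes_compose by metis
        finally have "transpose 1 i = (transpose 1 2 \<circ> transpose 1 3) \<circ> transpose 1 2"
          unfolding T_def using F(5) p1[OF 23(1)] p1[OF 23(2)] p1[OF i] permutes_compose by metis
        then have "transpose 1 i 1 = ((transpose 1 2 \<circ> transpose 1 3) \<circ> transpose 1 2) (1::nat)" by simp
        then show False using i by (simp add: transpose_def)
      qed
      then show ?thesis using rs by (metis insertE singletonD transpose_commute)
    qed (use b c in blast)+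
  qed
  then obtain h where h: "\<And>i. i \<in> {2..n} \<Longrightarrow> h i \<in> {1..n} \<and> h i \<noteq> a \<and> T i = transpose a (h i)"
    by metis
  have X: "i = 1 \<or> i \<in> {2..n}" if "i \<in> {1..n}" for i using that by auto
  obtain g where g: "g permutes {1..n}" "\<And>x. x \<in> {1..n} \<Longrightarrow> g x = (h(1 := a)) x"
  proof (rule permutes_extend[of "{1..n}" "{1..n}" "h(1 := a)"])
    show "inj_on (h(1 := a)) {1..n}"
    proof (rule inj_onI)
      fix i j assume ij: "i \<in> {1..n}" "j \<in> {1..n}" "(h(1 := a)) i = (h(1 := a)) j"
      show "i = j"
      proof (cases "i = 1 \<or> j = 1")
        case True then show ?thesis using ij X h by (metis fun_upd_apply)
      next
        case False
        then have "i \<in> {2..n}" "j \<in> {2..n}" "h i = h j" using ij X by auto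
        then show ?thesis using h Tinj by metis
      qed
    qed
    show "(h(1 := a)) ` {1..n} \<subseteq> {1..n}" using X h aX by (metis fun_upd_apply image_subsetI)
  qed auto
  have "f p = g \<circ> p \<circ> inv' g" if p: "p permutes {1..n}" for p
  proof (rule sym_group_hom_eqI[OF episD(1)[OF f] conj_hom[OF g(1)] sym_group_is_group _ p])
    fix i assume i: "i \<in> {2..n}"
    have "g 1 = a" using g(2)[of 1] n by simp
    moreover have "g i = h i" using g(2)[of i] i by auto
    ultimately show "f (transpose 1 i) = g \<circ> transpose 1 i \<circ> inv' g"
      unfolding permutes_conj_transpose[OF g(1)] using h[OF i] by (simp add: T_def)
  qed
  then have "f = inner_aut n g"
    by (intro epis_eqI[OF f inner_aut_in_auts[OF g(1)]]) (simp add: sym_group_carrier)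
  then show ?thesis using that g(1) by blast
qed

lemma card_auts:
  assumes n: "n \<ge> 3" "n \<noteq> 6"
  shows "card (auts n) = fact n"
proof -
  have "auts n = inner_aut n ` carrier (sym_group n)"
  proof (intro equalityI subsetI)
    fix f assume f: "f \<in> auts n"
    have "\<exists>c\<in>{1..n}. \<exists>d\<in>{1..n}. c \<noteq> d \<and> f (transpose 1 i) = transpose c d" if "i \<in> {2..n}" for i
      using aut_transpose[OF f, of 1 i] that n by auto
    then obtain g where "g permutes {1..n}" "f = inner_aut n g" by (rule aut_inner[OF n(1) f])
    then show "f \<in> inner_aut n ` carrier (sym_group n)" by (auto simp: sym_group_carrier)
  qed (use inner_aut_in_auts in \<open>auto simp: sym_group_carrier\<close>)
  then show ?thesis using inner_aut_inj[OF n(1)] by (simp add: card_image sym_group_card_carrier)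
qed

section \<open>The outer automorphism of the symmetric group of degree 6\<close>

text \<open>\<open>syntheme i j\<close> is the fixed-point-free involution given by the synthematic totals \<open>i\<close> and \<open>j\<close>
  of \<open>{1..6}\<close>, i.e. their unique common syntheme (perfect matching), and the identity for \<open>i = j\<close>.
  \<open>syntheme_swap k\<close> is the action of the transposition \<open>(1 k)\<close> on the six totals.\<close>

definition syntheme :: "nat \<Rightarrow> nat \<Rightarrow> nat \<Rightarrow> nat" where
  "syntheme i j a =
    [[[1, 2, 3, 4, 5, 6], [2, 1, 4, 3, 6, 5], [6, 3, 2, 5, 4, 1], [5, 4, 6, 2, 1, 3], [4, 6, 5, 1, 3, 2], [3, 5, 1, 6, 2, 4]],
     [[2, 1, 4, 3, 6, 5], [1, 2, 3, 4, 5, 6], [4, 5, 6, 1, 2, 3], [3, 6, 1, 5, 4, 2], [5, 3, 2, 6, 1, 4], [6, 4, 5, 2, 3, 1]],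
     [[6, 3, 2, 5, 4, 1], [4, 5, 6, 1, 2, 3], [1, 2, 3, 4, 5, 6], [2, 1, 5, 6, 3, 4], [3, 4, 1, 2, 6, 5], [5, 6, 4, 3, 1, 2]],
     [[5, 4, 6, 2, 1, 3], [3, 6, 1, 5, 4, 2], [2, 1, 5, 6, 3, 4], [1, 2, 3, 4, 5, 6], [6, 5, 4, 3, 2, 1], [4, 3, 2, 1, 6, 5]],
     [[4, 6, 5, 1, 3, 2], [5, 3, 2, 6, 1, 4], [3, 4, 1, 2, 6, 5], [6, 5, 4, 3, 2, 1], [1, 2, 3, 4, 5, 6], [2, 1, 6, 5, 4, 3]],
     [[3, 5, 1, 6, 2, 4], [6, 4, 5, 2, 3, 1], [5, 6, 4, 3, 1, 2], [4, 3, 2, 1, 6, 5], [2, 1, 6, 5, 4, 3], [1, 2, 3, 4, 5, 6]]]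
    ! (i - 1) ! (j - 1) ! (a - 1)"

definition syntheme_swap :: "nat \<Rightarrow> nat \<Rightarrow> nat" where
  "syntheme_swap k i = [[1, 2, 3, 4, 5, 6], [2, 1, 4, 3, 6, 5], [6, 4, 5, 2, 3, 1], [5, 3, 2, 6, 1, 4],
     [4, 5, 6, 1, 2, 3], [3, 6, 1, 5, 4, 2]] ! (k - 1) ! (i - 1)"

lemma atLeastAtMost_1_6: "{1..6::nat} = set [1, 2, 3, 4, 5, 6]" and atLeastAtMost_2_6: "{2..6::nat} = set [2, 3, 4, 5, 6]"
  by auto

text \<open>Compatible pairs of a permutation of the totals and one of the points, containing every
  star transposition of the points.\<close>

lemma syntheme_swap_equivariant:
  "\<forall>k\<in>{2..6}. \<forall>i\<in>{1..6}. \<forall>j\<in>{1..6}. \<forall>a\<in>{1..6}.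
    syntheme (syntheme_swap k i) (syntheme_swap k j) (transpose 1 k a) = transpose 1 k (syntheme i j a)"
  unfolding atLeastAtMost_1_6 atLeastAtMost_2_6 by code_simp

text \<open>The dual check, with star transpositions of the totals: swapping the totals 1 and
  \<open>k\<close> is induced on the points by their common syntheme.\<close>

lemma syntheme_equivariant:
  "\<forall>k\<in>{2..6}. \<forall>i\<in>{1..6}. \<forall>j\<in>{1..6}. \<forall>a\<in>{1..6}.
    syntheme (transpose 1 k i) (transpose 1 k j) (syntheme 1 k a) = syntheme 1 k (syntheme i j a)"
  unfolding atLeastAtMost_1_6 atLeastAtMost_2_6 by code_simp

text \<open>The 15 pairs of totals have 15 different common synthemes. This makes the action on the
  totals determined by the action on the points.\<close>

lemma syntheme_inj:
  "\<forall>i\<in>{1..6}. \<forall>j\<in>{1..6}. \<forall>p\<in>{1..6}. \<forall>q\<in>{1..6}. i \<noteq> j \<longrightarrow>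
    (\<forall>a\<in>{1..6}. syntheme p q a = syntheme i j a) \<longrightarrow> p = i \<and> q = j \<or> p = j \<and> q = i"
  unfolding atLeastAtMost_1_6 by code_simp

lemma syntheme_involution:
  "\<forall>k\<in>{2..6}. \<forall>a\<in>{1..6}. syntheme 1 k a \<in> {1..6} \<and> syntheme 1 k (syntheme 1 k a) = a"
  unfolding atLeastAtMost_1_6 atLeastAtMost_2_6 by code_simp

lemma syntheme_swap_involution:
  "\<forall>k\<in>{2..6}. \<forall>a\<in>{1..6}. syntheme_swap k a \<in> {1..6} \<and> syntheme_swap k a \<noteq> a \<and>
    syntheme_swap k (syntheme_swap k a) = a"
  unfolding atLeastAtMost_1_6 atLeastAtMost_2_6 by code_simp

lemma permutes_involution_extend:
  assumes "\<And>x. x \<in> X \<Longrightarrow> f x \<in> X \<and> f (f x) = x"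
  shows "(\<lambda>x. if x \<in> X then f x else x) permutes X"
  by (rule bij_imp_permutes, rule bij_betw_byWitness[where f' = f]) (use assms in auto)

text \<open>The pairs of permutations of totals and points that preserve the table form a subgroup
  \<open>D\<close>. Both projections are onto by the two families of generators, and the kernel is
  trivial, so \<open>D\<close> is the graph of an automorphism; it sends \<open>(1 2)\<close> to the
  fixed-point-free \<open>syntheme_swap 2\<close>.\<close>

lemma outer_aut_exists:
  obtains f where "f \<in> auts 6" "\<And>x. x \<in> {1..6} \<Longrightarrow> f (transpose 1 2) x \<noteq> x"
proof -
  let ?S = "sym_group 6"
  define D where "D = {(h, g). h permutes {1..6} \<and> g permutes {1..6} \<and>
    (\<forall>i\<in>{1..6}. \<forall>j\<in>{1..6}. \<forall>a\<in>{1..6}. syntheme (h i) (h j) (g a) = g (syntheme i j a))}"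
  \<comment> \<open>The tables are meaningful on \<open>{1..6}\<close> only; a permutation in the
    sense of \<open>permutes\<close> has to be the identity elsewhere.\<close>
  define ext where "ext f x = (if x \<in> {1..6} then f x else x)" for f and x :: nat
  have S: "group ?S" by (rule sym_group_is_group)
  interpret SS: group "?S \<times>\<times> ?S" by (intro DirProd_group S)
  have DI: "(h, g) \<in> D" if "h permutes {1..6}" "g permutes {1..6}"
    "\<And>i j a. i \<in> {1..6} \<Longrightarrow> j \<in> {1..6} \<Longrightarrow> a \<in> {1..6} \<Longrightarrow> syntheme (h i) (h j) (g a) = g (syntheme i j a)" for h g
    using that unfolding D_def by blast
  have DD: "h permutes {1..6}" "g permutes {1..6}"
    "\<lbrakk>i \<in> {1..6}; j \<in> {1..6}; a \<in> {1..6}\<rbrakk> \<Longrightarrow> syntheme (h i) (h j) (g a) = g (syntheme i j a)"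
    if "(h, g) \<in> D" for h g i j a
    using that unfolding D_def by blast+
  have sub: "subgroup D (?S \<times>\<times> ?S)"
  proof (rule SS.subgroupI)
    show "D \<subseteq> carrier (?S \<times>\<times> ?S)" using DD(1,2) by (auto simp: sym_group_carrier)
    have "(id, id) \<in> D" by (rule DI) simp_all
    then show "D \<noteq> {}" by blast
  next
    fix d assume d: "d \<in> D"
    obtain h g where hg: "d = (h, g)" by (cases d)
    note H = DD[OF d[unfolded hg]]
    have "(inv' h, inv' g) \<in> D"
    proof (rule DI[OF permutes_inv[OF H(1)] permutes_inv[OF H(2)]])
      fix i j a assume ija: "i \<in> {1..6::nat}" "j \<in> {1..6::nat}" "a \<in> {1..6::nat}"
      have "inv' h i \<in> {1..6}" "inv' h j \<in> {1..6}" "inv' g a \<in> {1..6}"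
        using ija permutes_in_image[OF permutes_inv[OF H(1)]] permutes_in_image[OF permutes_inv[OF H(2)]] by blast+
      from H(3)[OF this] have "g (syntheme (inv' h i) (inv' h j) (inv' g a)) = syntheme i j a"
        by (simp only: permutes_inverses[OF H(1)] permutes_inverses[OF H(2)])
      then show "syntheme (inv' h i) (inv' h j) (inv' g a) = inv' g (syntheme i j a)"
        using permutes_inverses(2)[OF H(2)] by metis
    qed
    then show "inv\<^bsub>?S \<times>\<times> ?S\<^esub> d \<in> D"
      using H(1,2) by (simp add: hg S inv_DirProd sym_group_carrier)
  next
    fix d d' assume d: "d \<in> D" "d' \<in> D"
    obtain h g where hg: "d = (h, g)" by (cases d)
    obtain h' g' where hg': "d' = (h', g')" by (cases d')
    note H = DD[OF d(1)[unfolded hg]] and H' = DD[OF d(2)[unfolded hg']]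
    have "(h \<circ> h', g \<circ> g') \<in> D"
    proof (rule DI)
      fix i j a assume ija: "i \<in> {1..6::nat}" "j \<in> {1..6::nat}" "a \<in> {1..6::nat}"
      then have "h' i \<in> {1..6}" "h' j \<in> {1..6}" "g' a \<in> {1..6}"
        using permutes_in_image[OF H'(1)] permutes_in_image[OF H'(2)] by blast+
      from H(3)[OF this] H'(3)[OF ija]
      show "syntheme ((h \<circ> h') i) ((h \<circ> h') j) ((g \<circ> g') a) = (g \<circ> g') (syntheme i j a)" by simp
    qed (intro permutes_compose H H')+
    then show "d \<otimes>\<^bsub>?S \<times>\<times> ?S\<^esub> d' \<in> D" unfolding hg hg' mult_DirProd sym_group_mult .
  qed
  have gen1: "(ext (syntheme_swap k), transpose 1 k) \<in> D" if k: "k \<in> {2..6}" for k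
  proof (rule DI)
    show "ext (syntheme_swap k) permutes {1..6}"
      unfolding ext_def by (rule permutes_involution_extend) (use k syntheme_swap_involution in blast)
    show "transpose 1 k permutes {1..6}" using k by (intro permutes_swap_id) auto
  qed (use k syntheme_swap_equivariant in \<open>simp add: ext_def\<close>)
  have gen2: "(transpose 1 k, ext (syntheme 1 k)) \<in> D" if k: "k \<in> {2..6}" for k
  proof (rule DI)
    show "ext (syntheme 1 k) permutes {1..6}"
      unfolding ext_def by (rule permutes_involution_extend) (use k syntheme_involution in blast)
    show "transpose 1 k permutes {1..6}" using k by (intro permutes_swap_id) auto
    fix i j a assume ija: "i \<in> {1..6::nat}" "j \<in> {1..6::nat}" "a \<in> {1..6::nat}"
    have "syntheme i j a \<in> {1..6}"
      using ija unfolding atLeastAtMost_1_6 by (auto simp: syntheme_def)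
    then show "syntheme (transpose 1 k i) (transpose 1 k j) (ext (syntheme 1 k) a) = ext (syntheme 1 k) (syntheme i j a)"
      using ija k syntheme_equivariant by (simp add: ext_def)
  qed
  have fst_hom: "group_hom (?S \<times>\<times> ?S) ?S fst" and snd_hom: "group_hom (?S \<times>\<times> ?S) ?S snd"
    using S by (auto simp: group_hom_def group_hom_axioms_def hom_def SS.is_group)
  have "fst ` D = carrier ?S"
    using gen2 by (intro subgroup_star_generators group_hom.subgroup_img_is_subgroup[OF fst_hom sub]) force
  moreover have "snd ` D = carrier ?S"
    using gen1 by (intro subgroup_star_generators group_hom.subgroup_img_is_subgroup[OF snd_hom sub]) force
  ultimately have D: "subdirect D ?S ?S" using sub by (simp add: subdirect_def)
  \<comment> \<open>If all points are fixed, so are all synthemes, and \<open>h\<close> preserves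
    every pair of totals. The pairs \<open>{i, j}\<close> and \<open>{i, k}\<close> then pin down
    \<open>i\<close>.\<close>
  have "h = id" if "(h, id) \<in> D" for h
  proof
    note H = DD[OF that]
    have pairs: "h i = i \<and> h j = j \<or> h i = j \<and> h j = i" if ij: "i \<in> {1..6}" "j \<in> {1..6}" "i \<noteq> j" for i j
    proof -
      have "h i \<in> {1..6}" "h j \<in> {1..6}" using permutes_in_image[OF H(1)] ij by blast+
      moreover have "\<forall>a\<in>{1..6}. syntheme (h i) (h j) a = syntheme i j a"
        using H(3)[OF ij(1,2)] by simp
      ultimately show ?thesis using syntheme_inj ij by blast
    qed
    fix i show "h i = id i"
    proof (cases "i \<in> {1..6}")
      case False then show ?thesis using permutes_not_in[OF H(1)] by simp
    next
      case True
      obtain j k where jk: "j \<in> {1..6}" "k \<in> {1..6}" "i \<noteq> j" "i \<noteq> k" "j \<noteq> (k::nat)"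
      proof -
        consider "i = 1" | "i = 2" | "i \<noteq> 1" "i \<noteq> 2" by blast
        then show ?thesis by cases (use that[of 2 3] that[of 1 3] that[of 1 2] in simp_all)
      qed
      then show ?thesis using pairs[OF True jk(1,3)] pairs[OF True jk(2,4)] by auto
    qed
  qed
  moreover have "(id, id) \<in> D" using subdirect_one[OF D] unfolding sym_group_one .
  ultimately have "fst_kernel D ?S = {id}" unfolding fst_kernel_def sym_group_one by blast
  also have "\<dots> = kernel ?S ?S id" by (auto simp: kernel_def sym_group_one sym_group_carrier permutes_id[unfolded id_def])
  finally have "fst_kernel D ?S = kernel ?S ?S id" .
  then have "D \<in> fibre_product ?S ?S id ` epis ?S ?S"
    using goursat[OF S S S, of id] D by (simp add: bij_betw_def hom_def)
  then obtain f where f: "f \<in> auts 6" "D = fibre_product ?S ?S id f" by blast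
  have "f (transpose 1 2) = ext (syntheme_swap 2)"
    using gen1[of 2] unfolding f(2) fibre_product_def by simp
  then have "f (transpose 1 2) x \<noteq> x" if "x \<in> {1..6}" for x
    using syntheme_swap_involution that by (simp add: ext_def)
  then show ?thesis using that f(1) by blast
qed

section \<open>Counting the automorphisms in degree 6\<close>

text \<open>Both consist of three 2-cycles, and \<open>g\<close> matches these up. This allows any
  non-inner automorphism to be adjusted to agree with a chosen one at \<open>(1 2)\<close>.\<close>

lemma fpf_involution_6_conj:
  assumes p: "p permutes {1..6::nat}" "\<And>x. x \<in> {1..6} \<Longrightarrow> p x \<noteq> x" "\<And>x. p (p x) = x"
    and q: "q permutes {1..6}" "\<And>x. x \<in> {1..6} \<Longrightarrow> q x \<noteq> x" "\<And>x. q (q x) = x"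
  obtains g where "g permutes {1..6}" "q = g \<circ> p \<circ> inv' g"
proof -
  have pick: "\<exists>x\<in>{1..6::nat}. x \<notin> set xs" if "length xs < 6" for xs
  proof (rule ccontr)
    assume "\<not> ?thesis"
    then have "{1..6} \<subseteq> set xs" by blast
    from card_mono[OF _ this] card_length[of xs] that show False by simp
  qed
  have form: "\<exists>a b c d e f. distinct [a, b, c, d, e, f] \<and> {1..6::nat} = {a, b, c, d, e, f} \<and>
      r a = b \<and> r b = a \<and> r c = d \<and> r d = c \<and> r e = f \<and> r f = e"
    if r: "r permutes {1..6}" "\<And>x. x \<in> {1..6} \<Longrightarrow> r x \<noteq> x" "\<And>x. r (r x) = x" for r
  proof -
    have inj: "r u = r v \<longleftrightarrow> u = v" for u v by (rule inj_eq[OF permutes_inj[OF r(1)]])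
    have 1: "1 \<in> {1..6::nat}" by simp
    obtain c where c: "c \<in> {1..6}" "c \<notin> {1, r 1}"
      using pick[of "[1, r 1]"] by auto
    obtain e where e: "e \<in> {1..6}" "e \<notin> {1, r 1, c, r c}"
      using pick[of "[1, r 1, c, r c]"] by auto
    have rc: "r c \<noteq> 1" "r c \<noteq> r 1" "r c \<noteq> c" using c r(2)[OF c(1)] inj[of c 1] r(3)[of c] by auto
    have re: "r e \<noteq> 1" "r e \<noteq> r 1" "r e \<noteq> c" "r e \<noteq> r c" "r e \<noteq> e"
      using e r(2)[OF e(1)] inj[of e 1] inj[of e c] r(3)[of e] by auto
    have d: "distinct [1, r 1, c, r c, e, r e]"
      using c(2) e(2) rc re r(2)[OF 1] by auto
    have "{1, r 1, c, r c, e, r e} \<subseteq> {1..6}" using 1 c(1) e(1) permutes_in_image[OF r(1)] by blast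
    moreover have "card {1, r 1, c, r c, e, r e} = card {1..6::nat}" using distinct_card[OF d] by simp
    ultimately have "{1, r 1, c, r c, e, r e} = {1..6}" by (intro card_subset_eq) auto
    then show ?thesis using d r(3) by metis
  qed
  obtain a b c d e f where 1: "distinct [a, b, c, d, e, f]" "{1..6} = {a, b, c, d, e, f}"
      "p a = b" "p b = a" "p c = d" "p d = c" "p e = f" "p f = e"
    using form[OF p] by blast
  obtain a' b' c' d' e' f' where 2: "distinct [a', b', c', d', e', f']" "{1..6} = {a', b', c', d', e', f'}"
      "q a' = b'" "q b' = a'" "q c' = d'" "q d' = c'" "q e' = f'" "q f' = e'"
    using form[OF q] by blast
  let ?f = "id(a := a', b := b', c := c', d := d', e := e', f := f')"
  obtain g where g: "g permutes {1..6}" "\<And>x. x \<in> {1..6} \<Longrightarrow> g x = ?f x"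
  proof (rule permutes_extend[of "{1..6}" "{1..6}" ?f])
    show "inj_on ?f {1..6}" unfolding 1(2) using 1(1) 2(1) by (simp add: inj_on_def) auto
    have "?f ` {a, b, c, d, e, f} = {a', b', c', d', e', f'}" using 1(1) by simp
    then show "?f ` {1..6} \<subseteq> {1..6}" by (metis 1(2) 2(2) order_refl)
  qed auto
  have gg: "g a = a'" "g b = b'" "g c = c'" "g d = d'" "g e = e'" "g f = f'"
    using g(2)[of a] g(2)[of b] g(2)[of c] g(2)[of d] g(2)[of e] g(2)[of f] 1(1) unfolding 1(2) by simp_all
  have "q (g x) = g (p x)" for x
  proof (cases "x \<in> {1..6}")
    case True
    then have "x \<in> {a, b, c, d, e, f}" unfolding 1(2) .
    then show ?thesis using gg 1(3-) 2(3-) by (elim insertE emptyE) simp_all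
  next
    case False
    then show ?thesis using permutes_not_in[OF g(1)] permutes_not_in[OF p(1)] permutes_not_in[OF q(1)] by simp
  qed
  then have "q = g \<circ> p \<circ> inv' g" using permutes_conj_eqI[OF g(1)] by metis
  then show ?thesis using that g(1) by blast
qed

lemma epis_comp:
  assumes G: "group G" and f: "f \<in> epis G H" and k: "k \<in> epis H K"
  shows "restrict (\<lambda>x. k (f x)) (carrier G) \<in> epis G K"
  unfolding restrict_in_epis_iff[OF G]
proof
  show "(\<lambda>x. k (f x)) \<in> hom G K"
    using hom_compose[OF episD(1)[OF f] episD(1)[OF k]] by (simp add: comp_def)
  show "(\<lambda>x. k (f x)) ` carrier G = carrier K"
    using episD(3)[OF f] episD(3)[OF k] by (metis image_image)
qed

lemma auts_inverse:
  assumes f: "f \<in> auts n"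
  obtains f' where "f' \<in> auts n" "\<And>p. p permutes {1..n} \<Longrightarrow> f' (f p) = p"
proof -
  let ?S = "sym_group n"
  have S: "group ?S" by (rule sym_group_is_group)
  have inj: "inj_on f (carrier ?S)" by (rule epis_inj_on[OF f]) auto
  then have "f \<in> iso ?S ?S" using episD[OF f] by (simp add: iso_def bij_betw_def)
  then have "inv_into (carrier ?S) f \<in> iso ?S ?S" by (rule group.iso_set_sym[OF S])
  then have "restrict (inv_into (carrier ?S) f) (carrier ?S) \<in> auts n"
    unfolding restrict_in_epis_iff[OF S] by (simp add: iso_def bij_betw_def)
  moreover have "restrict (inv_into (carrier ?S) f) (carrier ?S) (f p) = p" if "p permutes {1..n}" for p
    using that inj autsD(1)[OF f that] by (simp add: sym_group_carrier)
  ultimately show ?thesis using that by blast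
qed

text \<open>\<open>(1 i)\<close> is the conjugate of \<open>(1 2)\<close> by \<open>(2 i)\<close>,
  so the type of one image decides the type of all.\<close>

lemma aut_inner_if_transpose:
  fixes n :: nat
  assumes n: "n \<ge> 3" and f: "f \<in> auts n" and c: "c \<in> {1..n}" "d \<in> {1..n}" "c \<noteq> d" "f (transpose 1 2) = transpose c d"
  obtains g where "g permutes {1..n}" "f = inner_aut n g"
proof (rule aut_inner[OF n f])
  fix i assume i: "i \<in> {2..n}"
  note F = autsD[OF f]
  have p: "transpose 1 2 permutes {1..n}" "transpose 2 i permutes {1..n}" using n i by (auto intro!: permutes_swap_id)
  have "transpose 1 i = transpose 2 i \<circ> transpose 1 2 \<circ> inv' (transpose 2 i)"
    unfolding permutes_conj_transpose[OF p(2)] using i by simp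
  then have "f (transpose 1 i) = f (transpose 2 i) \<circ> transpose c d \<circ> inv' (f (transpose 2 i))"
    using F(2)[OF permutes_compose[OF p] permutes_inv[OF p(2)]] F(2)[OF p(2,1)] F(4)[OF p(2)] c(4) by metis
  also have "\<dots> = transpose (f (transpose 2 i) c) (f (transpose 2 i) d)"
    by (rule permutes_conj_transpose[OF F(1)[OF p(2)]])
  finally show "\<exists>c\<in>{1..n}. \<exists>d\<in>{1..n}. c \<noteq> d \<and> f (transpose 1 i) = transpose c d"
    using c(1-3) permutes_in_image[OF F(1)[OF p(2)]] permutes_inj[OF F(1)[OF p(2)]] by (metis injD)
qed (use that in blast)

text \<open>Inner automorphisms and those composed from \<open>s\<close> and a conjugation make up
  two disjoint families of size 720. If \<open>f\<close> sends \<open>(1 2)\<close> to a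
  fixed-point-free involution, some \<open>outer g\<close> agrees with it there, and the inverse of
  \<open>outer g\<close> after \<open>f\<close> fixes \<open>(1 2)\<close>, hence is inner.\<close>

lemma card_auts_6: "card (auts 6) = 1440"
proof -
  let ?S = "sym_group 6" and ?t = "transpose 1 (2::nat)"
  obtain s where s: "s \<in> auts 6" "\<And>x. x \<in> {1..6} \<Longrightarrow> s ?t x \<noteq> x" by (rule outer_aut_exists) blast
  note SD = autsD[OF s(1)]
  define outer where "outer g = restrict (\<lambda>p. inner_aut 6 g (s p)) (carrier ?S)" for g
  have outer: "outer g \<in> auts 6" if "g permutes {1..6}" for g
    unfolding outer_def by (rule epis_comp[OF sym_group_is_group s(1) inner_aut_in_auts[OF that]])
  have outer_apply: "outer g p = g \<circ> s p \<circ> inv' g" if "p permutes {1..6}" for g p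
    using that SD(1)[OF that] unfolding outer_def by (simp add: sym_group_carrier)
  have t: "?t permutes {1..6}" by (intro permutes_swap_id) auto
  have inv: "f ?t (f ?t x) = x" if f: "f \<in> auts 6" for f x
  proof -
    have "f ?t \<circ> f ?t = f (?t \<circ> ?t)" using autsD(2)[OF f t t] by simp
    also have "?t \<circ> ?t = id" by simp
    finally have "f ?t \<circ> f ?t = id" unfolding autsD(3)[OF f] .
    then show ?thesis by (metis comp_apply id_apply)
  qed
  have "auts 6 = inner_aut 6 ` carrier ?S \<union> outer ` carrier ?S"
  proof (intro equalityI subsetI)
    fix f assume f: "f \<in> auts 6"
    note F = autsD[OF f]
    consider c d where "c \<in> {1..6}" "d \<in> {1..6}" "c \<noteq> d" "f ?t = transpose c d"
      | "\<And>x. x \<in> {1..6} \<Longrightarrow> f ?t x \<noteq> x"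
      using aut_transpose[OF f, of 1 2] by auto
    then show "f \<in> inner_aut 6 ` carrier ?S \<union> outer ` carrier ?S"
    proof cases
      case 1
      obtain g where "g permutes {1..6}" "f = inner_aut 6 g" by (rule aut_inner_if_transpose[OF _ f 1]) simp
      then show ?thesis by (auto simp: sym_group_carrier)
    next
      case 2
      obtain g where g: "g permutes {1..6}" "f ?t = g \<circ> s ?t \<circ> inv' g"
        using fpf_involution_6_conj[of "s ?t" "f ?t"] SD(1)[OF t] F(1)[OF t] s(2) 2 inv[OF s(1)] inv[OF f] by metis
      note O = autsD[OF outer[OF g(1)]]
      obtain r where r: "r \<in> auts 6" "\<And>p. p permutes {1..6} \<Longrightarrow> r (outer g p) = p"
        by (rule auts_inverse[OF outer[OF g(1)]]) blast
      define k where "k = restrict (\<lambda>p. r (f p)) (carrier ?S)"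
      have k: "k \<in> auts 6" unfolding k_def by (rule epis_comp[OF sym_group_is_group f r(1)])
      have "f ?t = outer g ?t" using g(2) outer_apply[OF t] by simp
      then have "k ?t = transpose 1 2" using r(2)[OF t] t by (simp add: k_def sym_group_carrier)
      then obtain h where h: "h permutes {1..6}" "k = inner_aut 6 h"
        using aut_inner_if_transpose[OF _ k, of 1 2] by auto
      \<comment> \<open>Applying \<open>s\<close> after conjugation by \<open>h\<close> is the same
        as conjugating by \<open>s h\<close> after \<open>s\<close>, so the inner factor can be
        moved to the other side.\<close>
      define gh where "gh = g \<circ> s h"
      have gh: "gh permutes {1..6}" unfolding gh_def by (rule permutes_compose[OF SD(1)[OF h(1)] g(1)])
      have "f p = outer gh p" if p: "p permutes {1..6}" for p
      proof -
        obtain q where q: "q permutes {1..6}" "outer g q = f p" using O(6)[OF F(1)[OF p]] by blast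
        have "q = k p" using r(2)[OF q(1)] q(2) p by (simp add: k_def sym_group_carrier)
        also have "\<dots> = h \<circ> p \<circ> inv' h" using p by (simp add: h(2) sym_group_carrier)
        finally have "s q = s h \<circ> s p \<circ> inv' (s h)"
          using SD(2)[OF permutes_compose[OF p h(1)] permutes_inv[OF h(1)]] SD(2)[OF h(1) p] SD(4)[OF h(1)] by simp
        moreover have "inv' gh = inv' (s h) \<circ> inv' g"
          unfolding gh_def using permutes_bij[OF g(1)] permutes_bij[OF SD(1)[OF h(1)]] by (rule o_inv_distrib)
        ultimately show ?thesis
          using outer_apply[OF q(1), of g] outer_apply[OF p, of gh] unfolding q(2) gh_def by (simp add: comp_assoc)
      qed
      then have "f = outer gh" by (intro epis_eqI[OF f outer[OF gh]]) (simp add: sym_group_carrier)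
      then show ?thesis using gh by (auto simp: sym_group_carrier)
    qed
  qed (use inner_aut_in_auts outer in \<open>auto simp: sym_group_carrier\<close>)
  moreover have "inj_on outer (carrier ?S)"
  proof (rule inj_onI)
    fix g h assume gh: "g \<in> carrier ?S" "h \<in> carrier ?S" "outer g = outer h"
    have "inner_aut 6 g q = inner_aut 6 h q" if q: "q \<in> carrier ?S" for q
    proof -
      obtain p where "p permutes {1..6}" "s p = q" using SD(6)[of q] q by (auto simp: sym_group_carrier)
      then have "g \<circ> q \<circ> inv' g = h \<circ> q \<circ> inv' h" using outer_apply gh(3) by metis
      then show ?thesis using q by simp
    qed
    then have "inner_aut 6 g = inner_aut 6 h" by (intro extensionalityI[of _ "carrier ?S"]) auto
    then show "g = h" using inner_aut_inj[of 6] gh(1,2) by (auto simp: inj_on_def)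
  qed
  moreover have "inner_aut 6 ` carrier ?S \<inter> outer ` carrier ?S = {}"
  proof -
    have "inner_aut 6 h \<noteq> outer g" if g: "g permutes {1..6}" and h: "h permutes {1..6}" for g h
    proof
      assume "inner_aut 6 h = outer g"
      then have "inner_aut 6 h ?t = outer g ?t" by simp
      then have eq: "transpose (h 1) (h 2) = g \<circ> s ?t \<circ> inv' g"
        using t outer_apply[OF t, of g] permutes_conj_transpose[OF h, of 1 2] by (simp add: sym_group_carrier)
      \<comment> \<open>The image of \<open>(1 2)\<close> under an inner automorphism fixes
        \<open>h 3\<close>, whereas under an \<open>outer\<close> one it has no fixed point in
        \<open>{1..6}\<close>.\<close>
      have "h 3 \<noteq> h 1" "h 3 \<noteq> h 2" by (simp_all add: inj_eq[OF permutes_inj[OF h]])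
      then have "transpose (h 1) (h 2) (h 3) = h 3" by simp
      then have "(g \<circ> s ?t \<circ> inv' g) (h 3) = h 3" unfolding eq .
      then have "s ?t (inv' g (h 3)) = inv' g (h 3)" using permutes_inverses(2)[OF g] by (metis comp_apply)
      moreover have "inv' g (h 3) \<in> {1..6}"
        using permutes_in_image[OF permutes_inv[OF g]] permutes_in_image[OF h, of 3] by simp
      ultimately show False using s(2) by blast
    qed
    then show ?thesis by (auto simp: sym_group_carrier)
  qed
  ultimately have "card (auts 6) = card (carrier ?S) + card (carrier ?S)"
    using inner_aut_inj[of 6] by (simp add: card_Un_disjoint card_image)
  then show ?thesis by (simp add: sym_group_card_carrier fact_numeral)
qed

section \<open>Epimorphisms onto small quotients\<close>

abbreviation pullback :: "('a, 'm) monoid_scheme \<Rightarrow> ('a \<Rightarrow> 'b) \<Rightarrow> ('b \<Rightarrow> 'c) \<Rightarrow> 'a \<Rightarrow> 'c" where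
  "pullback G p f \<equiv> restrict (\<lambda>x. f (p x)) (carrier G)"

text \<open>The homomorphism theorem as a counting tool: epimorphisms that kill the kernel of
  \<open>p\<close> are the ones factoring uniquely through \<open>p\<close>.\<close>

lemma epis_pullback:
  assumes G: "group G" and H: "group H" and Q: "group Q" and p: "p \<in> epis G H"
  shows "inj_on (pullback G p) (epis H Q)"
    and "pullback G p ` epis H Q = {f \<in> epis G Q. kernel G H p \<subseteq> kernel G Q f}"
proof -
  note pD = episD[OF p]
  interpret p: group_hom G H p by (rule epis_group_hom[OF p G H])
  show "inj_on (pullback G p) (epis H Q)"
  proof (rule inj_onI)
    fix f g assume f: "f \<in> epis H Q" and g: "g \<in> epis H Q" and eq: "pullback G p f = pullback G p g"
    show "f = g"
    proof (rule epis_eqI[OF f g])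
      fix y assume "y \<in> carrier H"
      then obtain x where "x \<in> carrier G" "y = p x" using pD(3) by blast
      then show "f y = g y" using fun_cong[OF eq, of x] by simp
    qed
  qed
  show "pullback G p ` epis H Q = {f \<in> epis G Q. kernel G H p \<subseteq> kernel G Q f}" (is "?L = ?R")
  proof (intro equalityI subsetI)
    fix f assume "f \<in> ?L"
    then obtain k where k: "k \<in> epis H Q" "f = pullback G p k" by blast
    interpret k: group_hom H Q k by (rule epis_group_hom[OF k(1) H Q])
    have "kernel G H p \<subseteq> kernel G Q f" by (auto simp: kernel_def k(2))
    then show "f \<in> ?R" using epis_comp[OF G p k(1)] k(2) by simp
  next
    fix f assume "f \<in> ?R"
    then have f: "f \<in> epis G Q" and ker: "kernel G H p \<subseteq> kernel G Q f" by auto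
    interpret f: group_hom G Q f by (rule epis_group_hom[OF f G Q])
    have eq: "f x = f x'" if x: "x \<in> carrier G" "x' \<in> carrier G" "p x = p x'" for x x'
    proof -
      have "x \<otimes>\<^bsub>G\<^esub> inv\<^bsub>G\<^esub> x' \<in> kernel G H p"
        using x by (simp add: kernel_def p.hom_mult)
      then have "x \<otimes>\<^bsub>G\<^esub> inv\<^bsub>G\<^esub> x' \<in> kernel G Q f" using ker by blast
      then have "f (x \<otimes>\<^bsub>G\<^esub> inv\<^bsub>G\<^esub> x') = \<one>\<^bsub>Q\<^esub>" by (simp add: kernel_def)
      then have "f x \<otimes>\<^bsub>Q\<^esub> inv\<^bsub>Q\<^esub> f x' = \<one>\<^bsub>Q\<^esub>" using x by (simp add: f.hom_mult)
      then show ?thesis using f.H.inv_equality[of "f x" "inv\<^bsub>Q\<^esub> f x'"] x by simp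
    qed
    define k where "k = restrict (\<lambda>y. f (SOME x. x \<in> carrier G \<and> p x = y)) (carrier H)"
    have k: "k (p x) = f x" if x: "x \<in> carrier G" for x
    proof -
      have "(SOME x'. x' \<in> carrier G \<and> p x' = p x) \<in> carrier G \<and> p (SOME x'. x' \<in> carrier G \<and> p x' = p x) = p x"
        by (rule someI[of _ x]) (simp add: x)
      then have "f (SOME x'. x' \<in> carrier G \<and> p x' = p x) = f x" using eq x by blast
      then show ?thesis using x by (simp add: k_def)
    qed
    have "k \<in> epis H Q"
      unfolding epis_def
    proof (intro CollectI conjI IntI homI)
      fix y assume "y \<in> carrier H"
      then obtain x where "x \<in> carrier G" "y = p x" using pD(3) by blast
      then show "k y \<in> carrier Q" using k by simp
    next
      fix y y' assume "y \<in> carrier H" "y' \<in> carrier H"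
      then obtain x x' where x: "x \<in> carrier G" "y = p x" "x' \<in> carrier G" "y' = p x'" using pD(3) by blast
      then show "k (y \<otimes>\<^bsub>H\<^esub> y') = k y \<otimes>\<^bsub>Q\<^esub> k y'"
        using k[of "x \<otimes>\<^bsub>G\<^esub> x'"] k[of x] k[of x'] by (simp add: p.hom_mult f.hom_mult)
    next
      show "k \<in> extensional (carrier H)" by (simp add: k_def)
      have "k ` p ` carrier G = f ` carrier G" using k by (simp add: image_image)
      then show "k ` carrier H = carrier Q" using pD(3) episD(3)[OF f] by simp
    qed
    moreover have "f = pullback G p k"
      using k episD(2)[OF f] by (intro extensionalityI[of _ "carrier G"]) auto
    ultimately show "f \<in> ?L" by blast
  qed
qed

lemma epis_sym_group_empty:
  assumes "a < n" "n \<ge> 2"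
  shows "epis (sym_group a) (sym_group n) = {}"
proof -
  have "(fact a :: nat) < fact n"
    \<comment> \<open>Since \<open>0! = 1!\<close>, degree 0 is compared with \<open>n\<close>
      through degree 1.\<close>
    using assms fact_less_mono_nat[of a n] fact_less_mono_nat[of 1 n] by (cases "a = 0") auto
  then show ?thesis
    using epis_card_le[of _ "sym_group a" "sym_group n"] by (fastforce simp: sym_group_card_carrier)
qed

section \<open>The quotient \<open>S_3\<close> of \<open>S_4\<close>\<close>

text \<open>The stabiliser of 4 is a complement to \<open>klein_four\<close>. Let \<open>v j\<close>
  be the unique Klein element exchanging 4 and \<open>j\<close> (the identity for
  \<open>j = 4\<close>); then \<open>v (g 4) \<circ> g\<close> is the representative of the coset of
  \<open>g\<close> that fixes 4.\<close>

lemma klein_four_quotient: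
  obtains q where "q \<in> epis (sym_group 4) (sym_group 3)" "kernel (sym_group 4) (sym_group 3) q = klein_four"
proof -
  have "\<exists>v. v \<in> klein_four \<and> v 4 = j" if "j \<in> {1..4}" for j
    using klein_four_transitive[of 4 j] that by auto
  then obtain v where v: "\<And>j. j \<in> {1..4} \<Longrightarrow> v j \<in> klein_four \<and> v j 4 = j" by metis
  have uniq: "w = v j" if "w \<in> klein_four" "w 4 = j" for w j
  proof -
    have "j \<in> {1..4}" using klein_fourD(4)[OF that(1), of 4] that(2) by simp
    then show ?thesis using v that by (intro klein_four_eqI[of _ _ 4]) auto
  qed
  have idk: "id \<in> klein_four" unfolding klein_four_def by (intro CollectI conjI permutes_id disjI1 refl)
  define q where "q g = v (g 4) \<circ> g" for g :: "nat \<Rightarrow> nat"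
  have v4: "v (g 4) \<in> klein_four" "v (g 4) (g 4) = 4" if g: "g permutes {1..4}" for g
  proof -
    have "g 4 \<in> {1..4}" using permutes_in_image[OF g, of 4] by simp
    then show "v (g 4) \<in> klein_four" "v (g 4) (g 4) = 4" using v klein_fourD(2)[of "v (g 4)" 4] by auto
  qed
  have 3: "p permutes {1..3}" if "p permutes {1..4}" "p 4 = 4" for p :: "nat \<Rightarrow> nat"
  proof (rule permutes_superset[OF that(1)])
    fix x assume "x \<in> {1..4} - {1..3::nat}"
    then have "x = 4" by auto
    then show "p x = x" using that(2) by simp
  qed
  have 4: "p permutes {1..4}" if "p permutes {1..3::nat}" for p
    by (rule permutes_subset[OF that]) auto
  have qc: "q g permutes {1..3}" if g: "g permutes {1..4}" for g
    unfolding q_def using v4[OF g] klein_fourD(1)[OF v4(1)[OF g]] g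
    by (intro 3 permutes_compose) auto
  have q3: "q g = g" if "g permutes {1..3}" for g
  proof -
    have "g 4 = 4" using permutes_not_in[OF that, of 4] by simp
    then show ?thesis using uniq[OF idk, of 4] by (simp add: q_def flip: id_def)
  qed
  note VN = normal_sym_groupD[OF klein_four_normal]
  have mult: "q (g \<circ> h) = q g \<circ> q h" if g: "g permutes {1..4}" and h: "h permutes {1..4}" for g h
  proof -
    \<comment> \<open>By normality \<open>q g \<circ> q h\<close> differs from
      \<open>g \<circ> h\<close> by a Klein element \<open>u\<close>. As the product fixes 4,
      regularity forces \<open>u\<close> to be the correction in the definition of
      \<open>q (g \<circ> h)\<close>.\<close>
    define u where "u = v (g 4) \<circ> (g \<circ> v (h 4) \<circ> inv' g)"
    have u: "u \<in> klein_four"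
      unfolding u_def by (intro klein_four_comp v4 VN(5) g h)
    have gh: "q g \<circ> q h = u \<circ> (g \<circ> h)"
      by (simp add: u_def q_def fun_eq_iff permutes_inverses[OF g])
    have "(q g \<circ> q h) 4 = 4"
      using permutes_not_in[OF qc[OF g], of 4] permutes_not_in[OF qc[OF h], of 4] by simp
    then have "u ((g \<circ> h) 4) = 4" unfolding gh by simp
    then have "u 4 = (g \<circ> h) 4" using klein_fourD(2)[OF u, of "(g \<circ> h) 4"] by simp
    then have "u = v ((g \<circ> h) 4)" by (rule uniq[OF u])
    then show ?thesis using gh by (simp add: q_def)
  qed
  have "restrict q (carrier (sym_group 4)) \<in> epis (sym_group 4) (sym_group 3)"
    unfolding restrict_in_epis_iff[OF sym_group_is_group]
  proof
    show "q \<in> hom (sym_group 4) (sym_group 3)"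
      by (rule homI) (simp_all only: sym_group_carrier sym_group_mult qc mult)
    show "q ` carrier (sym_group 4) = carrier (sym_group 3)"
    proof (intro equalityI subsetI)
      fix g assume g: "g \<in> carrier (sym_group 3)"
      then have "g = q g" "g \<in> carrier (sym_group 4)" using q3 4 by (simp_all add: sym_group_carrier)
      then show "g \<in> q ` carrier (sym_group 4)" by blast
    qed (use qc in \<open>auto simp: sym_group_carrier\<close>)
  qed
  moreover have "kernel (sym_group 4) (sym_group 3) (restrict q (carrier (sym_group 4))) = klein_four"
  proof (intro equalityI subsetI)
    fix g assume "g \<in> kernel (sym_group 4) (sym_group 3) (restrict q (carrier (sym_group 4)))"
    then have g: "g permutes {1..4}" and "q g = id"
      unfolding kernel_def sym_group_one by (auto simp: sym_group_carrier)
    then have "v (g 4) (g x) = x" for x unfolding q_def by (metis comp_apply id_apply)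
    then have "g x = v (g 4) x" for x using klein_fourD(2)[OF v4(1)[OF g]] by metis
    then have "g = v (g 4)" by blast
    then show "g \<in> klein_four" using v4(1)[OF g] by simp
  next
    fix g assume g: "g \<in> klein_four"
    have "q g = g \<circ> g" unfolding q_def using uniq[OF g refl] by simp
    also have "\<dots> = id" using klein_fourD(2)[OF g] by (simp add: fun_eq_iff)
    finally show "g \<in> kernel (sym_group 4) (sym_group 3) (restrict q (carrier (sym_group 4)))"
      unfolding kernel_def sym_group_one using klein_fourD(1)[OF g] by (simp add: sym_group_carrier)
  qed
  ultimately show ?thesis using that by blast
qed

lemma epis_kernel_normal:
  assumes "f \<in> epis G H" "group G" "group H"
  shows "kernel G H f \<lhd> G"
  using group_hom.normal_kernel[OF epis_group_hom[OF assms]] .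

text \<open>Every such epimorphism has kernel \<open>klein_four\<close>, as all other normal
  subgroups give an image of the wrong size. So all of them factor through one quotient map and
  correspond to the 6 automorphisms of \<open>S_3\<close>.\<close>

lemma card_epis_sym_group_4_3: "card (epis (sym_group 4) (sym_group 3)) = 6"
proof -
  let ?S = "sym_group 4" and ?T = "sym_group 3"
  have S: "group ?S" and T: "group ?T" by (rule sym_group_is_group)+
  obtain q where q: "q \<in> epis ?S ?T" "kernel ?S ?T q = klein_four" by (rule klein_four_quotient)
  have "kernel ?S ?T f = klein_four" if f: "f \<in> epis ?S ?T" for f
  proof -
    interpret f: group_hom ?S ?T f by (rule epis_group_hom[OF f S T])
    note N = epis_kernel_normal[OF f S T]
    have False if k: "kernel ?S ?T f = {id}"
    proof -
      have "inj_on f (carrier ?S)" using f.inj_iff_trivial_ker k unfolding sym_group_one by blast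
      then have "card (carrier ?T) = card (carrier ?S)" using episD(3)[OF f] card_image by metis
      then show False by (simp add: sym_group_card_carrier fact_numeral)
    qed
    \<comment> \<open>If \<open>A_4\<close> is killed, \<open>f p\<close> depends only on the parity
      of \<open>p\<close>, so the image has at most 2 elements.\<close>
    moreover have False if alt: "carrier (alt_group 4) \<subseteq> kernel ?S ?T f"
    proof -
      define t where "t = transpose 1 (2::nat)"
      have t: "t permutes {1..4}" unfolding t_def by (intro permutes_swap_id) auto
      have perm: "permutation r" if "r permutes {1..4}" for r :: "nat \<Rightarrow> nat"
        using that by (auto simp: permutation_permutes)
      have "f p \<in> {id, f t}" if p: "p permutes {1..4}" for p
      proof (cases "evenperm p")
        case True
        then have "p \<in> kernel ?S ?T f" using alt p by (auto simp: alt_group_carrier)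
        then show ?thesis unfolding kernel_def sym_group_one by simp
      next
        case False
        then have "evenperm (p \<circ> t)"
          using perm[OF p] perm[OF t] by (simp add: evenperm_comp t_def evenperm_swap)
        then have "p \<circ> t \<in> kernel ?S ?T f" using alt permutes_compose[OF t p] by (auto simp: alt_group_carrier)
        then have 1: "f (p \<circ> t) = id" unfolding kernel_def sym_group_one by simp
        have "p = (p \<circ> t) \<circ> t" by (simp add: t_def comp_assoc)
        moreover have "f ((p \<circ> t) \<circ> t) = f (p \<circ> t) \<circ> f t"
          using f.hom_mult[of "p \<circ> t" t] t permutes_compose[OF t p] by (simp add: sym_group_carrier sym_group_mult)
        ultimately have "f p = id \<circ> f t" using 1 by simp
        then show ?thesis by simp
      qed
      then have "f ` carrier ?S \<subseteq> {id, f t}" by (intro image_subsetI) (simp only: sym_group_carrier)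
      then have "card (f ` carrier ?S) \<le> card {id, f t}" by (intro card_mono) auto
      also have "\<dots> \<le> 2" by (simp add: card_insert_if)
      finally show False using episD(3)[OF f] by (simp add: sym_group_card_carrier fact_numeral)
    qed
    moreover have "carrier (alt_group 4) \<subseteq> carrier ?S" by (auto simp: alt_group_carrier sym_group_carrier)
    ultimately show ?thesis using normal_sym_group_cases[OF N] by blast
  qed
  then have "epis ?S ?T = {f \<in> epis ?S ?T. kernel ?S ?T q \<subseteq> kernel ?S ?T f}" using q(2) by auto
  also have "\<dots> = pullback ?S q ` auts 3" by (rule epis_pullback(2)[OF S T T q(1), symmetric])
  finally have "card (epis ?S ?T) = card (auts 3)"
    using epis_pullback(1)[OF S T T q(1)] by (simp add: card_image)
  then show ?thesis using card_auts[of 3] by (simp add: fact_numeral)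
qed

section \<open>Characters with values in \<open>{-1, 1}\<close>\<close>

lemma sign_img_simps: "carrier sign_img = {-1, 1}" "mult sign_img = (*)" "one sign_img = 1"
  by (simp_all add: sign_img_def)

text \<open>The target is commutative, so conjugate transpositions take the same value, and the
  value at \<open>(1 2)\<close> decides between trivial and sign.\<close>

lemma sym_group_character:
  assumes f: "f \<in> hom (sym_group n) sign_img"
  shows "(\<forall>p. p permutes {1..n} \<longrightarrow> f p = 1) \<or> (\<forall>p. p permutes {1..n} \<longrightarrow> f p = sign p)"
proof -
  interpret f: group_hom "sym_group n" sign_img f
    using f sign_img_is_group sym_group_is_group by (simp add: group_hom_def group_hom_axioms_def)
  have mult: "f (p \<circ> q) = f p * f q" if "p permutes {1..n}" "q permutes {1..n}" for p q
    using f.hom_mult[of p q] that by (simp only: sym_group_carrier sym_group_mult sign_img_simps)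
  have val: "f p = 1 \<or> f p = -1" if "p permutes {1..n}" for p
    using f.hom_closed[of p] that by (auto simp: sym_group_carrier sign_img_simps)
  have conj: "f (transpose 1 k) = f (transpose 1 2)" if k: "k \<in> {2..n}" for k
  proof -
    have p: "transpose 1 2 permutes {1..n}" "transpose 2 k permutes {1..n}"
      using k by (auto intro!: permutes_swap_id)
    have "transpose 1 k = transpose 2 k \<circ> transpose 1 2 \<circ> transpose 2 k"
      using permutes_conj_transpose[OF p(2), of 1 2] k by simp
    then have "f (transpose 1 k) = f (transpose 2 k) * f (transpose 1 2) * f (transpose 2 k)"
      using mult[OF permutes_compose[OF p] p(2)] mult[OF p(2,1)] by simp
    then show ?thesis using val[OF p(2)] by auto
  qed
  show ?thesis
  proof (cases "f (transpose 1 2) = 1")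
    case True
    have "f p = 1" if "p permutes {1..n}" for p
    proof (rule sym_group_hom_eqI[OF f _ sign_img_is_group _ that])
      show "(\<lambda>_. 1) \<in> hom (sym_group n) sign_img" by (rule homI) (simp_all add: sign_img_simps)
      show "f (transpose 1 k) = 1" if "k \<in> {2..n}" for k unfolding conj[OF that] by (rule True)
    qed
    then show ?thesis by simp
  next
    case False
    have "f p = sign p" if "p permutes {1..n}" for p
    proof (rule sym_group_hom_eqI[OF f sign_is_hom sign_img_is_group _ that])
      fix k assume k: "k \<in> {2..n}"
      then have "transpose 1 2 permutes {1..n}" by (intro permutes_swap_id) auto
      then have "f (transpose 1 2) = -1" using val[of "transpose 1 2"] False by simp
      then show "f (transpose 1 k) = sign (transpose 1 k)" unfolding conj[OF k] using k by (simp add: sign_swap_id)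
    qed
    then show ?thesis by simp
  qed
qed

lemma epis_sym_group_sign_img:
  assumes n: "n \<ge> 2"
  shows "epis (sym_group n) sign_img = {restrict sign (carrier (sym_group n))}"
proof (intro equalityI subsetI)
  fix f assume f: "f \<in> epis (sym_group n) sign_img"
  have "\<not> (\<forall>p. p permutes {1..n} \<longrightarrow> f p = 1)"
  proof
    assume "\<forall>p. p permutes {1..n} \<longrightarrow> f p = 1"
    then have "f ` carrier (sym_group n) \<subseteq> {1}" by (auto simp: sym_group_carrier)
    then show False using episD(3)[OF f] by (auto simp: sign_img_simps)
  qed
  then have "\<forall>p. p permutes {1..n} \<longrightarrow> f p = sign p" using sym_group_character[OF episD(1)[OF f]] by blast
  then have "f = restrict sign (carrier (sym_group n))"
    using episD(2)[OF f] by (intro extensionalityI[of _ "carrier (sym_group n)"]) (auto simp: sym_group_carrier)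
  then show "f \<in> {restrict sign (carrier (sym_group n))}" by simp
next
  fix f assume "f \<in> {restrict sign (carrier (sym_group n))}"
  then show "f \<in> epis (sym_group n) sign_img"
    using sign_is_surj[OF n] sign_is_hom by (simp add: restrict_in_epis_iff[OF sym_group_is_group])
qed

section \<open>Characters and epimorphisms of subdirect products\<close>

lemma subdirect_group:
  assumes G: "group G" and H: "group H" and P: "subdirect P G H"
  shows "group ((G \<times>\<times> H)\<lparr>carrier := P\<rparr>)"
    "restrict fst P \<in> epis ((G \<times>\<times> H)\<lparr>carrier := P\<rparr>) G" "restrict snd P \<in> epis ((G \<times>\<times> H)\<lparr>carrier := P\<rparr>) H"
    "kernel ((G \<times>\<times> H)\<lparr>carrier := P\<rparr>) G (restrict fst P) = {d \<in> P. fst d = \<one>\<^bsub>G\<^esub>}"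
    "kernel ((G \<times>\<times> H)\<lparr>carrier := P\<rparr>) H (restrict snd P) = {d \<in> P. snd d = \<one>\<^bsub>H\<^esub>}"
proof -
  show K: "group ((G \<times>\<times> H)\<lparr>carrier := P\<rparr>)"
    by (rule group.subgroup_imp_group[OF DirProd_group[OF G H] subdirectD(1)[OF P]])
  have c: "fst d \<in> carrier G" "snd d \<in> carrier H" if "d \<in> P" for d
    using subdirect_subset[OF P] that by auto
  have "restrict fst (carrier ((G \<times>\<times> H)\<lparr>carrier := P\<rparr>)) \<in> epis ((G \<times>\<times> H)\<lparr>carrier := P\<rparr>) G"
    unfolding restrict_in_epis_iff[OF K] using c subdirectD(2)[OF P] by (auto simp: hom_def mult_DirProd')
  then show "restrict fst P \<in> epis ((G \<times>\<times> H)\<lparr>carrier := P\<rparr>) G" by simp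
  have "restrict snd (carrier ((G \<times>\<times> H)\<lparr>carrier := P\<rparr>)) \<in> epis ((G \<times>\<times> H)\<lparr>carrier := P\<rparr>) H"
    unfolding restrict_in_epis_iff[OF K] using c subdirectD(3)[OF P] by (auto simp: hom_def mult_DirProd')
  then show "restrict snd P \<in> epis ((G \<times>\<times> H)\<lparr>carrier := P\<rparr>) H" by simp
qed (auto simp: kernel_def)

lemma fst_kernel_full_iff:
  assumes G: "group G" and H: "group H" and P: "subdirect P G H"
  shows "fst_kernel P H = carrier G \<longleftrightarrow> P = carrier G \<times> carrier H"
proof
  interpret G: group G by fact
  interpret H: group H by fact
  assume full: "fst_kernel P H = carrier G"
  have "(x, y) \<in> P" if xy: "x \<in> carrier G" "y \<in> carrier H" for x y
  proof -
    obtain x' where x': "(x', y) \<in> P" using subdirect_snd_ex[OF P xy(2)] by blast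
    have c: "x' \<in> carrier G" by (rule subdirect_carrier(1)[OF P x'])
    have "x \<otimes>\<^bsub>G\<^esub> inv\<^bsub>G\<^esub> x' \<in> fst_kernel P H" using full c xy by simp
    then have "(x \<otimes>\<^bsub>G\<^esub> inv\<^bsub>G\<^esub> x' \<otimes>\<^bsub>G\<^esub> x', \<one>\<^bsub>H\<^esub> \<otimes>\<^bsub>H\<^esub> y) \<in> P"
      using subdirect_mult[OF P _ x'] by (simp add: fst_kernel_def)
    then show ?thesis using xy c by (simp add: G.m_assoc)
  qed
  then show "P = carrier G \<times> carrier H" using subdirect_subset[OF P] by auto
next
  assume "P = carrier G \<times> carrier H"
  moreover have "\<one>\<^bsub>H\<^esub> \<in> carrier H" using H by (simp add: group.is_monoid)
  ultimately show "fst_kernel P H = carrier G" by (auto simp: fst_kernel_def)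
qed

lemma subdirect_full:
  assumes G: "group G" and H: "group H" shows "subdirect (carrier G \<times> carrier H) G H"
proof -
  interpret G: group G by fact
  interpret H: group H by fact
  have "carrier G \<noteq> {}" "carrier H \<noteq> {}" by blast+
  then show ?thesis
    using group.subgroup_self[OF DirProd_group[OF G H]] by (simp add: subdirect_def fst_image_times snd_image_times)
qed

text \<open>Keeps the classes of subdirect products with different prescribed kernels from being
  counted twice; the bounds exclude coincidences such as \<open>A_2 = {id}\<close>.\<close>

lemma sym_group_normal_distinct:
  "n \<ge> 2 \<Longrightarrow> carrier (alt_group n) \<noteq> carrier (sym_group n)"
  "n \<ge> 3 \<Longrightarrow> {id} \<noteq> carrier (alt_group n)"
  "n \<ge> 2 \<Longrightarrow> {id} \<noteq> carrier (sym_group n)"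
  "klein_four \<noteq> {id}" "klein_four \<noteq> carrier (alt_group 4)" "klein_four \<noteq> carrier (sym_group 4)"
proof -
  have t: "transpose 1 2 permutes {1..n}" if "n \<ge> 2" for n :: nat using that by (intro permutes_swap_id) auto
  show "carrier (alt_group n) \<noteq> carrier (sym_group n)" if "n \<ge> 2"
  proof
    assume "carrier (alt_group n) = carrier (sym_group n)"
    then have "transpose 1 2 \<in> carrier (alt_group n)" using t[OF that] by (simp add: sym_group_carrier)
    then show False by (simp add: alt_group_carrier evenperm_swap)
  qed
  \<comment> \<open>A 3-cycle as witness: it is even, moves 1, and fixes 4, which no nontrivial
    element of \<open>klein_four\<close> does.\<close>
  have c: "transpose 1 2 \<circ> transpose 2 3 \<in> carrier (alt_group n)" if "n \<ge> 3" for n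
  proof -
    have "transpose 1 2 \<circ> transpose 2 3 permutes {1..n}"
      using that by (intro permutes_compose permutes_swap_id) auto
    then show ?thesis
      by (simp add: alt_group_carrier evenperm_comp permutation_swap_id evenperm_swap del: One_nat_def)
  qed
  have c1: "(transpose 1 2 \<circ> transpose 2 3) 1 = (2::nat)" "(transpose 1 2 \<circ> transpose 2 3) 4 = (4::nat)"
    by (simp_all add: transpose_def)
  show "{id} \<noteq> carrier (alt_group n)" if "n \<ge> 3"
    using c[OF that] c1(1) by (metis id_apply one_eq_numeral_iff num.distinct(1) singletonD)
  show "{id} \<noteq> carrier (sym_group n)" if "n \<ge> 2"
  proof
    assume "{id} = carrier (sym_group n)"
    then have "transpose 1 (2::nat) \<in> {id}" using t[OF that] by (simp add: sym_group_carrier)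
    then show False by (simp add: transpose_eq_id_iff)
  qed
  obtain v where "v \<in> klein_four" "v 1 = 2" using klein_four_transitive[of 1 2] by auto
  then have "v \<in> klein_four" "v \<noteq> id" by auto
  then show "klein_four \<noteq> {id}" by blast
  show "klein_four \<noteq> carrier (alt_group 4)"
  proof
    assume "klein_four = carrier (alt_group 4)"
    then have k: "transpose 1 2 \<circ> transpose 2 3 \<in> klein_four" using c[of 4] by simp
    have "transpose 1 2 \<circ> transpose 2 3 = (id :: nat \<Rightarrow> nat)" by (rule klein_fourD(3)[OF k _ c1(2)]) simp
    from fun_cong[OF this, of 1] show False unfolding c1(1) by simp
  qed
  show "klein_four \<noteq> carrier (sym_group 4)"
  proof
    assume eq: "klein_four = carrier (sym_group 4)"
    have "transpose 1 2 \<notin> klein_four" by (rule transpose_notin_klein_four[of 4]) simp_all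
    then show False unfolding eq sym_group_carrier using t[of 4] by simp
  qed
qed

text \<open>\<open>goursat\<close> with the quotient by each possible kernel: \<open>sign\<close>
  for the alternating group, the identity for the trivial kernel, the map onto \<open>S_3\<close>
  for \<open>klein_four\<close>. A full kernel leaves only the direct product.\<close>

lemma card_subdirect_sym_group_fst_kernel:
  assumes H: "group H"
  shows "card {D. subdirect D (sym_group n) H \<and> fst_kernel D H = carrier (sym_group n)} = 1"
    "n \<ge> 2 \<Longrightarrow> card {D. subdirect D (sym_group n) H \<and> fst_kernel D H = carrier (alt_group n)} = card (epis H sign_img)"
    "card {D. subdirect D (sym_group n) H \<and> fst_kernel D H = {id}} = card (epis H (sym_group n))"
    "card {D. subdirect D (sym_group 4) H \<and> fst_kernel D H = klein_four} = card (epis H (sym_group 3))"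
proof -
  note S = sym_group_is_group
  have "{D. subdirect D (sym_group n) H \<and> fst_kernel D H = carrier (sym_group n)} =
      {carrier (sym_group n) \<times> carrier H}"
    using fst_kernel_full_iff[OF S H] subdirect_full[OF S H, of n] by blast
  then show "card {D. subdirect D (sym_group n) H \<and> fst_kernel D H = carrier (sym_group n)} = 1" by simp
  show "card {D. subdirect D (sym_group n) H \<and> fst_kernel D H = carrier (alt_group n)} = card (epis H sign_img)"
    if "n \<ge> 2"
    using bij_betw_same_card[OF goursat[OF S H sign_img_is_group sign_is_hom sign_is_surj[OF that]]]
    by (simp only: alt_group_is_sign_kernel)
  have "kernel (sym_group n) (sym_group n) id = {id}"
    unfolding kernel_def sym_group_one by (auto simp: sym_group_carrier permutes_id[unfolded id_def])
  moreover have "id \<in> hom (sym_group n) (sym_group n)" by (simp add: hom_def)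
  ultimately show "card {D. subdirect D (sym_group n) H \<and> fst_kernel D H = {id}} = card (epis H (sym_group n))"
    using bij_betw_same_card[OF goursat[OF S H S, of id n n]] by simp
  obtain q where q: "q \<in> epis (sym_group 4) (sym_group 3)" "kernel (sym_group 4) (sym_group 3) q = klein_four"
    by (rule klein_four_quotient)
  show "card {D. subdirect D (sym_group 4) H \<and> fst_kernel D H = klein_four} = card (epis H (sym_group 3))"
    using bij_betw_same_card[OF goursat[OF S H S episD(1)[OF q(1)] episD(3)[OF q(1)]]] by (simp only: q(2))
qed

lemma card_subdirect_sym_group:
  assumes n: "n \<ge> 2" and H: "group H" and fin: "finite (carrier H)"
  shows "card {D. subdirect D (sym_group n) H} = 1 + card (epis H sign_img) +
    (if n \<ge> 3 then card (epis H (sym_group n)) else 0) + (if n = 4 then card (epis H (sym_group 3)) else 0)"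
proof -
  define A where "A N = {D. subdirect D (sym_group n) H \<and> fst_kernel D H = N}" for N
  note ck = card_subdirect_sym_group_fst_kernel(1-3)[OF H, of n, folded A_def]
  have fA: "finite (A N)" for N
    by (rule finite_subset[OF _ finite_subdirect[OF finite_sym_group[of n] fin]]) (auto simp: A_def)
  have dis: "A N \<inter> A M = {}" if "N \<noteq> M" for N M using that by (auto simp: A_def)
  have norm: "fst_kernel D H \<lhd> sym_group n" if "subdirect D (sym_group n) H" for D
    by (rule fst_kernel_normal[OF sym_group_is_group H that])
  note cases = normal_sym_group_cases[OF norm]
  define kers where "kers = {carrier (sym_group n), carrier (alt_group n), {id}} \<union> (if n = 4 then {klein_four} else {})"
  have "{D. subdirect D (sym_group n) H} = (\<Union>N\<in>kers. A N)"
    using cases by (auto simp: A_def kers_def)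
  then have sum: "card {D. subdirect D (sym_group n) H} = (\<Sum>N\<in>kers. card (A N))"
    using fA dis by (subst card_UN_disjoint[symmetric]) (auto simp: kers_def)
  note d = sym_group_normal_distinct(1-3)[of n] sym_group_normal_distinct(4-6)
  consider "n = 2" | "n \<ge> 3" "n \<noteq> 4" | "n = 4" using n by linarith
  then show ?thesis
  proof cases
    case 1
    \<comment> \<open>In degree 2 the trivial kernel is the alternating one and must be counted
      once; this explains the guard \<open>n \<ge> 3\<close> in the statement.\<close>
    have "card (carrier (alt_group n)) = 1" using alt_group_card_carrier[of n] 1 by simp
    moreover have "id \<in> carrier (alt_group n)" unfolding alt_group_carrier by (intro conjI permutes_id) simp
    ultimately have "carrier (alt_group n) = {id}" by (metis card_1_singletonE singletonD)
    then have "kers = {carrier (sym_group n), carrier (alt_group n)}" using 1 by (simp add: kers_def)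
    then show ?thesis using sum d(1) 1 ck by simp
  next
    case 2
    then have "kers = {carrier (sym_group n), carrier (alt_group n), {id}}" by (simp add: kers_def)
    then show ?thesis using sum d(1-3) 2 ck by simp
  next
    case 3
    then have "kers = {carrier (sym_group n), carrier (alt_group n), {id}, klein_four}" by (auto simp: kers_def)
    moreover have "card (A klein_four) = card (epis H (sym_group 3))"
      using card_subdirect_sym_group_fst_kernel(4)[OF H] 3 by (simp add: A_def)
    ultimately show ?thesis using sum d 3 ck by simp
  qed
qed

text \<open>The kernel is a proper normal subgroup. \<open>A_a\<close> is generated by elements of
  order 3, which have value 1. On \<open>klein_four\<close> the character is constant on the three
  conjugate involutions, and each is the product of the other two.\<close>

lemma character_trivial_on_fst_kernel:
  assumes P: "subdirect P (sym_group a) (sym_group b)" and nfull: "P \<noteq> carrier (sym_group a) \<times> carrier (sym_group b)"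
    and f: "f \<in> hom ((sym_group a \<times>\<times> sym_group b)\<lparr>carrier := P\<rparr>) sign_img" and x: "(x, id) \<in> P"
  shows "f (x, id) = 1"
proof -
  let ?K = "(sym_group a \<times>\<times> sym_group b)\<lparr>carrier := P\<rparr>"
  note S = sym_group_is_group
  interpret f: group_hom ?K sign_img f
    using f subdirect_group(1)[OF S S P] sign_img_is_group by (simp add: group_hom_def group_hom_axioms_def)
  have mult: "f (u \<circ> u', v \<circ> v') = f (u, v) * f (u', v')" if "(u, v) \<in> P" "(u', v') \<in> P" for u v u' v'
    using f.hom_mult[of "(u, v)" "(u', v')"] that by (simp add: sym_group_mult sign_img_simps)
  have one: "f (id, id) = 1" using f.hom_one by (simp add: sym_group_one sign_img_simps)
  have val: "f d = 1 \<or> f d = -1" if "d \<in> P" for d using f.hom_closed[of d] that by (auto simp: sign_img_simps)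
  define N where "N = fst_kernel P (sym_group b)"
  have N: "N \<lhd> sym_group a" unfolding N_def by (rule fst_kernel_normal[OF S S P])
  note ND = normal_sym_groupD[OF N]
  have NP: "u \<in> N \<longleftrightarrow> (u, id) \<in> P" for u by (simp add: N_def fst_kernel_def sym_group_one)
  have m1: "f (u \<circ> v, id) = f (u, id) * f (v, id)" if "u \<in> N" "v \<in> N" for u v
    using mult[of u id v id] that by (simp add: NP)
  have xN: "x \<in> N" using x by (simp add: NP)
  have "N \<noteq> carrier (sym_group a)" using fst_kernel_full_iff[OF S S P] nfull by (simp add: N_def)
  then consider "N = {id}" | "N = carrier (alt_group a)" | "a = 4" "N = klein_four"
    using normal_sym_group_cases[OF N] by blast
  then show ?thesis
  proof cases
    case 1
    then have "x = id" using xN by blast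
    then show ?thesis using one by (simp only:)
  next
    case 2
    have cube: "h \<in> N \<and> f (h, id) = 1" if h: "h \<in> three_cycles a" for h
    proof
      show hN: "h \<in> N" using h three_cycles_incl 2 by blast
      obtain cs where cs: "h = cycle_of_list cs" "cycle cs" "length cs = 3" using h by auto
      obtain a' b' c' where cs_def: "cs = [a', b', c']" using stupid_lemma[OF cs(3)] by auto
      have "h \<circ> h \<circ> h = id" using cs(2) unfolding cs(1) cs_def by (auto simp: fun_eq_iff transpose_def)
      then have "f (h, id) * f (h, id) * f (h, id) = 1"
        using m1[OF hN hN] m1[OF ND(3)[OF hN hN] hN] one by simp
      moreover have "f (h, id) = 1 \<or> f (h, id) = -1" using val hN by (simp only: NP)
      ultimately show "f (h, id) = 1" by auto
    qed
    have "u \<in> N \<and> f (u, id) = 1" if "u \<in> generate (alt_group a) (three_cycles a)" for u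
      using that
    proof (induction rule: generate.induct)
      case one show ?case unfolding alt_group_one using ND(2) \<open>f (id, id) = 1\<close> by (intro conjI)
    next
      case (incl h) then show ?case by (rule cube)
    next
      case (inv h)
      then have h: "h \<in> carrier (alt_group a)" using three_cycles_incl by blast
      have hN: "h \<in> N" "inv' h \<in> N" "f (h, id) = 1" using cube[OF inv] ND(4) by blast+
      have "h \<circ> inv' h = id" using permutes_inv_o(1)[OF ND(1)[OF hN(1)]] .
      then have "f (h, id) * f (inv' h, id) = 1" using m1[OF hN(1,2)] one by simp
      then have "f (inv' h, id) = 1" unfolding hN(3) by simp
      then show ?case unfolding alt_group_inv_equality[OF h] using hN(2) by (intro conjI)
    next
      case (eng h1 h2)
      then have h: "h1 \<in> N" "h2 \<in> N" "f (h1, id) = 1" "f (h2, id) = 1" by blast+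
      have "f (h1 \<circ> h2, id) = 1" using m1[OF h(1,2)] unfolding h(3,4) by simp
      moreover have "h1 \<circ> h2 \<in> N" by (rule ND(3)[OF h(1,2)])
      ultimately show ?case unfolding alt_group_mult by (intro conjI)
    qed
    then show ?thesis using xN 2 alt_group_carrier_as_three_cycles by blast
  next
    case 3
    show ?thesis
    proof (cases "x = id")
      case True then show ?thesis using one by (simp only:)
    next
      case False
      have xk: "x \<in> klein_four" using xN 3 by simp
      \<comment> \<open>A point \<open>j\<close> other than 1 and \<open>x 1\<close> makes
        \<open>w\<close> different from both \<open>id\<close> and \<open>x\<close>, so that
        \<open>x = u \<circ> w\<close> with nontrivial \<open>u\<close> and
        \<open>w\<close>.\<close>
      have "card {1, x 1} < card {1..4::nat}" by (simp add: card_insert_if)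
      then have "\<not> {1..4} \<subseteq> {1, x 1}" by (meson card_mono finite.emptyI finite.insertI not_le)
      then obtain j where j: "j \<in> {1..4}" "j \<noteq> 1" "j \<noteq> x 1" by blast
      obtain w where w: "w \<in> klein_four" "w 1 = j" using klein_four_transitive[of 1 j] j(1) by auto
      define u where "u = x \<circ> w"
      have u: "u \<in> klein_four" unfolding u_def by (rule klein_four_comp[OF xk w(1)])
      have "w \<noteq> id" using w(2) j(2) by auto
      have ww: "w \<circ> w = id" using klein_fourD(2)[OF w(1)] by (simp add: fun_eq_iff)
      then have xuw: "x = u \<circ> w" by (simp add: u_def comp_assoc)
      have "u \<noteq> id"
      proof
        assume "u = id"
        then have "x 1 = w 1" using xuw by simp
        then show False using w(2) j(3) by simp
      qed
      then obtain g where g: "g permutes {1..4}" "u = g \<circ> w \<circ> inv' g"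
        using klein_four_conj[OF w(1) \<open>w \<noteq> id\<close> u] by blast
      \<comment> \<open>The conjugating \<open>g\<close> is lifted to an element of
        \<open>P\<close>, since \<open>(g, id)\<close> itself need not belong to
        \<open>P\<close>.\<close>
      obtain y where y: "(g, y) \<in> P"
        using subdirect_fst_ex[OF P, of g] g(1) 3(1) by (auto simp: sym_group_carrier)
      have uN: "u \<in> N" "w \<in> N" using u w 3 by simp_all
      have "u \<circ> g = g \<circ> w" unfolding g(2) by (simp add: fun_eq_iff permutes_inverses[OF g(1)])
      then have "f (u, id) * f (g, y) = f (g, y) * f (w, id)"
        using mult[of u id g y] mult[of g y w id] uN y by (simp only: NP comp_id id_comp)
      then have "f (u, id) = f (w, id)" using val[OF y] by auto
      then have "f (x, id) = f (w, id) * f (w, id)" using m1[OF uN] xuw by metis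
      moreover have "f (w, id) = 1 \<or> f (w, id) = -1" using val uN(2) by (simp only: NP)
      then have "f (w, id) * f (w, id) = 1" by auto
      ultimately show ?thesis by (simp only:)
    qed
  qed
qed

text \<open>Being trivial on the kernel of the second projection, the character factors through
  \<open>S_b\<close>, whose only nontrivial character is the sign.\<close>

lemma card_characters_subdirect_nonfull:
  assumes b: "b \<ge> 2" and P: "subdirect P (sym_group a) (sym_group b)"
    and nfull: "P \<noteq> carrier (sym_group a) \<times> carrier (sym_group b)"
  shows "card (epis ((sym_group a \<times>\<times> sym_group b)\<lparr>carrier := P\<rparr>) sign_img) = 1"
proof -
  let ?K = "(sym_group a \<times>\<times> sym_group b)\<lparr>carrier := P\<rparr>"
  note S = sym_group_is_group
  note K = subdirect_group[OF S S P]
  have "kernel ?K (sym_group b) (restrict snd P) \<subseteq> kernel ?K sign_img f" if f: "f \<in> epis ?K sign_img" for f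
    unfolding K(5)
    using character_trivial_on_fst_kernel[OF P nfull episD(1)[OF f]]
    by (auto simp: kernel_def sym_group_one sign_img_simps)
  then have "epis ?K sign_img = {f \<in> epis ?K sign_img. kernel ?K (sym_group b) (restrict snd P) \<subseteq> kernel ?K sign_img f}"
    by blast
  also have "\<dots> = pullback ?K (restrict snd P) ` epis (sym_group b) sign_img"
    by (rule epis_pullback(2)[OF K(1) S sign_img_is_group K(3), symmetric])
  finally show ?thesis unfolding epis_sym_group_sign_img[OF b] by simp
qed

text \<open>A character is the product of its restrictions to the factors, each trivial or the sign.
  The flags \<open>i\<close>, \<open>j\<close> record the choice, and both false is excluded by
  surjectivity.\<close>

lemma card_characters_full:
  assumes ab: "a \<ge> 2" "b \<ge> 2"
  shows "card (epis (sym_group a \<times>\<times> sym_group b) sign_img) = 3"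
proof -
  let ?K = "sym_group a \<times>\<times> sym_group b"
  note S = sym_group_is_group
  have K: "group ?K" by (intro DirProd_group S)
  define c where "c i j = restrict (\<lambda>(x, y). (if i then sign x else 1) * (if j then sign y else 1 :: int)) (carrier ?K)" for i j
  define t where "t = transpose 1 (2::nat)"
  have t: "t permutes {1..n}" if "n \<ge> 2" for n unfolding t_def using that by (intro permutes_swap_id) auto
  have st: "sign t = -1" by (simp add: t_def sign_swap_id)
  have ev: "c i j (x, y) = (if i then sign x else 1) * (if j then sign y else 1)"
    if "x permutes {1..a}" "y permutes {1..b}" for i j x y
    using that by (simp add: c_def sym_group_carrier)
  have cv: "c i j (t, id) = (if i then -1 else 1)" "c i j (id, t) = (if j then -1 else 1)" "c i j (id, id) = 1" for i j
    using ev[OF t[OF ab(1)] permutes_id, of i j] ev[OF permutes_id t[OF ab(2)], of i j]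
      ev[OF permutes_id permutes_id, of i j] unfolding sign_id st by simp_all
  have mem: "(t, id) \<in> carrier ?K" "(id, t) \<in> carrier ?K" "(id, id) \<in> carrier ?K"
    unfolding carrier_DirProd mem_Sigma_iff sym_group_carrier
    by (simp_all only: t[OF ab(1)] t[OF ab(2)] permutes_id simp_thms)
  have cE: "c i j \<in> epis ?K sign_img" if ij: "i \<or> j" for i j
    unfolding c_def restrict_in_epis_iff[OF K]
  proof
    show "(\<lambda>(x, y). (if i then sign x else 1) * (if j then sign y else 1)) \<in> hom ?K sign_img" (is "?h \<in> _")
    proof (rule homI)
      fix d assume "d \<in> carrier ?K"
      then show "?h d \<in> carrier sign_img"
        by (cases d, cases "fst d" rule: sign_cases; cases "snd d" rule: sign_cases) (simp_all add: sign_img_simps)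
    next
      fix d d' assume dd: "d \<in> carrier ?K" "d' \<in> carrier ?K"
      obtain x y x' y' where xy: "d = (x, y)" "d' = (x', y')" by (cases d, cases d')
      have "permutation x" "permutation x'" "permutation y" "permutation y'"
        using dd sym_group_carrier' unfolding xy by auto
      then show "?h (d \<otimes>\<^bsub>?K\<^esub> d') = ?h d \<otimes>\<^bsub>sign_img\<^esub> ?h d'"
        unfolding xy by (simp add: sym_group_mult sign_img_simps sign_compose)
    qed
    then have "?h ` carrier ?K \<subseteq> carrier sign_img" by (rule hom_carrier)
    moreover have "1 \<in> ?h ` carrier ?K" using mem(3) by (intro image_eqI[of _ _ "(id, id)"]) (simp_all only: case_prod_conv sign_id if_cancel mult_1)
    moreover have "-1 \<in> ?h ` carrier ?K"
    proof (cases i)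
      case True
      then show ?thesis using mem(1) by (intro image_eqI[of _ _ "(t, id)"]) (simp_all only: case_prod_conv sign_id if_cancel if_True st mult_1_right)
    next
      case False
      then show ?thesis using mem(2) ij by (intro image_eqI[of _ _ "(id, t)"]) (simp_all only: case_prod_conv sign_id if_cancel if_False if_True simp_thms st mult_1)
    qed
    ultimately show "?h ` carrier ?K = carrier sign_img"
      by (intro equalityI) (simp_all only: sign_img_simps insert_subset empty_subsetI simp_thms)
  qed
  have "epis ?K sign_img = {c True False, c False True, c True True}"
  proof (intro equalityI subsetI)
    fix f assume f: "f \<in> epis ?K sign_img"
    interpret f: group_hom ?K sign_img f by (rule epis_group_hom[OF f K sign_img_is_group])
    have mult: "f (u \<circ> u', v \<circ> v') = f (u, v) * f (u', v')"
      if "u permutes {1..a}" "u' permutes {1..a}" "v permutes {1..b}" "v' permutes {1..b}" for u v u' v'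
      using f.hom_mult[of "(u, v)" "(u', v')"] that by (simp only: mult_DirProd carrier_DirProd mem_Sigma_iff simp_thms sym_group_carrier sym_group_mult sign_img_simps)
    have val: "f (u, v) \<in> carrier sign_img" if "u permutes {1..a}" "v permutes {1..b}" for u v
      using f.hom_closed[of "(u, v)"] that by (simp add: sym_group_carrier)
    have "(\<lambda>x. f (x, id)) \<in> hom (sym_group a) sign_img"
      by (rule homI) (use val mult[of _ _ id id] in \<open>simp_all only: sym_group_carrier sym_group_mult permutes_id id_comp sign_img_simps\<close>)
    then obtain i where i: "\<And>x. x permutes {1..a} \<Longrightarrow> f (x, id) = (if i then sign x else 1)"
      using sym_group_character[of "\<lambda>x. f (x, id)" a] by metis
    have "(\<lambda>y. f (id, y)) \<in> hom (sym_group b) sign_img"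
      by (rule homI) (use val mult[of id id] in \<open>simp_all only: sym_group_carrier sym_group_mult permutes_id id_comp sign_img_simps\<close>)
    then obtain j where j: "\<And>y. y permutes {1..b} \<Longrightarrow> f (id, y) = (if j then sign y else 1)"
      using sym_group_character[of "\<lambda>y. f (id, y)" b] by metis
    have "f (x, y) = c i j (x, y)" if "x permutes {1..a}" "y permutes {1..b}" for x y
      using mult[OF that(1) permutes_id permutes_id that(2)] i[OF that(1)] j[OF that(2)] ev[OF that, of i j]
      by (simp only: comp_id id_comp)
    then have eq: "f = c i j"
      using episD(2)[OF f] by (intro extensionalityI[of _ "carrier ?K"]) (auto simp: sym_group_carrier c_def)
    have "i \<or> j"
    proof (rule ccontr)
      assume "\<not> (i \<or> j)"
      then have "f ` carrier ?K \<subseteq> {1}" using ev unfolding eq by (auto simp: sym_group_carrier)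
      then show False using episD(3)[OF f] by (auto simp: sign_img_simps)
    qed
    then show "f \<in> {c True False, c False True, c True True}" unfolding eq by (cases i; cases j) simp_all
  next
    fix f assume "f \<in> {c True False, c False True, c True True}"
    then consider "f = c True False" | "f = c False True" | "f = c True True" by blast
    then show "f \<in> epis ?K sign_img" by cases (use cE in \<open>simp_all only: simp_thms\<close>)
  qed
  moreover have "c True False (t, id) \<noteq> c False True (t, id)" "c True False (id, t) \<noteq> c True True (id, t)"
      "c False True (t, id) \<noteq> c True True (t, id)"
    unfolding cv by simp_all
  then have "c True False \<noteq> c False True" "c True False \<noteq> c True True" "c False True \<noteq> c True True"
    by metis+
  ultimately show ?thesis by simp
qed

text \<open>The kernels of the two projections commute elementwise. If an epimorphism killed
  neither, both images would be nontrivial normal subgroups and contain \<open>A_n\<close>, which is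
  not abelian.\<close>

lemma epis_subdirect_sym_group:
  assumes n: "n \<ge> 5" and P: "subdirect P (sym_group a) (sym_group b)"
  defines "K \<equiv> (sym_group a \<times>\<times> sym_group b)\<lparr>carrier := P\<rparr>"
  shows "epis K (sym_group n) = pullback K (restrict fst P) ` epis (sym_group a) (sym_group n) \<union>
    pullback K (restrict snd P) ` epis (sym_group b) (sym_group n)"
proof -
  note S = sym_group_is_group
  note KP = subdirect_group[OF S S P, folded K_def]
  let ?k1 = "kernel K (sym_group a) (restrict fst P)" and ?k2 = "kernel K (sym_group b) (restrict snd P)"
  have "?k1 \<subseteq> kernel K (sym_group n) f \<or> ?k2 \<subseteq> kernel K (sym_group n) f" if f: "f \<in> epis K (sym_group n)" for f
  proof (rule ccontr)
    assume not: "\<not> ?thesis"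
    interpret f: group_hom K "sym_group n" f by (rule epis_group_hom[OF f KP(1) S])
    have alt: "carrier (alt_group n) \<subseteq> f ` k" if k: "k \<lhd> K" and nk: "\<not> k \<subseteq> kernel K (sym_group n) f" for k
    proof -
      have sub: "k \<subseteq> carrier K" using k by (simp add: normal_imp_subgroup subgroup.subset)
      have "f ` k \<lhd> sym_group n" 
        by (rule normal.surj_hom_normal_subgroup[OF k f.group_hom_axioms episD(3)[OF f]])
      moreover have "f ` k \<noteq> {id}"
        using nk sub unfolding kernel_def sym_group_one by blast
      moreover have "carrier (alt_group n) \<subseteq> carrier (sym_group n)" by (auto simp: alt_group_carrier sym_group_carrier)
      ultimately show ?thesis using normal_sym_group_cases[of "f ` k" n] n by auto
    qed
    have c: "p \<circ> q \<in> carrier (alt_group n)" if "p = transpose u v" "q = transpose v w" "u \<noteq> v" "v \<noteq> w" "{u, v, w} \<subseteq> {1..n}" for p q u v w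
    proof -
      have "p \<circ> q permutes {1..n}" unfolding that(1,2) using that(5) by (intro permutes_compose permutes_swap_id) auto
      moreover have "evenperm (p \<circ> q)" unfolding that(1,2) using that(3,4)
        by (simp add: evenperm_comp permutation_swap_id evenperm_swap)
      ultimately show ?thesis unfolding alt_group_carrier by blast
    qed
    \<comment> \<open>The 3-cycles \<open>1 -> 2 -> 3\<close> and \<open>1 -> 2 -> 4\<close>; their
      products in the two orders send 1 to 3 and to 4.\<close>
    define p q where "p = transpose 1 2 \<circ> transpose 2 (3::nat)" and "q = transpose 1 2 \<circ> transpose 2 (4::nat)"
    have "p \<in> carrier (alt_group n)" "q \<in> carrier (alt_group n)"
      unfolding p_def q_def using n by (auto intro!: c[OF refl refl])
    then have "p \<in> f ` ?k1" "q \<in> f ` ?k2"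
      using not alt[OF epis_kernel_normal[OF KP(2,1) S]] alt[OF epis_kernel_normal[OF KP(3,1) S]] by blast+
    then obtain d e where de: "d \<in> ?k1" "p = f d" "e \<in> ?k2" "q = f e" by blast
    then have "d \<in> P" "fst d = id" "e \<in> P" "snd e = id" unfolding KP(4,5) sym_group_one by auto
    then have "d \<otimes>\<^bsub>K\<^esub> e = e \<otimes>\<^bsub>K\<^esub> d" by (simp add: K_def mult_DirProd' sym_group_mult)
    moreover have "d \<in> carrier K" "e \<in> carrier K" using de(1,3) by (auto simp: kernel_def)
    ultimately have "p \<circ> q = q \<circ> p" unfolding de(2,4) using f.hom_mult[of d e] f.hom_mult[of e d] by (simp add: sym_group_mult)
    then have "(p \<circ> q) 1 = (q \<circ> p) 1" by simp
    then show False by (simp add: p_def q_def transpose_def)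
  qed
  then have "epis K (sym_group n) = {f \<in> epis K (sym_group n). ?k1 \<subseteq> kernel K (sym_group n) f} \<union>
      {f \<in> epis K (sym_group n). ?k2 \<subseteq> kernel K (sym_group n) f}" by blast
  then show ?thesis
    unfolding epis_pullback(2)[OF KP(1) S S KP(2)] epis_pullback(2)[OF KP(1) S S KP(3)] .
qed

section \<open>The count\<close>

text \<open>A factor of degree below \<open>n\<close> is too small to map onto \<open>S_n\<close>.
  For equal degrees a trivial kernel means that \<open>P\<close> is the graph of an automorphism, so
  both projections yield the same epimorphisms; otherwise the two families are disjoint.\<close>

lemma card_epis_subdirect_sym_group:
  assumes n: "n \<ge> 5" and P: "subdirect P (sym_group a) (sym_group b)" and ab: "a \<le> n" "b \<le> a"
  shows "card (epis ((sym_group a \<times>\<times> sym_group b)\<lparr>carrier := P\<rparr>) (sym_group n)) =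
    (if a < n then 0 else if b < n \<or> fst_kernel P (sym_group b) = {id} then card (auts n) else 2 * card (auts n))"
proof -
  note S = sym_group_is_group
  define K where "K = (sym_group a \<times>\<times> sym_group b)\<lparr>carrier := P\<rparr>"
  note KP = subdirect_group[OF S S P, folded K_def]
  have cK: "carrier K = P" by (simp add: K_def)
  let ?A = "pullback K (restrict fst P) ` epis (sym_group a) (sym_group n)"
  let ?B = "pullback K (restrict snd P) ` epis (sym_group b) (sym_group n)"
  have un: "epis K (sym_group n) = ?A \<union> ?B" unfolding K_def by (rule epis_subdirect_sym_group[OF n P])
  have cA: "card ?A = card (epis (sym_group a) (sym_group n))"
    by (rule card_image[OF epis_pullback(1)[OF KP(1) S S KP(2)]])
  have cB: "card ?B = card (epis (sym_group b) (sym_group n))"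
    by (rule card_image[OF epis_pullback(1)[OF KP(1) S S KP(3)]])
  have e0: "epis (sym_group m) (sym_group n) = {}" if "m < n" for m
    by (rule epis_sym_group_empty[OF that]) (use n in simp)
  consider "a < n" | "a = n" "b < n" | "a = n" "b = n" using ab by linarith
  then have "card (epis K (sym_group n)) =
    (if a < n then 0 else if b < n \<or> fst_kernel P (sym_group b) = {id} then card (auts n) else 2 * card (auts n))"
  proof cases
    case 1
    then show ?thesis using un e0[of a] e0[of b] ab by simp
  next
    case 2
    then show ?thesis using un e0[of b] cA by simp
  next
    case 3
    have fin: "finite ?A" "finite ?B" by (auto intro!: finite_epis)
    show ?thesis
    proof (cases "fst_kernel P (sym_group b) = {id}")
      case True
      have "{d \<in> P. snd d = id} \<subseteq> {(id, id)}"
      proof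
        fix d assume d: "d \<in> {d \<in> P. snd d = id}"
        then have "fst d \<in> fst_kernel P (sym_group b)" unfolding fst_kernel_def sym_group_one by (cases d) auto
        then show "d \<in> {(id, id)}" using True d by (cases d) simp
      qed
      moreover have "f (id, id) = id" if "f \<in> epis K (sym_group n)" for f
      proof -
        interpret f: group_hom K "sym_group n" f by (rule epis_group_hom[OF that KP(1) S])
        show ?thesis using f.hom_one by (simp add: K_def sym_group_one)
      qed
      moreover have "(id, id) \<in> P" using subdirect_one[OF P] unfolding sym_group_one .
      ultimately have "kernel K (sym_group b) (restrict snd P) \<subseteq> kernel K (sym_group n) f"
        if "f \<in> epis K (sym_group n)" for f
        unfolding KP(5) using that by (auto simp: kernel_def sym_group_one cK)
      then have "epis K (sym_group n) = {f \<in> epis K (sym_group n). kernel K (sym_group b) (restrict snd P) \<subseteq> kernel K (sym_group n) f}"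
        by blast
      also have "\<dots> = ?B" by (rule epis_pullback(2)[OF KP(1) S S KP(3), symmetric])
      finally show ?thesis using cB 3 True by simp
    next
      case False
      \<comment> \<open>Evaluating a common member at \<open>(x, id)\<close> gives
        \<open>f x = g id = id\<close>, which forces \<open>x = id\<close> for all \<open>x\<close>
        in the kernel.\<close>
      have "?A \<inter> ?B = {}"
      proof (rule ccontr)
        assume "?A \<inter> ?B \<noteq> {}"
        then obtain f g where f: "f \<in> auts n" and g: "g \<in> auts n"
          and eq: "pullback K (restrict fst P) f = pullback K (restrict snd P) g"
          using 3 by blast
        have "x = id" if "x \<in> fst_kernel P (sym_group b)" for x
        proof -
          have xP: "(x, id) \<in> P" using that unfolding fst_kernel_def sym_group_one by simp
          then have px: "x permutes {1..n}" using subdirect_carrier(1)[OF P xP] 3 by (simp add: sym_group_carrier)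
          have "f x = g id" using fun_cong[OF eq, of "(x, id)"] xP by (simp add: cK)
          then have "f x = f id" unfolding autsD(3)[OF f] autsD(3)[OF g] .
          then show ?thesis using autsD(5)[OF f px permutes_id] by blast
        qed
        moreover have "id \<in> fst_kernel P (sym_group b)"
          using subdirect_one[OF P] unfolding fst_kernel_def sym_group_one by simp
        ultimately show False using False by blast
      qed
      then have "card (epis K (sym_group n)) = card ?A + card ?B" unfolding un by (rule card_Un_disjoint[OF fin])
      then show ?thesis using cA cB 3 False by simp
    qed
  qed
  then show ?thesis unfolding K_def .
qed

text \<open>Here \<open>p\<close> is the number of subdirect \<open>P\<close> in the last two
  factors, and \<open>k\<close> the number of those with trivial kernel. The term
  \<open>2 * p + 2\<close> collects the kernels \<open>S_n1\<close> and \<open>A_n1\<close>, the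
  rest the trivial kernel.\<close>

lemma num_subdirect_sum:
  assumes n: "n1 \<ge> n2" "n2 \<ge> n3" "n3 \<ge> 2" "n1 \<ge> 5"
  defines "p \<equiv> 2 + (if n2 \<ge> 3 then card (epis (sym_group n3) (sym_group n2)) else 0)
      + (if n2 = 4 then card (epis (sym_group n3) (sym_group 3)) else 0)"
  defines "k \<equiv> card (epis (sym_group n3) (sym_group n2))"
  shows "num_subdirect n1 n2 n3 = 2 * p + 2 +
    (if n2 < n1 then 0 else if n3 < n1 then p * card (auts n1)
     else k * card (auts n1) + (p - k) * (2 * card (auts n1)))"
proof -
  note S = sym_group_is_group
  let ?S1 = "sym_group n1" and ?S2 = "sym_group n2" and ?S3 = "sym_group n3"
  define PP where "PP = {P. subdirect P ?S2 ?S3}"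
  have finPP: "finite PP" unfolding PP_def by (intro finite_subdirect) simp_all
  define K where "K P = (?S2 \<times>\<times> ?S3)\<lparr>carrier := P\<rparr>" for P
  have "card (epis ?S3 sign_img) = 1" unfolding epis_sym_group_sign_img[OF n(3)] by simp
  then have cP: "card PP = p"
    unfolding PP_def p_def using card_subdirect_sym_group[OF _ S finite_sym_group, of n2 n3] n by simp
  have each: "card {D. subdirect D ?S1 (K P)} = 1 + card (epis (K P) sign_img) + card (epis (K P) ?S1)" if P: "P \<in> PP" for P
  proof -
    have sub: "subdirect P ?S2 ?S3" using P by (simp add: PP_def)
    have "finite P" by (rule finite_subset[OF subdirect_subset[OF sub]]) simp
    then have "finite (carrier (K P))" by (simp add: K_def)
    then show ?thesis
      using card_subdirect_sym_group[OF _ subdirect_group(1)[OF S S sub], of n1] n by (simp add: K_def)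
  qed
  define full where "full = carrier ?S2 \<times> carrier ?S3"
  have fullP: "full \<in> PP" unfolding full_def PP_def using subdirect_full[OF S S] by simp
  have "K full = ?S2 \<times>\<times> ?S3" by (simp add: K_def full_def DirProd_def)
  then have chf: "card (epis (K full) sign_img) = 3" using card_characters_full[of n2 n3] n by simp
  have chn: "card (epis (K P) sign_img) = 1" if "P \<in> PP - {full}" for P
    using card_characters_subdirect_nonfull[OF n(3)] that by (simp add: K_def PP_def full_def)
  have "(\<Sum>P\<in>PP. 1 + card (epis (K P) sign_img)) =
      (1 + card (epis (K full) sign_img)) + (\<Sum>P\<in>PP - {full}. 1 + card (epis (K P) sign_img))"
    by (rule sum.remove[OF finPP fullP])
  also have "\<dots> = 4 + 2 * card (PP - {full})" using chf chn by simp
  also have "\<dots> = 2 * p + 2" using cP finPP fullP card_gt_0_iff[of PP] by (auto simp: card_Diff_singleton)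
  finally have s1: "(\<Sum>P\<in>PP. 1 + card (epis (K P) sign_img)) = 2 * p + 2" .
  have ep: "card (epis (K P) ?S1) = (if n2 < n1 then 0
      else if n3 < n1 \<or> fst_kernel P ?S3 = {id} then card (auts n1) else 2 * card (auts n1))" if "P \<in> PP" for P
    using card_epis_subdirect_sym_group[OF n(4) _ n(1,2)] that by (simp only: K_def PP_def mem_Collect_eq)
  have s2: "(\<Sum>P\<in>PP. card (epis (K P) ?S1)) = (if n2 < n1 then 0 else if n3 < n1 then p * card (auts n1)
     else k * card (auts n1) + (p - k) * (2 * card (auts n1)))"
  proof (cases "n3 < n1")
    case True
    then show ?thesis using ep cP by simp
  next
    case False
    then have eq: "n2 = n1" "n3 = n1" using n by auto
    define G where "G = {P \<in> PP. fst_kernel P ?S3 = {id}}"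
    have G: "G \<subseteq> PP" "card G = k"
      using card_subdirect_sym_group_fst_kernel(3)[OF S, of n2 n3] by (auto simp: G_def PP_def k_def)
    have "(\<Sum>P\<in>PP. card (epis (K P) ?S1)) = (\<Sum>P\<in>PP - G. card (epis (K P) ?S1)) + (\<Sum>P\<in>G. card (epis (K P) ?S1))"
      by (rule sum.subset_diff[OF G(1) finPP])
    also have "(\<Sum>P\<in>G. card (epis (K P) ?S1)) = k * card (auts n1)"
      using ep eq G(2) by (simp add: G_def)
    also have "(\<Sum>P\<in>PP - G. card (epis (K P) ?S1)) = (\<Sum>P\<in>PP - G. 2 * card (auts n1))"
      by (rule sum.cong) (use ep eq in \<open>auto simp: G_def\<close>)
    also have "\<dots> = (p - k) * (2 * card (auts n1))"
      using cP G finPP by (simp add: card_Diff_subset finite_subset)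
    finally show ?thesis using eq by simp
  qed
  have "num_subdirect n1 n2 n3 = (\<Sum>P\<in>PP. card {D. subdirect D ?S1 (K P)})"
    unfolding num_subdirect_def PP_def K_def by (rule card_subdirect_product3) (simp_all add: S)
  also have "\<dots> = (\<Sum>P\<in>PP. (1 + card (epis (K P) sign_img)) + card (epis (K P) ?S1))"
    by (rule sum.cong) (simp_all add: each)
  also have "\<dots> = (\<Sum>P\<in>PP. 1 + card (epis (K P) sign_img)) + (\<Sum>P\<in>PP. card (epis (K P) ?S1))"
    by (rule sum.distrib)
  finally show ?thesis unfolding s1 s2 .
qed

text \<open>With \<open>p\<close> evaluated in each case, the pattern \<open>n1 = n2 > n3\<close>
  (two epimorphism families, \<open>p = 2\<close>) and the pattern
  \<open>n1 > n2 = n3 \<ge> 5\<close> (\<open>p = 2 + card (auts n2)\<close>) happen to give the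
  same value.\<close>

lemma num_subdirect_cases:
  assumes n: "n1 \<ge> n2" "n2 \<ge> n3" "n3 \<ge> 2" "n1 \<ge> 5"
  shows "num_subdirect n1 n2 n3 =
    (if n1 = n2 \<and> n2 = n3 then (card (auts n1))\<^sup>2 + 6 * card (auts n1) + 6
     else if n1 = n2 \<or> n2 = n3 \<and> n2 \<ge> 5 then 2 * card (auts n2) + 6
     else if n2 = 4 \<and> n3 = 4 then 66
     else if (n2 = 3 \<or> n2 = 4) \<and> n3 = 3 then 18
     else 6)"
proof -
  note sum = num_subdirect_sum[OF n]
  have e0: "epis (sym_group m) (sym_group k) = {}" if "m < k" "k \<ge> 2" for m k
    by (rule epis_sym_group_empty[OF that])
  have a3: "card (auts 3) = 6" and a4: "card (auts 4) = 24"
    using card_auts[of 3] card_auts[of 4] by (simp_all add: fact_numeral)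
  have "n1 = n2 \<or> n2 < n1" "n2 = n3 \<or> n3 < n2"
    "n2 = 2 \<or> n2 = 3 \<or> n2 = 4 \<or> n2 \<ge> 5" "n3 = 2 \<or> n3 = 3 \<or> n3 \<ge> 4"
    using n by arith+
  then consider "n1 = n2" "n2 = n3" | "n1 = n2" "n3 < n2" | "n2 < n1" "n2 = n3" "n2 \<ge> 5"
    | "n2 < n1" "n2 = 4" "n3 = 4" | "n2 < n1" "n2 = 4" "n3 = 3" | "n2 < n1" "n2 = 4" "n3 = 2"
    | "n2 < n1" "n2 = 3" "n3 = 3" | "n2 < n1" "n2 = 3" "n3 = 2" | "n2 < n1" "n2 = 2" "n3 = 2"
    | "n2 < n1" "n3 < n2" "n2 \<ge> 5"
    by (elim disjE) (simp_all, linarith?)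
  then show ?thesis
  proof cases
    case 1
    then show ?thesis using sum n by (simp add: power2_eq_square algebra_simps)
  next
    case 2
    then show ?thesis using sum n e0[of n3 n2] by simp
  next
    case 3
    then show ?thesis using sum n by simp
  next
    case 4
    then show ?thesis using sum n a4 card_epis_sym_group_4_3 by simp
  next
    case 5
    then show ?thesis using sum n a3 e0[of 3 4] by simp
  next
    case 6
    then show ?thesis using sum n e0[of 2 3] e0[of 2 4] by simp
  next
    case 7
    then show ?thesis using sum n a3 by simp
  next
    case 8
    then show ?thesis using sum n e0[of 2 3] by simp
  next
    case 9
    then show ?thesis using sum n by simp
  next
    case 10
    then show ?thesis using sum n e0[of n3 n2] by simp
  qed
qed

theorem corollary4p4:
  fixes n1 n2 n3 :: nat
  assumes "n1 \<ge> n2" and "n2 \<ge> n3" and "n3 \<ge> 2" and "n1 \<ge> 5"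
  shows
    "(n1 = n2 \<and> n2 = n3 \<and> n3 \<noteq> 6 \<longrightarrow>
        num_subdirect n1 n2 n3 = (fact n1)^2 + 6 * fact n1 + 6) \<and>
     (n1 = n2 \<and> n2 = n3 \<and> n3 = 6 \<longrightarrow> num_subdirect n1 n2 n3 = 2082246) \<and>
     (n2 = n3 \<and> n3 = 4 \<longrightarrow> num_subdirect n1 n2 n3 = 66) \<and>
     (n2 \<in> {3, 4} \<and> n3 = 3 \<longrightarrow> num_subdirect n1 n2 n3 = 18) \<and>
     (\<forall>m2. {#n1, n2, n3#} = {#6, 6, m2#} \<and> m2 \<noteq> 6 \<longrightarrow>
        num_subdirect n1 n2 n3 = 2886) \<and>
     (\<forall>m1 m2. {#n1, n2, n3#} = {#m1, m1, m2#} \<and> m1 \<noteq> m2 \<and> 6 \<noteq> m1 \<and> m1 \<ge> 5 \<longrightarrow>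
        num_subdirect n1 n2 n3 = 2 * fact m1 + 6) \<and>
     (\<not> (n1 = n2 \<and> n2 = n3 \<and> n3 \<noteq> 6) \<and>
      \<not> (n1 = n2 \<and> n2 = n3 \<and> n3 = 6) \<and>
      \<not> (n2 = n3 \<and> n3 = 4) \<and>
      \<not> (n2 \<in> {3, 4} \<and> n3 = 3) \<and>
      \<not> (\<exists>m2. {#n1, n2, n3#} = {#6, 6, m2#} \<and> m2 \<noteq> 6) \<and>
      \<not> (\<exists>m1 m2. {#n1, n2, n3#} = {#m1, m1, m2#} \<and> m1 \<noteq> m2 \<and> 6 \<noteq> m1 \<and> m1 \<ge> 5) \<longrightarrow>
        num_subdirect n1 n2 n3 = 6)"
proof -
  note num = num_subdirect_cases[OF assms]
  have aut: "card (auts m) = (if m = 6 then 1440 else fact m)" if "m \<ge> 5" for m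
    using card_auts[of m] card_auts_6 that by simp
  \<comment> \<open>The degrees are sorted, so the odd one out is last or first; in the middle it
    would have to equal the others.\<close>
  have pair: "(n1 = m \<and> n2 = m \<and> n3 = m' \<or> n2 = m \<and> n3 = m \<and> n1 = m')"
    if "{#n1, n2, n3#} = {#m, m, m'#}" for m m'
  proof -
    have c: "count {#n1, n2, n3#} x = count {#m, m, m'#} x" for x using that by simp
    show ?thesis
    proof (cases "n1 = m")
      case True
      then have "{#n2, n3#} = {#m, m'#}" using that by simp
      then have "n2 = m \<and> n3 = m' \<or> n2 = m' \<and> n3 = m" by (auto simp: add_eq_conv_ex)
      then show ?thesis using True assms(1,2) by linarith
    next
      case False
      then have "n2 = m" "n3 = m" using c[of m] by (auto split: if_splits)
      moreover have "n1 = m'" using c[of n1] False calculation by (simp split: if_splits)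
      ultimately show ?thesis by simp
    qed
  qed
  show ?thesis
  proof (intro conjI allI impI; (elim conjE)?)
    assume "n1 = n2" "n2 = n3" "n3 \<noteq> 6"
    then show "num_subdirect n1 n2 n3 = (fact n1)^2 + 6 * fact n1 + 6" using num aut[of n1] assms by simp
  next
    assume "n1 = n2" "n2 = n3" "n3 = 6"
    then show "num_subdirect n1 n2 n3 = 2082246" using num aut[of 6] by simp
  next
    assume "n2 = n3" "n3 = 4"
    then show "num_subdirect n1 n2 n3 = 66" using num assms by simp
  next
    assume "n2 \<in> {3, 4}" "n3 = 3"
    then show "num_subdirect n1 n2 n3 = 18" using num assms by auto
  next
    fix m2 assume "{#n1, n2, n3#} = {#6, 6, m2#}" "m2 \<noteq> 6"
    then show "num_subdirect n1 n2 n3 = 2886" using num aut[of 6] pair[of 6 m2] by auto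
  next
    fix m1 m2 assume "{#n1, n2, n3#} = {#m1, m1, m2#}" "m1 \<noteq> m2" "6 \<noteq> m1" "m1 \<ge> 5"
    then show "num_subdirect n1 n2 n3 = 2 * fact m1 + 6" using num aut[of m1] pair[of m1 m2] by auto
  next
    assume a: "\<not> (n1 = n2 \<and> n2 = n3 \<and> n3 \<noteq> 6)" "\<not> (n1 = n2 \<and> n2 = n3 \<and> n3 = 6)" "\<not> (n2 = n3 \<and> n3 = 4)"
      "\<not> (n2 \<in> {3, 4} \<and> n3 = 3)" "\<not> (\<exists>m2. {#n1, n2, n3#} = {#6, 6, m2#} \<and> m2 \<noteq> 6)"
      "\<not> (\<exists>m1 m2. {#n1, n2, n3#} = {#m1, m1, m2#} \<and> m1 \<noteq> m2 \<and> 6 \<noteq> m1 \<and> m1 \<ge> 5)"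
    have "\<not> (n1 = n2 \<and> n2 = n3)" using a(1,2) by blast
    moreover have "n1 \<noteq> n2"
    proof
      assume "n1 = n2"
      moreover have "n3 \<noteq> n1" using \<open>\<not> (n1 = n2 \<and> n2 = n3)\<close> \<open>n1 = n2\<close> by simp
      ultimately show False using a(5,6) assms(4) by (cases "n1 = 6") auto
    qed
    moreover have "\<not> (n2 = n3 \<and> n2 \<ge> 5)"
    proof
      assume eq: "n2 = n3 \<and> n2 \<ge> 5"
      then have ms: "{#n1, n2, n3#} = {#n2, n2, n1#}" by simp
      show False
      proof (cases "n2 = 6")
        case True
        then show ?thesis using a(5) ms \<open>n1 \<noteq> n2\<close> by metis
      next
        case False
        then show ?thesis using a(6) ms \<open>n1 \<noteq> n2\<close> eq by metis
      qed
    qed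
    ultimately show "num_subdirect n1 n2 n3 = 6" using num a(3,4) by auto
  qed
qed

end
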